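(* Let $M$ be a Dupin cyclide. The Darboux curves of $M$ are the leaves of the foliations $\mathcal F_\alpha^+$ and $\mathcal F_\alpha^-$, $\alpha\in(-\pi/2,\pi/2]$.
   Context: A Dupin cyclide is a surface (in $S^3$ or $\mathbb R^3$) which is in two different ways the envelope of a one-parameter family of spheres; up to a conformal (Möbius) map it is (part of) one of: the boundary of a tubular neighborhood of a geodesic of $S^3$, a cylinder of revolution in $\mathbb R^3$, a cone of revolution in $\mathbb R^3$ (singular points removed). Let $\mathcal P_1,\mathcal P_2$ be the principal foliations (lines of curvature) of a surface free of umbilics. For each $\alpha$, $\mathcal F_\alpha^{\pm}$ is the foliation whose leaves make constant angle $\pm\alpha$ with the leaves of $\mathcal P_1$. A Darboux curve on a surface $M$ is a curve such that at each point its osculating sphere (sphere or plane with contact of order at least 3) is tangent to $M$; equivalently, $k_n'+\tau_gk_g=0$ (normal curvature, geodesic torsion, geodesic curvature; $'$ is the derivative with respect to arc length). The definition is conformally invariant. *)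

theory Defs
  imports "HOL-Analysis.Analysis"
begin

text \<open>
  The two ambient geometries are treated at once: the Euclidean space of dimension 3, and the
  unit sphere \<open>S\<^sup>3\<close> of a Euclidean space of dimension 4.
\<close>

definition ambient_space :: "'a::euclidean_space set \<Rightarrow> bool" where
  "ambient_space Q \<longleftrightarrow>
     (DIM('a) = 3 \<and> Q = UNIV) \<or> (DIM('a) = 4 \<and> Q = sphere 0 1)"


text \<open>Continuously differentiable maps of order \<open>k\<close>; only used on open sets \<open>U\<close>.\<close>

primrec Ck_on :: "nat \<Rightarrow> 'a::euclidean_space set \<Rightarrow> ('a \<Rightarrow> 'b::real_normed_vector) \<Rightarrow> bool" where
  "Ck_on 0 U f \<longleftrightarrow> continuous_on U f"
| "Ck_on (Suc k) U f \<longleftrightarrow>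
     f differentiable_on U \<and> (\<forall>v. Ck_on k U (\<lambda>x. frechet_derivative f (at x) v))"

definition smooth_on :: "'a::euclidean_space set \<Rightarrow> ('a \<Rightarrow> 'b::real_normed_vector) \<Rightarrow> bool" where
  "smooth_on U f \<longleftrightarrow> (\<forall>k. Ck_on k U f)"


definition regular_surface :: "'a::euclidean_space set \<Rightarrow> bool" where
  "regular_surface M \<longleftrightarrow>
     (\<forall>p\<in>M. \<exists>(U :: (real^2) set) V x y.
        open U \<and> open V \<and> p \<in> V \<and> homeomorphism U (M \<inter> V) x y \<and> smooth_on U x \<and>
        (\<forall>u\<in>U. inj (frechet_derivative x (at u))))"

text \<open>Velocities at \<open>p\<close> of the curves lying in \<open>X\<close>.\<close>

definition tangent_space :: "'a::euclidean_space set \<Rightarrow> 'a \<Rightarrow> 'a set" where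
  "tangent_space X p =
     {v. \<exists>c \<epsilon>. \<epsilon> > (0::real) \<and> c ` {-\<epsilon><..<\<epsilon>} \<subseteq> X \<and> c 0 = p \<and>
               (c has_vector_derivative v) (at 0)}"

definition unit_normal :: "'a::euclidean_space set \<Rightarrow> 'a set \<Rightarrow> 'a \<Rightarrow> 'a \<Rightarrow> bool" where
  "unit_normal Q M p n \<longleftrightarrow>
     n \<in> tangent_space Q p \<and> norm n = 1 \<and> (\<forall>v\<in>tangent_space M p. n \<bullet> v = 0)"

text \<open>
  Eigenvectors of the shape operator. For \<open>Q = S\<^sup>3\<close> no projection to \<open>T\<^sub>pS\<^sup>3\<close> is needed: as \<open>N\<close> and
  \<open>v\<close> are orthogonal to the position vector, so is the derivative of \<open>N\<close> along \<open>v\<close>.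
\<close>

definition principal_direction ::
    "'a::euclidean_space set \<Rightarrow> 'a set \<Rightarrow> 'a \<Rightarrow> 'a \<Rightarrow> bool" where
  "principal_direction Q M p v \<longleftrightarrow>
     v \<in> tangent_space M p \<and> v \<noteq> 0 \<and>
     (\<exists>N V k. open V \<and> p \<in> V \<and> smooth_on V N \<and> (\<forall>q\<in>M \<inter> V. unit_normal Q M q (N q)) \<and>
        frechet_derivative N (at p) v = - (k *\<^sub>R v))"

text \<open>
  A continuous field of principal lines. On a connected orientable surface free of umbilics there are
  exactly two of them, the tangent fields of \<open>\<P>\<^sub>1\<close> and \<open>\<P>\<^sub>2\<close>; which one is called
  \<open>\<P>\<^sub>1\<close> is left open.
\<close>

definition principal_foliation ::
    "'a::euclidean_space set \<Rightarrow> 'a set \<Rightarrow> ('a \<Rightarrow> 'a set) \<Rightarrow> bool" where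
  "principal_foliation Q M P \<longleftrightarrow>
     (\<forall>p\<in>M. \<exists>V e. open V \<and> p \<in> V \<and> continuous_on (M \<inter> V) e \<and>
        (\<forall>q\<in>M \<inter> V. principal_direction Q M q (e q) \<and> P q = span {e q}))"

text \<open>
  An orientation of \<open>M\<close>, given by the rotations of angle \<open>\<pi>/2\<close> in the tangent planes.
\<close>

definition surface_orientation ::
    "'a::euclidean_space set \<Rightarrow> ('a \<Rightarrow> 'a \<Rightarrow> 'a) \<Rightarrow> bool" where
  "surface_orientation M R \<longleftrightarrow>
     continuous_on (SIGMA p:M. tangent_space M p) (\<lambda>(p, v). R p v) \<and>
     (\<forall>p\<in>M. linear (R p) \<and>
        (\<forall>v\<in>tangent_space M p.
           R p v \<in> tangent_space M p \<and> norm (R p v) = norm v \<and> R p v \<bullet> v = 0))"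

text \<open>The line field at oriented angle \<open>\<alpha>\<close> with \<open>P\<close>, and its leaves.\<close>

definition angle_foliation ::
    "('a::euclidean_space \<Rightarrow> 'a \<Rightarrow> 'a) \<Rightarrow> ('a \<Rightarrow> 'a set) \<Rightarrow> real \<Rightarrow> 'a \<Rightarrow> 'a set" where
  "angle_foliation R P \<alpha> p = (\<lambda>e. cos \<alpha> *\<^sub>R e + sin \<alpha> *\<^sub>R R p e) ` P p"

definition unit_speed_curve ::
    "'a::euclidean_space set \<Rightarrow> real set \<Rightarrow> (real \<Rightarrow> 'a) \<Rightarrow> bool" where
  "unit_speed_curve M J \<gamma> \<longleftrightarrow>
     open J \<and> is_interval J \<and> J \<noteq> {} \<and> \<gamma> ` J \<subseteq> M \<and> Ck_on 3 J \<gamma> \<and>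
     (\<forall>s\<in>J. norm (vector_derivative \<gamma> (at s)) = 1)"

text \<open>Curves of the class \<open>C\<close> without proper extension to a larger interval.\<close>

definition inextendible ::
    "(real set \<Rightarrow> (real \<Rightarrow> 'a) \<Rightarrow> bool) \<Rightarrow> real set \<Rightarrow> (real \<Rightarrow> 'a) \<Rightarrow> bool" where
  "inextendible C J \<gamma> \<longleftrightarrow>
     C J \<gamma> \<and> (\<forall>J' \<gamma>'. C J' \<gamma>' \<and> J \<subseteq> J' \<and> (\<forall>s\<in>J. \<gamma>' s = \<gamma> s) \<longrightarrow> J' = J)"

definition integral_curve ::
    "'a::euclidean_space set \<Rightarrow> ('a \<Rightarrow> 'a set) \<Rightarrow> real set \<Rightarrow> (real \<Rightarrow> 'a) \<Rightarrow> bool" where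
  "integral_curve M F J \<gamma> \<longleftrightarrow>
     unit_speed_curve M J \<gamma> \<and> (\<forall>s\<in>J. vector_derivative \<gamma> (at s) \<in> F (\<gamma> s))"

definition leaf ::
    "'a::euclidean_space set \<Rightarrow> ('a \<Rightarrow> 'a set) \<Rightarrow> real set \<Rightarrow> (real \<Rightarrow> 'a) \<Rightarrow> bool" where
  "leaf M F = inextendible (integral_curve M F)"


text \<open>
  The triple \<open>(a, b, c)\<close> encodes the zero set in \<open>Q\<close> of \<open>a |x|\<^sup>2 + b \<bullet> x + c\<close>. If this zero set has
  at least two points and is not all of \<open>Q\<close>, it is a sphere or a plane when \<open>Q\<close> is the Euclidean
  space of dimension 3, and a (great or small) 2-sphere when \<open>Q = S\<^sup>3\<close>.
\<close>

definition sphere_fun :: "real \<times> 'a::euclidean_space \<times> real \<Rightarrow> 'a \<Rightarrow> real" where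
  "sphere_fun S x = (case S of (a, b, c) \<Rightarrow> a * (norm x)\<^sup>2 + b \<bullet> x + c)"

definition sphere_set :: "'a::euclidean_space set \<Rightarrow> real \<times> 'a \<times> real \<Rightarrow> 'a set" where
  "sphere_set Q S = {x \<in> Q. sphere_fun S x = 0}"

definition is_sphere :: "'a::euclidean_space set \<Rightarrow> real \<times> 'a \<times> real \<Rightarrow> bool" where
  "is_sphere Q S \<longleftrightarrow>
     (\<exists>x\<in>sphere_set Q S. \<exists>y\<in>sphere_set Q S. x \<noteq> y) \<and> sphere_set Q S \<noteq> Q"

definition tangent_at ::
    "'a::euclidean_space set \<Rightarrow> 'a set \<Rightarrow> real \<times> 'a \<times> real \<Rightarrow> 'a \<Rightarrow> bool" where
  "tangent_at Q M S p \<longleftrightarrow>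
     p \<in> M \<and> p \<in> sphere_set Q S \<and> tangent_space (sphere_set Q S) p = tangent_space M p"

definition contact_order_ge ::
    "nat \<Rightarrow> real \<times> 'a::euclidean_space \<times> real \<Rightarrow> (real \<Rightarrow> 'a) \<Rightarrow> real \<Rightarrow> bool" where
  "contact_order_ge k S \<gamma> s \<longleftrightarrow>
     (\<forall>i\<le>k. (deriv ^^ i) (\<lambda>t. sphere_fun S (\<gamma> t)) s = 0)"

text \<open>
  Where several spheres have contact of order at least 3 with the curve (for instance along an arc
  of a circle), one of them has to be tangent to \<open>M\<close>.
\<close>

definition darboux_curve ::
    "'a::euclidean_space set \<Rightarrow> 'a set \<Rightarrow> real set \<Rightarrow> (real \<Rightarrow> 'a) \<Rightarrow> bool" where
  "darboux_curve Q M J \<gamma> \<longleftrightarrow>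
     unit_speed_curve M J \<gamma> \<and>
     (\<forall>s\<in>J. \<exists>S. is_sphere Q S \<and> contact_order_ge 3 S \<gamma> s \<and> tangent_at Q M S (\<gamma> s))"


definition sphere_family ::
    "'a::euclidean_space set \<Rightarrow> real set \<Rightarrow> (real \<Rightarrow> real \<times> 'a \<times> real) \<Rightarrow> bool" where
  "sphere_family Q I \<S> \<longleftrightarrow>
     open I \<and> is_interval I \<and> smooth_on I \<S> \<and> (\<forall>t\<in>I. is_sphere Q (\<S> t))"

text \<open>
  \<open>M\<close> is (part of) the envelope of the family: each point \<open>q\<close> of \<open>M\<close> is a point of contact with a
  member of the family, whose parameter \<open>\<tau> q\<close> depends smoothly on \<open>q\<close>. The function \<open>\<tau>\<close> is only
  required locally, since families of spheres may be closed, with periodic parametrization.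
\<close>

definition envelope ::
    "'a::euclidean_space set \<Rightarrow> 'a set \<Rightarrow> real set \<Rightarrow> (real \<Rightarrow> real \<times> 'a \<times> real) \<Rightarrow> bool" where
  "envelope Q M I \<S> \<longleftrightarrow>
     (\<forall>p\<in>M. \<exists>V \<tau>. open V \<and> p \<in> V \<and> smooth_on V \<tau> \<and>
        (\<forall>q\<in>M \<inter> V. \<tau> q \<in> I \<and> tangent_at Q M (\<S> (\<tau> q)) q))"

text \<open>
  The two ways are different if no sphere touches \<open>M\<close> at the same point as a member of both
  families. This excludes umbilics. Indeed, \<open>\<S> (\<tau> q)\<close> and its radius do not vary to
  first order along the kernel of the differential of \<open>\<tau>\<close>, so the vectors of that kernel are
  principal, with the curvature of the sphere as principal curvature. The two spheres at a point
  are therefore the two curvature spheres of \<open>M\<close>.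
\<close>

definition dupin_cyclide :: "'a::euclidean_space set \<Rightarrow> 'a set \<Rightarrow> bool" where
  "dupin_cyclide Q M \<longleftrightarrow>
     regular_surface M \<and> M \<subseteq> Q \<and>
     (\<exists>I\<^sub>1 \<S>\<^sub>1 I\<^sub>2 \<S>\<^sub>2.
        sphere_family Q I\<^sub>1 \<S>\<^sub>1 \<and> envelope Q M I\<^sub>1 \<S>\<^sub>1 \<and>
        sphere_family Q I\<^sub>2 \<S>\<^sub>2 \<and> envelope Q M I\<^sub>2 \<S>\<^sub>2 \<and>
        (\<forall>p\<in>M. \<forall>t\<^sub>1\<in>I\<^sub>1. \<forall>t\<^sub>2\<in>I\<^sub>2.
           tangent_at Q M (\<S>\<^sub>1 t\<^sub>1) p \<and> tangent_at Q M (\<S>\<^sub>2 t\<^sub>2) p \<longrightarrow>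
           sphere_set Q (\<S>\<^sub>1 t\<^sub>1) \<noteq> sphere_set Q (\<S>\<^sub>2 t\<^sub>2)))"

end

theory Submission
  imports Defs
begin

text \<open>
  A triple \<open>S = (a, b, c)\<close> is a vector of a Lorentz space with the form \<open>b \<bullet> b' - 2 a c' - 2 a' c\<close>, and
  \<open>S(p)\<close> is, up to a factor, its product with the isotropic vector \<open>X\<^sub>p = (1, -2 p, |p|\<^sup>2)\<close>. Normalize the
  two families to unit vectors \<open>\<Sigma>\<^sub>1(u)\<close>, \<open>\<Sigma>\<^sub>2(v)\<close> with matching orientations. Every sphere of one family
  touches every nearby sphere of the other, so \<open>\<langle>\<Sigma>\<^sub>1(u), \<Sigma>\<^sub>2(v)\<rangle> = 1\<close>, and the difference
  \<open>\<Sigma>\<^sub>1(u) - \<Sigma>\<^sub>2(v)\<close> is isotropic: it is a multiple of \<open>X\<^sub>p\<close> for the point of contact \<open>p\<close>. In this scaling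
  \<open>M\<close> is a translation surface, conformally flat in the coordinates \<open>u\<close>, \<open>v\<close>, whose coordinate lines
  are the lines of curvature.

  Along a curve put \<open>c\<^sub>1 = \<Sigma>\<^sub>1(u(s))\<close> and \<open>c\<^sub>2 = \<Sigma>\<^sub>2(v(s))\<close>. The tangent spheres at \<open>\<gamma>(s)\<close> are the
  \<open>\<alpha> c\<^sub>1(s) + \<beta> c\<^sub>2(s)\<close>, and their product with \<open>c\<^sub>1(t) - c\<^sub>2(t)\<close> is
  \<open>- \<alpha>/2 |c\<^sub>1(t) - c\<^sub>1(s)|\<^sup>2 + \<beta>/2 |c\<^sub>2(t) - c\<^sub>2(s)|\<^sup>2\<close>. With \<open>A = |c\<^sub>1'|\<^sup>2\<close> and \<open>B = |c\<^sub>2'|\<^sup>2\<close>, contact of order 3 means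
  \<open>\<alpha> A = \<beta> B\<close> and \<open>\<alpha> A' = \<beta> B'\<close>. Such a sphere exists at every point iff \<open>A' B = A B'\<close>, that is, iff
  \<open>A / (A + B)\<close>, the squared cosine of the angle with a line of curvature, is constant.
\<close>

subsection \<open>Calculus of \<open>C\<^sup>k\<close> curves\<close>

text \<open>Tangency of all nearby pairs comes from the surface: distinct curvature spheres make the
  two parameters independent, so every pair of parameters close to those of a given point occurs on
  \<open>M\<close>. Hence \<open>s\<close> and \<open>t\<close> vary separately in the products of
  the two families, and all mixed derivatives vanish. Contact of order 1 is automatic for the
  spheres of the tangent pencil; orders 2 and 3 are two linear equations for their two coefficients,
  and the determinant is, up to sign, the numerator of the derivative of \<open>A / (A + B)\<close>.

  Two obstacles shape the rest. Charts are local, while one angle has to serve the whole curve: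
  local constancy is propagated by connectedness. Moreover the given principal foliation is not
  matched with one of the families of spheres, so the squared cosine is known only up to exchange
  with its complement; a continuous function with finitely many values on an interval settles this.
  A leaf containing a given curve comes from a maximal extension of that curve.\<close>

lemma Ck_on_cong:
  assumes "open U" "\<And>x. x \<in> U \<Longrightarrow> f x = g x" "Ck_on k U f"
  shows "Ck_on k U g"
  using assms(2,3)
proof (induction k arbitrary: f g)
  case 0
  then show ?case by (simp cong: continuous_on_cong)
next
  case (Suc k)
  have d: "f differentiable at x" if "x \<in> U" for x
    using Suc.prems(2) that assms(1) by (simp add: differentiable_on_eq_differentiable_at)
  have g: "g differentiable at x" if "x \<in> U" for x
    using d[OF that] has_derivative_transform_within_open[OF _ assms(1) that, of f _ UNIV g]
      Suc.prems(1) unfolding differentiable_def by blast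
  have e: "frechet_derivative f (at x) v = frechet_derivative g (at x) v" if "x \<in> U" for x v
    using frechet_derivative_transform_within_open[OF d[OF that] assms(1) that] Suc.prems(1) by simp
  show ?case
    using Suc.IH[OF e] Suc.prems(2) g assms(1) by (simp add: differentiable_on_eq_differentiable_at)
qed

lemma Ck_on_subset:
  assumes "Ck_on k U f" "W \<subseteq> U"
  shows "Ck_on k W f"
  using assms(1)
proof (induction k arbitrary: f)
  case 0
  then show ?case using assms(2) continuous_on_subset by auto
next
  case (Suc k)
  then show ?case using assms(2) differentiable_on_subset by auto
qed

lemma Ck_on_UN:
  assumes "\<And>i. i \<in> I \<Longrightarrow> open (U i)" "\<And>i. i \<in> I \<Longrightarrow> Ck_on k (U i) f"
  shows "Ck_on k (\<Union>i\<in>I. U i) f"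
  using assms(2)
proof (induction k arbitrary: f)
  case 0
  then show ?case using continuous_on_open_UN assms(1) by auto
next
  case (Suc k)
  then show ?case
    by (auto simp: differentiable_on_eq_differentiable_at open_UN assms(1))
qed

lemma Ck_on_linear:
  assumes "open U" "bounded_linear h" "Ck_on k U f"
  shows "Ck_on k U (\<lambda>x. h (f x))"
  using assms(3)
proof (induction k arbitrary: f)
  case 0
  then show ?case using assms(2) by (simp add: bounded_linear.continuous_on)
next
  case (Suc k)
  have d: "(f has_derivative frechet_derivative f (at x)) (at x)" if "x \<in> U" for x
    using Suc.prems that assms(1)
    by (simp add: differentiable_on_eq_differentiable_at frechet_derivative_works)
  have hd: "((\<lambda>x. h (f x)) has_derivative (\<lambda>v. h (frechet_derivative f (at x) v))) (at x)" if "x \<in> U" for x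
    using bounded_linear.has_derivative[OF assms(2) d[OF that]] .
  have e: "h (frechet_derivative f (at x) v) = frechet_derivative (\<lambda>x. h (f x)) (at x) v" if "x \<in> U" for x v
    using frechet_derivative_at[OF hd[OF that]] by metis
  have "Ck_on k U (\<lambda>x. frechet_derivative (\<lambda>x. h (f x)) (at x) v)" for v
    by (rule Ck_on_cong[OF assms(1) e Suc.IH]) (use Suc.prems in auto)
  then show ?case
    using hd assms(1) by (auto simp: differentiable_on_eq_differentiable_at differentiable_def)
qed

text \<open>In one real variable every directional derivative is a multiple of the one in direction
  1. The quantifier over directions in \<open>Ck_on\<close> thus reduces to one derivative function,
  on which the inductions below operate.\<close>

lemma Ck_on_Suc_curve:
  fixes f :: "real \<Rightarrow> 'b::real_normed_vector"
  assumes "open J"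
  shows "Ck_on (Suc k) J f \<longleftrightarrow>
    (\<exists>f'. (\<forall>s\<in>J. (f has_vector_derivative f' s) (at s)) \<and> Ck_on k J f')"
proof
  assume c: "Ck_on (Suc k) J f"
  then have "(f has_vector_derivative frechet_derivative f (at s) 1) (at s)" if "s \<in> J" for s
  proof -
    have d: "(f has_derivative frechet_derivative f (at s)) (at s)"
      using c that assms by (simp add: differentiable_on_eq_differentiable_at frechet_derivative_works)
    have "frechet_derivative f (at s) = (\<lambda>v. v *\<^sub>R frechet_derivative f (at s) 1)"
      using linear_cmul[OF has_derivative_linear[OF d], of v 1 for v] by (intro ext) (metis mult.right_neutral real_scaleR_def)
    then show ?thesis using d unfolding has_vector_derivative_def by metis
  qed
  then show "\<exists>f'. (\<forall>s\<in>J. (f has_vector_derivative f' s) (at s)) \<and> Ck_on k J f'"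
    using c by (intro exI[of _ "\<lambda>s. frechet_derivative f (at s) 1"]) simp
next
  assume "\<exists>f'. (\<forall>s\<in>J. (f has_vector_derivative f' s) (at s)) \<and> Ck_on k J f'"
  then obtain f' where f': "\<And>s. s \<in> J \<Longrightarrow> (f has_vector_derivative f' s) (at s)" "Ck_on k J f'"
    by auto
  have e: "v *\<^sub>R f' s = frechet_derivative f (at s) v" if "s \<in> J" for s v
    using frechet_derivative_at[OF f'(1)[OF that, unfolded has_vector_derivative_def]] by metis
  have "Ck_on k J (\<lambda>s. frechet_derivative f (at s) v)" for v
    using Ck_on_cong[OF assms e Ck_on_linear[OF assms bounded_linear_scaleR_right f'(2)]] .
  then show "Ck_on (Suc k) J f"
    using f'(1) assms
    by (auto simp: differentiable_on_eq_differentiable_at differentiable_def has_vector_derivative_def)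
qed

lemma Ck_on_SucE:
  fixes f :: "real \<Rightarrow> 'b::real_normed_vector"
  assumes "open J" "Ck_on (Suc k) J f"
  obtains f' where "\<And>s. s \<in> J \<Longrightarrow> (f has_vector_derivative f' s) (at s)" "Ck_on k J f'"
  using assms(2) unfolding Ck_on_Suc_curve[OF assms(1)] by blast

lemma Ck_on_SucI:
  fixes f :: "real \<Rightarrow> 'b::real_normed_vector"
  assumes "open J" "\<And>s. s \<in> J \<Longrightarrow> (f has_vector_derivative f' s) (at s)" "Ck_on k J f'"
  shows "Ck_on (Suc k) J f"
  using assms(2,3) unfolding Ck_on_Suc_curve[OF assms(1)] by blast

lemma Ck_on_SucD:
  fixes f :: "real \<Rightarrow> 'b::real_normed_vector"
  assumes "open J" "Ck_on (Suc k) J f"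
  shows "Ck_on k J f"
  using assms(2)
proof (induction k arbitrary: f)
  case 0
  then show ?case by (simp add: differentiable_imp_continuous_on)
next
  case (Suc k)
  from Suc.prems show ?case
    by (rule Ck_on_SucE[OF assms(1)]) (rule Ck_on_SucI[OF assms(1)], auto intro: Suc.IH)
qed

lemma Ck_on_add:
  fixes f g :: "real \<Rightarrow> 'b::real_normed_vector"
  assumes "open J" "Ck_on k J f" "Ck_on k J g"
  shows "Ck_on k J (\<lambda>s. f s + g s)"
  using assms(2,3)
proof (induction k arbitrary: f g)
  case 0
  then show ?case by (simp add: continuous_on_add)
next
  case (Suc k)
  from Suc.prems(1) obtain f' where f': "\<And>s. s \<in> J \<Longrightarrow> (f has_vector_derivative f' s) (at s)" "Ck_on k J f'"
    by (rule Ck_on_SucE[OF assms(1)]) (rule that)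
  from Suc.prems(2) obtain g' where g': "\<And>s. s \<in> J \<Longrightarrow> (g has_vector_derivative g' s) (at s)" "Ck_on k J g'"
    by (rule Ck_on_SucE[OF assms(1)]) (rule that)
  show ?case
    by (rule Ck_on_SucI[OF assms(1) has_vector_derivative_add[OF f'(1) g'(1)] Suc.IH[OF f'(2) g'(2)]])
qed

lemma Ck_on_const:
  fixes J :: "real set"
  assumes "open J"
  shows "Ck_on k J (\<lambda>s. c)"
proof (induction k arbitrary: c)
  case (Suc k)
  then show ?case
    by (intro Ck_on_SucI[OF assms, where f' = "\<lambda>s. 0"]) auto
qed simp

lemma Ck_on_sum:
  fixes f :: "'i \<Rightarrow> real \<Rightarrow> 'b::real_normed_vector"
  assumes "open J" "finite I" "\<And>i. i \<in> I \<Longrightarrow> Ck_on k J (f i)"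
  shows "Ck_on k J (\<lambda>s. \<Sum>i\<in>I. f i s)"
  using assms(2,3)
proof (induction I)
  case empty
  then show ?case by (simp add: Ck_on_const[OF assms(1)])
next
  case (insert i I)
  then show ?case using Ck_on_add[OF assms(1), of k "f i"] by simp
qed

text \<open>Stated for every bounded bilinear map, so that it serves the inner product, scaling,
  real products and the Lorentz form alike.\<close>

lemma (in bounded_bilinear) Ck_on_bilinear:
  fixes f :: "real \<Rightarrow> 'a" and g :: "real \<Rightarrow> 'b"
  assumes "open J" "Ck_on k J f" "Ck_on k J g"
  shows "Ck_on k J (\<lambda>s. prod (f s) (g s))"
  using assms(2,3)
proof (induction k arbitrary: f g)
  case 0
  then show ?case by (simp add: continuous_on)
next
  case (Suc k)
  from Suc.prems(1) obtain f' where f': "\<And>s. s \<in> J \<Longrightarrow> (f has_vector_derivative f' s) (at s)" "Ck_on k J f'"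
    by (rule Ck_on_SucE[OF assms(1)]) (rule that)
  from Suc.prems(2) obtain g' where g': "\<And>s. s \<in> J \<Longrightarrow> (g has_vector_derivative g' s) (at s)" "Ck_on k J g'"
    by (rule Ck_on_SucE[OF assms(1)]) (rule that)
  note fg = Suc.prems[THEN Ck_on_SucD[OF assms(1)]]
  show ?case
    by (rule Ck_on_SucI[OF assms(1) has_vector_derivative[OF f'(1) g'(1)]
          Ck_on_add[OF assms(1) Suc.IH[OF fg(1) g'(2)] Suc.IH[OF f'(2) fg(2)]]])
qed

text \<open>Expanding the velocity in \<open>Basis\<close> writes the derivative of the composition
  as a sum of products of velocity components with partial derivatives along the curve. The
  induction hypothesis applies to each partial derivative, which is why \<open>f\<close> is
  generalized.\<close>

lemma Ck_on_compose_curve: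
  fixes \<gamma> :: "real \<Rightarrow> 'a::euclidean_space" and f :: "'a \<Rightarrow> 'b::real_normed_vector"
  assumes "open J" "open V" "\<gamma> ` J \<subseteq> V" "Ck_on k V f" "Ck_on k J \<gamma>"
  shows "Ck_on k J (\<lambda>s. f (\<gamma> s))"
  using assms(4,5)
proof (induction k arbitrary: f)
  case 0
  then show ?case using assms(3) continuous_on_compose2 by auto
next
  case (Suc k)
  from Suc.prems(2) obtain \<gamma>' where g: "\<And>s. s \<in> J \<Longrightarrow> (\<gamma> has_vector_derivative \<gamma>' s) (at s)" "Ck_on k J \<gamma>'"
    by (rule Ck_on_SucE[OF assms(1)]) (rule that)
  have d: "(f has_derivative frechet_derivative f (at x)) (at x)" if "x \<in> V" for x
    using Suc.prems that assms(2)
    by (simp add: differentiable_on_eq_differentiable_at frechet_derivative_works)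
  have "((\<lambda>s. f (\<gamma> s)) has_vector_derivative
      (\<Sum>b\<in>Basis. (\<gamma>' s \<bullet> b) *\<^sub>R frechet_derivative f (at (\<gamma> s)) b)) (at s)" if "s \<in> J" for s
  proof -
    have x: "\<gamma> s \<in> V" using that assms(3) by auto
    have lin: "linear (frechet_derivative f (at (\<gamma> s)))"
      using d[OF x] has_derivative_linear by blast
    have "frechet_derivative f (at (\<gamma> s)) (\<gamma>' s) =
        (\<Sum>b\<in>Basis. (\<gamma>' s \<bullet> b) *\<^sub>R frechet_derivative f (at (\<gamma> s)) b)"
      by (subst euclidean_representation[of "\<gamma>' s", symmetric])
        (simp only: linear_sum[OF lin] linear_cmul[OF lin])
    then show ?thesis
      using vector_derivative_diff_chain_within[OF g(1)[OF that]
          has_derivative_at_withinI[OF d[OF x]]] by (simp add: o_def)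
  qed
  moreover have "Ck_on k J (\<lambda>s. \<Sum>b\<in>Basis. (\<gamma>' s \<bullet> b) *\<^sub>R frechet_derivative f (at (\<gamma> s)) b)"
  proof (rule Ck_on_sum[OF assms(1)], simp)
    fix b :: 'a assume "b \<in> Basis"
    have "Ck_on k J (\<lambda>s. frechet_derivative f (at (\<gamma> s)) b)"
      using Suc.IH[of "\<lambda>x. frechet_derivative f (at x) b"] Suc.prems(1)
          Ck_on_SucD[OF assms(1) Suc.prems(2)] by simp
    then show "Ck_on k J (\<lambda>s. (\<gamma>' s \<bullet> b) *\<^sub>R frechet_derivative f (at (\<gamma> s)) b)"
      using bounded_bilinear.Ck_on_bilinear[OF bounded_bilinear_scaleR assms(1)
          Ck_on_linear[OF assms(1) bounded_linear_inner_left g(2)]] by blast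
  qed
  ultimately show ?case
    by (rule Ck_on_SucI[OF assms(1)])
qed

text \<open>The function \<open>r = 1 / sqrt f\<close> satisfies \<open>r' = - r^3 f' / 2\<close>,
  so the regularity of \<open>r\<close> itself, gained in the previous step, lifts by one
  order.\<close>

lemma Ck_on_inverse_sqrt:
  fixes f :: "real \<Rightarrow> real"
  assumes "open J" "\<And>s. s \<in> J \<Longrightarrow> 0 < f s" "Ck_on k J f"
  shows "Ck_on k J (\<lambda>s. inverse (sqrt (f s)))"
  using assms(3)
proof (induction k)
  case 0
  then have "continuous_on J f" by simp
  moreover have "\<forall>s\<in>J. sqrt (f s) \<noteq> 0" using assms(2) by force
  ultimately show ?case
    unfolding Ck_on.simps(1) by (intro continuous_on_inverse continuous_on_real_sqrt)
next
  case (Suc k)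
  define r where "r s = inverse (sqrt (f s))" for s
  from Suc.prems obtain f' where f': "\<And>s. s \<in> J \<Longrightarrow> (f has_vector_derivative f' s) (at s)" "Ck_on k J f'"
    by (rule Ck_on_SucE[OF assms(1)]) (rule that)
  have r: "Ck_on k J r" using Suc.IH Ck_on_SucD[OF assms(1) Suc.prems] by (simp add: r_def[abs_def])
  have "(r has_vector_derivative - (1/2) * (r s * (r s * (r s * f' s)))) (at s)" if "s \<in> J" for s
  proof -
    have "(r has_real_derivative - (1/2) * (r s * (r s * (r s * f' s)))) (at s)"
      unfolding r_def[abs_def] using f'(1)[OF that] assms(2)[OF that]
      by (auto intro!: derivative_eq_intros simp: has_real_derivative_iff_has_vector_derivative[symmetric]
          field_simps power2_eq_square)
    then show ?thesis by (simp add: has_real_derivative_iff_has_vector_derivative)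
  qed
  moreover have "Ck_on k J (\<lambda>s. - (1/2) * (r s * (r s * (r s * f' s))))"
    by (rule Ck_on_linear[OF assms(1) bounded_linear_mult_right];
        intro bounded_bilinear.Ck_on_bilinear[OF bounded_bilinear_mult assms(1)] r f'(2))
  ultimately show ?case
    unfolding r_def[symmetric] by (rule Ck_on_SucI[OF assms(1)])
qed

lemma Ck_on_3D:
  fixes f :: "real \<Rightarrow> 'b::real_normed_vector"
  assumes "open J" "Ck_on 3 J f"
  obtains f1 f2 f3 where "\<And>s. s \<in> J \<Longrightarrow> (f has_vector_derivative f1 s) (at s)"
    "\<And>s. s \<in> J \<Longrightarrow> (f1 has_vector_derivative f2 s) (at s)"
    "\<And>s. s \<in> J \<Longrightarrow> (f2 has_vector_derivative f3 s) (at s)"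
proof -
  have "Ck_on (Suc (Suc (Suc 0))) J f" using assms(2) by (simp only: numeral_3_eq_3)
  then show thesis
    by (elim Ck_on_SucE[OF assms(1)]) (rule that)
qed

text \<open>Contact is defined with iterated \<open>deriv\<close> at a point, while derivatives are
  known as functions on \<open>J\<close> only; openness of \<open>J\<close> makes the two
  agree.\<close>

lemma deriv_iterate_upto_3:
  fixes f :: "real \<Rightarrow> real"
  assumes "open J" "s \<in> J"
    and f: "\<And>s. s \<in> J \<Longrightarrow> (f has_real_derivative f1 s) (at s)"
    "\<And>s. s \<in> J \<Longrightarrow> (f1 has_real_derivative f2 s) (at s)"
    "\<And>s. s \<in> J \<Longrightarrow> (f2 has_real_derivative f3 s) (at s)"
  shows "(\<forall>i\<le>3. (deriv ^^ i) f s = 0) \<longleftrightarrow> f s = 0 \<and> f1 s = 0 \<and> f2 s = 0 \<and> f3 s = 0"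
proof -
  have e1: "deriv f t = f1 t" if "t \<in> J" for t using DERIV_imp_deriv f(1) that by blast
  have e2: "deriv (deriv f) t = f2 t" if "t \<in> J" for t
  proof (rule DERIV_imp_deriv)
    show "(deriv f has_real_derivative f2 t) (at t)"
      using has_field_derivative_transform_within_open[OF f(2)[OF that] assms(1) that] e1 by simp
  qed
  have e3: "deriv (deriv (deriv f)) t = f3 t" if "t \<in> J" for t
  proof (rule DERIV_imp_deriv)
    show "(deriv (deriv f) has_real_derivative f3 t) (at t)"
      using has_field_derivative_transform_within_open[OF f(3)[OF that] assms(1) that] e2 by simp
  qed
  have "(\<forall>i\<le>3. P i) \<longleftrightarrow> P 0 \<and> P (Suc 0) \<and> P (Suc (Suc 0)) \<and> P (Suc (Suc (Suc 0)))"
    for P :: "nat \<Rightarrow> bool"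
    by (auto simp: numeral_3_eq_3 le_Suc_eq)
  then show ?thesis using assms(2) by (simp add: e1 e2 e3)
qed

subsection \<open>Tangent planes and normals\<close>

lemma tangent_spaceE:
  assumes "v \<in> tangent_space X p"
  obtains c and \<epsilon> :: real where "\<epsilon> > 0" "c ` {-\<epsilon><..<\<epsilon>} \<subseteq> X" "c 0 = p"
    "(c has_vector_derivative v) (at 0)"
  using assms unfolding tangent_space_def by blast

text \<open>The delicate part is that each velocity lies in the range of \<open>L\<close>. The
  inverse chart \<open>y\<close> is only known to be continuous, so the lifted curve cannot be
  differentiated. Instead the difference quotients of the curve are approximated by images under
  \<open>L\<close> of difference quotients of the lift, and \<open>range L\<close>, a subspace of a
  finite-dimensional space, is closed.\<close>

lemma regular_surface_chart:
  fixes M :: "'a::euclidean_space set"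
  assumes "regular_surface M" "p \<in> M"
  obtains U and x :: "real^2 \<Rightarrow> 'a" and u L where
    "open U" "u \<in> U" "x u = p" "x ` U \<subseteq> M" "continuous_on U x"
    "(x has_derivative L) (at u)" "inj L" "tangent_space M p = range L"
proof -
  obtain U :: "(real^2) set" and V x y where U: "open U" "open V" "p \<in> V"
    and hom: "homeomorphism U (M \<inter> V) x y" and sm: "smooth_on U x"
    and inj: "\<And>u. u \<in> U \<Longrightarrow> inj (frechet_derivative x (at u))"
    using bspec[OF assms(1)[unfolded regular_surface_def] assms(2)]
    by (elim exE conjE) (rule that, auto)
  define u where "u = y p"
  have u: "u \<in> U" "x u = p"
    using hom U(3) assms(2) unfolding u_def homeomorphism_def by auto
  define L where "L = frechet_derivative x (at u)"
  have "Ck_on 1 U x" using sm unfolding smooth_on_def by blast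
  then have L: "(x has_derivative L) (at u)"
    using U(1) u(1) unfolding L_def
    by (simp add: differentiable_on_eq_differentiable_at frechet_derivative_works)
  have lin: "linear L" using L has_derivative_linear by blast
  have "inj L" using inj[OF u(1)] by (simp add: L_def)
  have "range L \<subseteq> tangent_space M p"
  proof
    fix v assume "v \<in> range L"
    then obtain w where w: "v = L w" by auto
    obtain e where e: "e > 0" "ball u e \<subseteq> U" using U(1) u(1) open_contains_ball by blast
    have "u + t *\<^sub>R w \<in> U" if "t \<in> {- (e / (norm w + 1))<..<e / (norm w + 1)}" for t
    proof -
      have "\<bar>t\<bar> < e / (norm w + 1)" using that by auto
      then have "\<bar>t\<bar> * (norm w + 1) < e" by (simp add: pos_less_divide_eq add_nonneg_pos)
      moreover have "\<bar>t\<bar> * norm w \<le> \<bar>t\<bar> * (norm w + 1)" by (simp add: mult_left_mono)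
      ultimately have "dist u (u + t *\<^sub>R w) < e" by (simp add: dist_norm)
      then show ?thesis using e by auto
    qed
    moreover have "((\<lambda>t. x (u + t *\<^sub>R w)) has_vector_derivative v) (at 0)"
    proof -
      have "((\<lambda>t::real. u + t *\<^sub>R w) has_vector_derivative w) (at 0)"
        by (auto intro!: derivative_eq_intros)
      from vector_derivative_diff_chain_within[OF this, of x L]
      show ?thesis using L w by (simp add: o_def has_derivative_at_withinI)
    qed
    moreover have "x ` U \<subseteq> M" using hom unfolding homeomorphism_def by auto
    ultimately show "v \<in> tangent_space M p"
      unfolding tangent_space_def using e(1) u
      by (intro CollectI exI[of _ "\<lambda>t. x (u + t *\<^sub>R w)"] exI[of _ "e / (norm w + 1)"])
        (auto simp: add_nonneg_pos)
  qed
  moreover have "tangent_space M p \<subseteq> range L"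
  proof
    fix v assume "v \<in> tangent_space M p"
    then obtain c \<epsilon> where c: "\<epsilon> > (0::real)" "c ` {-\<epsilon><..<\<epsilon>} \<subseteq> M" "c 0 = p"
      "(c has_vector_derivative v) (at 0)" by (rule tangent_spaceE)
    obtain B where B: "B > 0" "\<And>w. B * norm w \<le> norm (L w)"
      using linear_inj_bounded_below_pos[OF lin \<open>inj L\<close>] by metis
    have cont: "(c \<longlongrightarrow> p) (at 0)"
      using has_vector_derivative_continuous[OF c(4)] c(3) by (simp add: continuous_at)
    have ev0: "\<forall>\<^sub>F t in at 0. t \<in> {-\<epsilon><..<\<epsilon>}"
      using c(1) eventually_at_topological[of "\<lambda>t. t \<in> {-\<epsilon><..<\<epsilon>}" 0 UNIV]
      by (metis UNIV_I greaterThanLessThan_iff neg_less_0_iff_less open_greaterThanLessThan)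
    have ev: "\<forall>\<^sub>F t in at 0. c t \<in> M \<inter> V"
      using topological_tendstoD[OF cont U(2,3)] ev0
      by eventually_elim (use c(2) in auto)
    have q: "((\<lambda>t. (c t - p) /\<^sub>R t) \<longlongrightarrow> v) (at 0)"
    proof -
      have "((\<lambda>t. norm (c t - p - t *\<^sub>R v) / norm t) \<longlongrightarrow> 0) (at 0)"
        using c(4,3) by (simp add: has_vector_derivative_def has_derivative_iff_norm)
      moreover have "\<forall>\<^sub>F t in at 0. norm (c t - p - t *\<^sub>R v) / norm t = dist ((c t - p) /\<^sub>R t) v"
        using eventually_neq_at_within[of 0 0 UNIV]
      proof eventually_elim
        case (elim t)
        then have "(c t - p) /\<^sub>R t - v = (c t - p - t *\<^sub>R v) /\<^sub>R t" by (simp add: algebra_simps)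
        then show ?case by (simp add: dist_norm divide_inverse mult.commute)
      qed
      ultimately show ?thesis
        unfolding tendsto_dist_iff[of _ v] by (rule Lim_transform_eventually)
    qed
    have yc: "((\<lambda>t. y (c t)) \<longlongrightarrow> u) (at 0)"
      unfolding u_def
      using continuous_on_tendsto_compose[OF _ cont _ ev, of y] hom U(3) assms(2)
      unfolding homeomorphism_def by auto
    have "v \<in> closure (range L)"
      unfolding closure_approachable
    proof (intro allI impI)
      fix \<eta> :: real assume \<eta>: "\<eta> > 0"
      \<comment> \<open>The bound \<open>B / 2\<close> lets the linearization error be absorbed,
        giving \<open>|w - u| <= (2 / B) |c t - p|\<close>. The second bound turns the resulting
        error of the difference quotient into at most \<open>\<eta> / 2\<close>.\<close>
      define e where "e = min (B / 2) (B * \<eta> / (4 * (norm v + 1)))"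
      have v1: "norm v + 1 > 0" by (simp add: add_nonneg_pos)
      have e: "e > 0" "e \<le> B / 2" "e \<le> B * \<eta> / (4 * (norm v + 1))"
        using B(1) \<eta> v1 unfolding e_def by (simp, intro min.cobounded1, intro min.cobounded2)
      obtain d where d: "d > 0"
        "\<And>w. norm (w - u) < d \<Longrightarrow> norm (x w - x u - L (w - u)) \<le> e * norm (w - u)"
        using L e(1) unfolding has_derivative_at_alt by blast
      have "\<forall>\<^sub>F t in at 0. t \<noteq> 0 \<and> c t \<in> M \<inter> V \<and> dist (y (c t)) u < d \<and>
          dist ((c t - p) /\<^sub>R t) v < min 1 (\<eta> / 2)"
        using \<eta> d(1) by (intro eventually_conj ev tendstoD[OF yc] tendstoD[OF q]
            eventually_neq_at_within) auto
      from eventually_happens'[OF _ this] obtain t where t: "t \<noteq> 0" "c t \<in> M \<inter> V"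
          "dist (y (c t)) u < d" "dist ((c t - p) /\<^sub>R t) v < min 1 (\<eta> / 2)"
        by auto
      define w where "w = y (c t)"
      define E where "E = norm (c t - p - L (w - u))"
      have xw: "x w = c t" using hom t(2) unfolding w_def homeomorphism_def by auto
      have E: "E \<le> e * norm (w - u)"
        using d(2)[of w] t(3) xw u(2) by (simp add: E_def w_def dist_norm)
      have "B * norm (w - u) \<le> norm (c t - p) + E"
        using B(2)[of "w - u"] norm_triangle_sub[of "L (w - u)" "c t - p"]
        by (simp add: E_def norm_minus_commute)
      also have "\<dots> \<le> norm (c t - p) + (B / 2) * norm (w - u)"
        using E mult_right_mono[OF e(2) norm_ge_zero[of "w - u"]] by linarith
      finally have "norm (w - u) \<le> (2 / B) * norm (c t - p)"
        using B(1) by (simp add: field_simps)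
      then have "E \<le> e * ((2 / B) * norm (c t - p))"
        using E mult_left_mono[OF _ less_imp_le[OF e(1)]] order_trans by blast
      then have "E / \<bar>t\<bar> \<le> e * ((2 / B) * norm (c t - p)) / \<bar>t\<bar>"
        by (rule divide_right_mono) simp
      also have "\<dots> = e * (2 / B) * norm ((c t - p) /\<^sub>R t)"
        by (simp add: divide_inverse)
      also have "\<dots> \<le> e * (2 / B) * (norm v + 1)"
        using t(4) e(1) B(1) norm_triangle_sub[of "(c t - p) /\<^sub>R t" v]
        by (intro mult_left_mono) (auto simp: dist_norm)
      also have "\<dots> \<le> B * \<eta> / (4 * (norm v + 1)) * (2 / B) * (norm v + 1)"
        using e(3) B(1) v1 by (intro mult_right_mono) auto
      also have "\<dots> = \<eta> / 2" using B(1) v1 by (simp add: field_simps)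
      finally have "E / \<bar>t\<bar> \<le> \<eta> / 2" .
      moreover have "dist ((c t - p) /\<^sub>R t) (L ((w - u) /\<^sub>R t)) = E / \<bar>t\<bar>"
      proof -
        have "(c t - p) /\<^sub>R t - L ((w - u) /\<^sub>R t) = (c t - p - L (w - u)) /\<^sub>R t"
          by (simp only: linear_cmul[OF lin]) (simp only: scaleR_diff_right)
        then show ?thesis by (simp add: dist_norm E_def divide_inverse mult.commute)
      qed
      ultimately have "dist (L ((w - u) /\<^sub>R t)) v < \<eta>"
        using t(4) dist_triangle_half_r[of "(c t - p) /\<^sub>R t"] 
          dist_triangle3[of "L ((w - u) /\<^sub>R t)" v "(c t - p) /\<^sub>R t"] by linarith
      then show "\<exists>z\<in>range L. dist z v < \<eta>" by blast
    qed
    then show "v \<in> range L"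
      using closure_closed closed_subspace[OF linear_subspace_image[OF lin subspace_UNIV]] by blast
  qed
  ultimately show thesis
    using that[OF U(1) u _ _ L \<open>inj L\<close>] hom unfolding homeomorphism_def by auto
qed

lemma tangent_space_mono: "X \<subseteq> Y \<Longrightarrow> tangent_space X p \<subseteq> tangent_space Y p"
  unfolding tangent_space_def by blast

lemma tangent_space_zero_set:
  assumes f: "(f has_derivative f') (at p)" and zero: "\<And>x. x \<in> X \<Longrightarrow> f x = (0::real)"
    and v: "v \<in> tangent_space X p"
  shows "f' v = 0"
proof -
  obtain c \<epsilon> where c: "\<epsilon> > (0::real)" "c ` {-\<epsilon><..<\<epsilon>} \<subseteq> X" "c 0 = p"
    "(c has_vector_derivative v) (at 0)" using v by (rule tangent_spaceE)
  have "((\<lambda>t. f (c t)) has_vector_derivative f' v) (at 0)"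
    using vector_derivative_diff_chain_within[OF c(4), of f f'] f c(3)
    by (simp add: o_def has_derivative_at_withinI)
  moreover have "((\<lambda>t. f (c t)) has_vector_derivative 0) (at 0)"
  proof (rule has_vector_derivative_transform_within_open[OF has_vector_derivative_const])
    show "0 = f (c t)" if "t \<in> {-\<epsilon><..<\<epsilon>}" for t
      using c(2) zero that by (metis image_subset_iff)
  qed (use c(1) in auto)
  ultimately show ?thesis by (rule vector_derivative_unique_at)
qed

section \<open>Gradients of sphere equations\<close>

definition sphere_grad :: "real \<times> 'a::euclidean_space \<times> real \<Rightarrow> 'a \<Rightarrow> 'a" where
  "sphere_grad S p = (2 * fst S) *\<^sub>R p + fst (snd S)"

text \<open>The second-order Taylor expansion is exact, with Hessian \<open>2 * fst S\<close> times
  the identity. Hence a triple is determined by its leading coefficient, its value and its gradient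
  at one point.\<close>

lemma sphere_fun_add:
  "sphere_fun S (p + d) = sphere_fun S p + sphere_grad S p \<bullet> d + fst S * (d \<bullet> d)"
  by (simp add: sphere_fun_def sphere_grad_def case_prod_beta power2_norm_eq_inner inner_simps
      inner_commute algebra_simps)

lemma has_derivative_sphere_fun:
  "(sphere_fun S has_derivative (\<lambda>v. sphere_grad S p \<bullet> v)) (at p)"
  unfolding sphere_fun_def[abs_def] sphere_grad_def case_prod_beta power2_norm_eq_inner
  by (auto intro!: derivative_eq_intros simp: inner_simps inner_commute algebra_simps)

lemma tangent_space_sphere_orthogonal:
  assumes "v \<in> tangent_space (sphere 0 1) p"
  shows "v \<bullet> p = 0"
  using tangent_space_zero_set[OF has_derivative_sphere_fun[of "(1, 0, -1)" p] _ assms]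
  by (simp add: sphere_fun_def sphere_grad_def inner_commute)

text \<open>
  Covectors of \<open>Q\<close> at \<open>p\<close> vanishing on the tangent plane of \<open>M\<close>, represented by vectors.
\<close>

definition conormal :: "'a::euclidean_space set \<Rightarrow> 'a set \<Rightarrow> 'a \<Rightarrow> 'a \<Rightarrow> bool" where
  "conormal Q M p g \<longleftrightarrow> (\<forall>v\<in>tangent_space M p. g \<bullet> v = 0) \<and> (Q \<noteq> UNIV \<longrightarrow> g \<bullet> p = 0)"

locale surface_in_space =
  fixes Q M :: "'a::euclidean_space set"
  assumes ambient: "ambient_space Q" and regular: "regular_surface M" and subset: "M \<subseteq> Q"
begin

lemma Q_cases:
  obtains "Q = UNIV" "DIM('a) = 3" | "Q \<noteq> UNIV" "Q = sphere 0 1" "DIM('a) = 4"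
proof -
  have "sphere (0::'a) 1 \<noteq> UNIV"
    using bounded_sphere not_bounded_UNIV by metis
  then show thesis using ambient that unfolding ambient_space_def by metis
qed

lemma norm_Q: "Q \<noteq> UNIV \<Longrightarrow> p \<in> Q \<longleftrightarrow> p \<bullet> p = 1"
  by (rule Q_cases) (auto simp: norm_eq_1)

lemma tangent_space_Q: "v \<in> tangent_space Q p \<Longrightarrow> Q \<noteq> UNIV \<Longrightarrow> v \<bullet> p = 0"
  by (rule Q_cases) (auto intro: tangent_space_sphere_orthogonal)

lemma tangent_space_M: "v \<in> tangent_space M p \<Longrightarrow> Q \<noteq> UNIV \<Longrightarrow> v \<bullet> p = 0"
  using tangent_space_Q tangent_space_mono[OF subset] by blast

lemma subspace_tangent_space: "p \<in> M \<Longrightarrow> subspace (tangent_space M p)"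
  and dim_tangent_space: "p \<in> M \<Longrightarrow> dim (tangent_space M p) = 2"
proof -
  assume "p \<in> M"
  from regular_surface_chart[OF regular this] obtain x :: "real^2 \<Rightarrow> 'a" and u L
    where "(x has_derivative L) (at u)" "inj L" "tangent_space M p = range L" by metis
  moreover from this have "linear L" using has_derivative_linear by blast
  ultimately show "subspace (tangent_space M p)" "dim (tangent_space M p) = 2"
    using linear_subspace_image[OF _ subspace_UNIV] dim_image_eq[of L UNIV]
    by (auto simp: inj_on_subset)
qed

text \<open>Conormals are the vectors orthogonal to \<open>A\<close>, which is the tangent plane,
  enlarged on \<open>S\<^sup>3\<close> by the radial direction. In both geometries \<open>A\<close>
  has codimension 1, so there is no room for the component \<open>r\<close> of \<open>h\<close>
  orthogonal to \<open>g\<close>.\<close>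

lemma conormal_unique:
  assumes "p \<in> M" "conormal Q M p g" "conormal Q M p h" "g \<noteq> 0"
  shows "h = ((h \<bullet> g) / (g \<bullet> g)) *\<^sub>R g"
proof (rule ccontr)
  define r where "r = h - ((h \<bullet> g) / (g \<bullet> g)) *\<^sub>R g"
  define A where "A = (if Q = UNIV then tangent_space M p else span (insert p (tangent_space M p)))"
  define N where "N = {y. \<forall>x\<in>A. orthogonal x y}"
  assume "h \<noteq> ((h \<bullet> g) / (g \<bullet> g)) *\<^sub>R g"
  then have "r \<noteq> 0" by (simp add: r_def)
  have rg: "r \<bullet> g = 0" using assms(4) by (simp add: r_def inner_simps)
  have cr: "conormal Q M p r"
    using assms(2,3) unfolding conormal_def r_def by (simp add: inner_simps)
  have sub: "subspace A"
    using subspace_tangent_space[OF assms(1)] by (simp add: A_def subspace_span)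
  have "dim A = DIM('a) - 1 \<and> DIM('a) > 0"
  proof (rule Q_cases)
    assume "Q = UNIV" "DIM('a) = 3"
    then show ?thesis using dim_tangent_space[OF assms(1)] by (simp add: A_def)
  next
    assume Q: "Q \<noteq> UNIV" "DIM('a) = 4"
    have "p \<notin> tangent_space M p"
      using tangent_space_M[of p p] norm_Q[of p] Q assms(1) subset by auto
    then show ?thesis using dim_tangent_space[OF assms(1)] Q subspace_tangent_space[OF assms(1)]
      by (simp add: A_def dim_insert span_eq_iff[THEN iffD2])
  qed
  moreover have "dim N + dim A = DIM('a)"
    using dim_subspace_orthogonal_to_vectors[OF sub subspace_UNIV] by (simp add: N_def)
  ultimately have "dim N = 1" by linarith
  have inN: "y \<in> N" if "conormal Q M p y" for y
  proof -
    have "\<forall>x\<in>A. y \<bullet> x = 0"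
    proof (cases "Q = UNIV")
      case True
      then show ?thesis using that by (simp add: A_def conormal_def)
    next
      case False
      have "A \<subseteq> {x. y \<bullet> x = 0}"
        unfolding A_def using False that
        by (simp add: conormal_def, intro span_minimal subspace_hyperplane) auto
      then show ?thesis by auto
    qed
    then show ?thesis by (auto simp: N_def orthogonal_def inner_commute)
  qed
  have "g \<noteq> r" using rg assms(4) by auto
  have "independent {g, r}"
    using rg \<open>r \<noteq> 0\<close> assms(4)
    by (intro pairwise_orthogonal_independent)
      (auto simp: pairwise_insert orthogonal_def inner_commute)
  then have "card {g, r} \<le> dim N"
    using inN cr assms(2) by (intro independent_card_le_dim) auto
  then show False using \<open>dim N = 1\<close> \<open>g \<noteq> r\<close> by simp
qed

text \<open>For the converse, the component of \<open>v\<close> orthogonal to the tangent plane is a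
  conormal that is orthogonal to \<open>g\<close>, hence zero.\<close>

lemma tangent_space_conormal_iff:
  assumes "p \<in> M" "conormal Q M p g" "g \<noteq> 0"
  shows "v \<in> tangent_space M p \<longleftrightarrow> v \<bullet> g = 0 \<and> (Q \<noteq> UNIV \<longrightarrow> v \<bullet> p = 0)"
proof
  assume "v \<in> tangent_space M p"
  then show "v \<bullet> g = 0 \<and> (Q \<noteq> UNIV \<longrightarrow> v \<bullet> p = 0)"
    using assms(2) tangent_space_M[of v p] by (auto simp: conormal_def inner_commute)
next
  assume v: "v \<bullet> g = 0 \<and> (Q \<noteq> UNIV \<longrightarrow> v \<bullet> p = 0)"
  have sp: "span (tangent_space M p) = tangent_space M p"
    using subspace_tangent_space[OF assms(1)] by (simp add: span_eq_iff)
  obtain t n where tn: "t \<in> tangent_space M p" "\<And>w. w \<in> tangent_space M p \<Longrightarrow> orthogonal n w"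
    "v = t + n"
    using orthogonal_subspace_decomp_exists[of "tangent_space M p" v] sp by metis
  have "conormal Q M p n"
    unfolding conormal_def using tn v tangent_space_M[OF tn(1)]
    by (auto simp: orthogonal_def inner_simps)
  moreover have "n \<bullet> g = 0"
    using v tn assms(2) by (auto simp: conormal_def inner_simps inner_commute)
  ultimately have "n = 0" using conormal_unique[OF assms(1,2) _ assms(3)] by force
  then show "v \<in> tangent_space M p" using tn by simp
qed

end

subsection \<open>Tangent spheres\<close>

text \<open>The circle arc with velocity \<open>v\<close> and curvature vector \<open>- 2 |v|\<^sup>2 h\<close> at its point \<open>p\<close>.\<close>

definition circle_arc :: "'a::euclidean_space \<Rightarrow> 'a \<Rightarrow> 'a \<Rightarrow> real \<Rightarrow> 'a" where
  "circle_arc p v h t =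
     p + (1 / (1 + t\<^sup>2 * (v \<bullet> v) * (h \<bullet> h))) *\<^sub>R (t *\<^sub>R v - (t\<^sup>2 * (v \<bullet> v)) *\<^sub>R h)"

lemma circle_arc_denom: "1 + t\<^sup>2 * (v \<bullet> v) * (h \<bullet> h) > (0::real)"
  by (simp add: add_pos_nonneg)

lemma circle_arc_inner:
  "(circle_arc p v h t - p) \<bullet> w =
     (t * (v \<bullet> w) - t\<^sup>2 * (v \<bullet> v) * (h \<bullet> w)) / (1 + t\<^sup>2 * (v \<bullet> v) * (h \<bullet> h))"
  by (simp add: circle_arc_def inner_simps)

text \<open>For \<open>t\<close> and \<open>v\<close> nonzero, the arc comes from the line of points
  \<open>v / (t |v|^2) - h\<close> by inversion, translated to \<open>p\<close>. This is why the
  squared chord has the same denominator as the inner products with the chord: along the arc a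
  sphere equation becomes a linear condition on \<open>h\<close>.\<close>

lemma circle_arc_norm:
  assumes "v \<bullet> h = 0"
  shows "(circle_arc p v h t - p) \<bullet> (circle_arc p v h t - p) =
    t\<^sup>2 * (v \<bullet> v) / (1 + t\<^sup>2 * (v \<bullet> v) * (h \<bullet> h))"
proof -
  define D where "D = 1 + t\<^sup>2 * (v \<bullet> v) * (h \<bullet> h)"
  have D: "D > 0" using circle_arc_denom by (simp add: D_def)
  have "(t *\<^sub>R v - (t\<^sup>2 * (v \<bullet> v)) *\<^sub>R h) \<bullet> (t *\<^sub>R v - (t\<^sup>2 * (v \<bullet> v)) *\<^sub>R h) = t\<^sup>2 * (v \<bullet> v) * D"
    using assms by (simp add: D_def inner_simps inner_commute power2_eq_square algebra_simps)
  then show ?thesis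
    unfolding D_def[symmetric] circle_arc_def using D
    by (simp add: power2_eq_square)
qed

lemma circle_arc_velocity: "(circle_arc p v h has_vector_derivative v) (at 0)"
  unfolding circle_arc_def[abs_def]
  by (auto intro!: derivative_eq_intros simp: has_real_derivative_iff_has_vector_derivative[symmetric])

text \<open>
  On \<open>S\<^sup>3\<close> a triple is only determined up to multiples of \<open>|x|\<^sup>2 - 1\<close>. The representative chosen
  here is the sphere orthogonal to \<open>S\<^sup>3\<close>, so that its gradient at a point of \<open>S\<^sup>3\<close> is tangent
  to \<open>S\<^sup>3\<close>; this lets both ambient spaces be treated by the same computations.
\<close>

definition reduced_sphere ::
    "'a::euclidean_space set \<Rightarrow> real \<times> 'a \<times> real \<Rightarrow> real \<times> 'a \<times> real" where
  "reduced_sphere Q S =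
     (if Q = UNIV then S else ((fst S + snd (snd S)) / 2, fst (snd S), (fst S + snd (snd S)) / 2))"

definition orthogonal_to_space :: "'a::euclidean_space set \<Rightarrow> real \<times> 'a \<times> real \<Rightarrow> bool" where
  "orthogonal_to_space Q S \<longleftrightarrow> (Q \<noteq> UNIV \<longrightarrow> fst S = snd (snd S))"

lemma orthogonal_reduced_sphere: "orthogonal_to_space Q (reduced_sphere Q S)"
  by (simp add: orthogonal_to_space_def reduced_sphere_def)

lemma bounded_linear_reduced_sphere:
  "bounded_linear (reduced_sphere (Q :: 'a::euclidean_space set))"
proof (cases "Q = UNIV")
  case True
  then show ?thesis by (simp add: reduced_sphere_def[abs_def] bounded_linear_ident)
next
  case False
  have "linear (\<lambda>S :: real \<times> 'a \<times> real.
      ((fst S + snd (snd S)) / 2, fst (snd S), (fst S + snd (snd S)) / 2))"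
    by (rule linearI) (auto simp: add_divide_distrib algebra_simps)
  then show ?thesis
    using False by (simp add: reduced_sphere_def[abs_def] linear_conv_bounded_linear)
qed

lemma sphere_grad_linear [simp]:
  "sphere_grad (S + S') p = sphere_grad S p + sphere_grad S' p"
  "sphere_grad (S - S') p = sphere_grad S p - sphere_grad S' p"
  "sphere_grad (r *\<^sub>R S) p = r *\<^sub>R sphere_grad S p"
  by (simp_all add: sphere_grad_def algebra_simps)

lemma sphere_fun_linear [simp]:
  "sphere_fun (S + S') p = sphere_fun S p + sphere_fun S' p"
  "sphere_fun (S - S') p = sphere_fun S p - sphere_fun S' p"
  "sphere_fun (r *\<^sub>R S) p = r * sphere_fun S p"
  by (simp_all add: sphere_fun_def case_prod_beta algebra_simps inner_simps)

text \<open>If value and gradient vanish at \<open>p\<close>, only \<open>fst S * |x - p|^2\<close>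
  is left, whose zero set in \<open>Q\<close> is contained in \<open>{p}\<close> or is all of
  \<open>Q\<close>.\<close>

lemma is_sphere_grad_nonzero:
  assumes "is_sphere Q S" "p \<in> Q" "sphere_fun S p = 0"
  shows "sphere_grad S p \<noteq> 0"
proof
  assume g: "sphere_grad S p = 0"
  have S: "sphere_fun S x = fst S * ((x - p) \<bullet> (x - p))" for x
    using sphere_fun_add[of S p "x - p"] assms(3) g by simp
  show False
  proof (cases "fst S = 0")
    case True
    then have "sphere_set Q S = Q" using S by (auto simp: sphere_set_def)
    then show False using assms(1) by (simp add: is_sphere_def)
  next
    case False
    then have "sphere_set Q S \<subseteq> {p}" using S by (auto simp: sphere_set_def)
    then show False using assms(1) by (auto simp: is_sphere_def)
  qed
qed

context surface_in_space
begin

lemma sphere_fun_reduced: "x \<in> Q \<Longrightarrow> sphere_fun (reduced_sphere Q S) x = sphere_fun S x"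
  using norm_Q[of x]
  by (auto simp: reduced_sphere_def sphere_fun_def case_prod_beta power2_norm_eq_inner)

lemma sphere_set_reduced: "sphere_set Q (reduced_sphere Q S) = sphere_set Q S"
  using sphere_fun_reduced[of _ S] unfolding sphere_set_def by auto

lemma is_sphere_reduced: "is_sphere Q (reduced_sphere Q S) \<longleftrightarrow> is_sphere Q S"
  by (simp add: is_sphere_def sphere_set_reduced)

lemma tangent_at_reduced: "tangent_at Q M (reduced_sphere Q S) p \<longleftrightarrow> tangent_at Q M S p"
  by (simp add: tangent_at_def sphere_set_reduced)

text \<open>With equal outer coefficients \<open>a\<close> and \<open>|p| = 1\<close>, the radial
  component of the gradient and the value at \<open>p\<close> are the same number
  \<open>2 a + b \<bullet> p\<close>.\<close>

lemma sphere_grad_orthogonal: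
  assumes "p \<in> Q" "orthogonal_to_space Q S" "sphere_fun S p = 0" "Q \<noteq> UNIV"
  shows "sphere_grad S p \<bullet> p = 0"
  using assms norm_Q[of p]
  by (auto simp: orthogonal_to_space_def sphere_grad_def sphere_fun_def case_prod_beta
      power2_norm_eq_inner inner_simps)

text \<open>The radial component 1/2 of \<open>h\<close> gives the curvature vector the radial
  component \<open>- |v|^2\<close> that a curve on the unit sphere must have.\<close>

lemma circle_arc_Q:
  assumes "p \<in> Q" "v \<bullet> h = 0" "Q \<noteq> UNIV \<longrightarrow> h \<bullet> p = 1 / 2 \<and> v \<bullet> p = 0"
  shows "circle_arc p v h t \<in> Q"
proof (cases "Q = UNIV")
  case False
  let ?d = "circle_arc p v h t - p"
  have "2 * (?d \<bullet> p) + ?d \<bullet> ?d = 0"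
    unfolding circle_arc_norm[OF assms(2)] circle_arc_inner[of p v h t p] using assms(3) False
    by (simp add: add_divide_distrib[symmetric])
  moreover have "(p + ?d) \<bullet> (p + ?d) = p \<bullet> p + 2 * (?d \<bullet> p) + ?d \<bullet> ?d"
    by (simp only: inner_simps inner_commute) simp
  ultimately show ?thesis using norm_Q[OF False] assms(1) by simp
qed simp

lemma tangent_space_sphere_set_iff:
  assumes "p \<in> Q" "orthogonal_to_space Q S" "sphere_fun S p = 0" "sphere_grad S p \<noteq> 0"
  shows "v \<in> tangent_space (sphere_set Q S) p \<longleftrightarrow>
    v \<bullet> sphere_grad S p = 0 \<and> (Q \<noteq> UNIV \<longrightarrow> v \<bullet> p = 0)"
proof
  assume v: "v \<in> tangent_space (sphere_set Q S) p"
  have "v \<bullet> sphere_grad S p = 0"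
    using tangent_space_zero_set[OF has_derivative_sphere_fun _ v]
    by (simp add: sphere_set_def inner_commute)
  moreover have "v \<in> tangent_space Q p"
    using v tangent_space_mono[of "sphere_set Q S" Q] by (auto simp: sphere_set_def)
  ultimately show "v \<bullet> sphere_grad S p = 0 \<and> (Q \<noteq> UNIV \<longrightarrow> v \<bullet> p = 0)"
    using tangent_space_Q by blast
next
  define g where "g = sphere_grad S p"
  \<comment> \<open>Two conditions determine this choice: \<open>h \<bullet> g = fst S\<close>
    annihilates the sphere equation along the arc, and \<open>h \<bullet> p = 1 / 2\<close> keeps
    the arc in the unit sphere. As \<open>g\<close> and \<open>p\<close> are orthogonal, the two
    contributions do not interfere.\<close>
  define h where "h = (fst S / (g \<bullet> g)) *\<^sub>R g + (if Q = UNIV then 0 else (1 / 2) *\<^sub>R p)"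
  assume v: "v \<bullet> sphere_grad S p = 0 \<and> (Q \<noteq> UNIV \<longrightarrow> v \<bullet> p = 0)"
  have gp: "g \<bullet> p = 0" if "Q \<noteq> UNIV"
    using sphere_grad_orthogonal[OF assms(1-3) that] by (simp add: g_def)
  have vh: "v \<bullet> h = 0" using v by (simp add: h_def g_def inner_simps)
  have hg: "h \<bullet> g = fst S"
    using assms(4) gp by (simp add: h_def g_def inner_simps inner_commute)
  have hp: "h \<bullet> p = 1 / 2" if "Q \<noteq> UNIV"
    using norm_Q[OF that, of p] assms(1) gp[OF that] that by (simp add: h_def inner_simps)
  have "circle_arc p v h t \<in> sphere_set Q S" for t
  proof -
    let ?d = "circle_arc p v h t - p"
    have "sphere_fun S (p + ?d) = g \<bullet> ?d + fst S * (?d \<bullet> ?d)"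
      using sphere_fun_add[of S p ?d] assms(3) by (simp add: g_def)
    also have "\<dots> = ?d \<bullet> g + fst S * (?d \<bullet> ?d)" by (simp add: inner_commute)
    also have "\<dots> = 0"
      unfolding circle_arc_norm[OF vh] circle_arc_inner[of p v h t g] using v hg
      by (simp add: g_def)
    finally show ?thesis
      using circle_arc_Q[OF assms(1) vh] v hp by (simp add: sphere_set_def)
  qed
  then show "v \<in> tangent_space (sphere_set Q S) p"
    unfolding tangent_space_def using circle_arc_velocity[of p v h]
    by (intro CollectI exI[of _ "circle_arc p v h"] exI[of _ 1]) (auto simp: circle_arc_def)
qed

text \<open>Replaces sets and velocities of curves by conditions on the 1-jet of the equation. In
  the converse, nondegeneracy has to be recovered: a sphere equal to \<open>Q\<close> would contain
  an arc in the direction of its own gradient, and a sphere with one point would have no nonzero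
  tangent vector.\<close>

lemma tangent_sphere_iff:
  assumes "p \<in> M" "orthogonal_to_space Q S"
  shows "is_sphere Q S \<and> tangent_at Q M S p \<longleftrightarrow>
    sphere_fun S p = 0 \<and> sphere_grad S p \<noteq> 0 \<and> conormal Q M p (sphere_grad S p)"
proof
  assume S: "is_sphere Q S \<and> tangent_at Q M S p"
  have p: "p \<in> Q" using assms(1) subset by auto
  have zero: "sphere_fun S p = 0" using S by (simp add: tangent_at_def sphere_set_def)
  moreover have "sphere_grad S p \<noteq> 0" using is_sphere_grad_nonzero S p zero by blast
  moreover from this have "conormal Q M p (sphere_grad S p)"
    using tangent_space_sphere_set_iff[OF p assms(2) zero] S
      sphere_grad_orthogonal[OF p assms(2) zero]
    by (auto simp: conormal_def tangent_at_def inner_commute)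
  ultimately show "sphere_fun S p = 0 \<and> sphere_grad S p \<noteq> 0 \<and> conormal Q M p (sphere_grad S p)"
    by blast
next
  define g where "g = sphere_grad S p"
  assume S: "sphere_fun S p = 0 \<and> sphere_grad S p \<noteq> 0 \<and> conormal Q M p (sphere_grad S p)"
  then have g: "conormal Q M p g" "g \<noteq> 0" by (auto simp: g_def)
  have p: "p \<in> Q" using assms(1) subset by auto
  have tan: "tangent_space (sphere_set Q S) p = tangent_space M p"
    using tangent_space_sphere_set_iff[OF p assms(2)] tangent_space_conormal_iff[OF assms(1) g] S
    by (auto simp: g_def)
  have "sphere_set Q S \<noteq> Q"
  proof
    assume eq: "sphere_set Q S = Q"
    have gp: "g \<bullet> p = 0" if "Q \<noteq> UNIV"
      using g(1) that by (simp add: conormal_def)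
    define h where "h = (if Q = UNIV then 0 else (1 / 2) *\<^sub>R p)"
    have gh: "g \<bullet> h = 0" using gp by (simp add: h_def)
    have hp: "h \<bullet> p = 1 / 2" if "Q \<noteq> UNIV"
      using norm_Q[OF that, of p] p that by (simp add: h_def)
    have "t * (g \<bullet> g) + fst S * (t\<^sup>2 * (g \<bullet> g)) = 0" for t
    proof -
      let ?d = "circle_arc p g h t - p"
      have "circle_arc p g h t \<in> sphere_set Q S"
        using circle_arc_Q[OF p gh] hp gp eq by simp
      then have "0 = sphere_fun S (p + ?d)" by (simp add: sphere_set_def)
      also have "\<dots> = ?d \<bullet> g + fst S * (?d \<bullet> ?d)"
        unfolding sphere_fun_add using S by (simp add: g_def inner_commute)
      also have "\<dots> = (t * (g \<bullet> g) + fst S * (t\<^sup>2 * (g \<bullet> g))) / (1 + t\<^sup>2 * (g \<bullet> g) * (h \<bullet> h))"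
        unfolding circle_arc_norm[OF gh] circle_arc_inner[of p g h t g] using gh
        by (simp add: inner_commute add_divide_distrib)
      finally show ?thesis
        using circle_arc_denom[of t g h] by simp
    qed
    \<comment> \<open>The linear term is odd in \<open>t\<close> and the quadratic term is even, so
      subtracting the two equations leaves \<open>g \<bullet> g\<close>.\<close>
    from this[of 1] this[of "-1"] have "g \<bullet> g = 0" by auto
    then show False using g(2) by simp
  qed
  moreover have "\<exists>x\<in>sphere_set Q S. \<exists>y\<in>sphere_set Q S. x \<noteq> y"
  proof -
    obtain v where v: "v \<in> tangent_space M p" "v \<noteq> 0"
      using dim_tangent_space[OF assms(1)] dim_eq_0[of "tangent_space M p"] by force
    from v(1)[folded tan] obtain c \<epsilon> where c: "\<epsilon> > (0::real)"
      "c ` {-\<epsilon><..<\<epsilon>} \<subseteq> sphere_set Q S" "(c has_vector_derivative v) (at 0)"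
      by (rule tangent_spaceE)
    show ?thesis
    proof (rule ccontr)
      assume no: "\<not> ?thesis"
      have "c 0 = c t" if "t \<in> {-\<epsilon><..<\<epsilon>}" for t
      proof -
        have "c 0 \<in> sphere_set Q S" "c t \<in> sphere_set Q S"
          using c(1,2) that by auto
        then show ?thesis using no by blast
      qed
      then have "(c has_vector_derivative 0) (at 0)"
        using has_vector_derivative_transform_within_open[OF has_vector_derivative_const
            open_greaterThanLessThan[of "-\<epsilon>" \<epsilon>], of 0 "c 0" c] c(1) by simp
      then show False using vector_derivative_unique_at[OF c(3)] v(2) by blast
    qed
  qed
  ultimately show "is_sphere Q S \<and> tangent_at Q M S p"
    using S p assms(1) tan by (simp add: is_sphere_def tangent_at_def sphere_set_def)
qed

end

subsection \<open>The Lorentz form\<close>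

text \<open>
  The form of signature \<open>(n + 1, 1)\<close> whose isotropic vectors are the spheres of radius 0, together
  with the constants. Oriented unit spheres are tangent iff their product is 1.
\<close>

definition lorentz :: "real \<times> 'a::euclidean_space \<times> real \<Rightarrow> real \<times> 'a \<times> real \<Rightarrow> real" where
  "lorentz S S' = fst (snd S) \<bullet> fst (snd S') - 2 * fst S * snd (snd S') - 2 * fst S' * snd (snd S)"

definition point_sphere :: "'a::euclidean_space \<Rightarrow> real \<times> 'a \<times> real" where
  "point_sphere p = (1, - 2 *\<^sub>R p, p \<bullet> p)"

lemma bounded_bilinear_lorentz:
  "bounded_bilinear (lorentz :: real \<times> 'a::euclidean_space \<times> real \<Rightarrow> _ \<Rightarrow> real)"
proof -
  have "bilinear (lorentz :: real \<times> 'a \<times> real \<Rightarrow> _ \<Rightarrow> real)"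
    unfolding bilinear_def lorentz_def
    by (auto intro!: linearI simp: inner_simps algebra_simps)
  then show ?thesis by (simp add: bilinear_conv_bounded_bilinear)
qed

interpretation lorentz: bounded_bilinear "lorentz :: real \<times> 'a::euclidean_space \<times> real \<Rightarrow> _ \<Rightarrow> real"
  by (rule bounded_bilinear_lorentz)

lemma lorentz_commute: "lorentz S S' = lorentz S' S"
  by (simp add: lorentz_def inner_commute)

lemma lorentz_point_sphere: "lorentz S (point_sphere p) = - 2 * sphere_fun S p"
  by (simp add: lorentz_def point_sphere_def sphere_fun_def case_prod_beta power2_norm_eq_inner
      inner_simps inner_commute)

text \<open>The form is invariant under translations, and with \<open>p\<close> as origin the triple
  \<open>S\<close> becomes \<open>(fst S, sphere_grad S p, sphere_fun S p)\<close>.\<close>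

lemma lorentz_grad:
  "lorentz S S' = sphere_grad S p \<bullet> sphere_grad S' p - 2 * fst S * sphere_fun S' p
     - 2 * fst S' * sphere_fun S p"
  by (simp add: lorentz_def sphere_grad_def sphere_fun_def case_prod_beta power2_norm_eq_inner
      inner_simps inner_commute algebra_simps)

text \<open>At a common point the form is the Euclidean product of normals. All metric information
  about spheres through a point is obtained in this way.\<close>

lemma lorentz_grad_zero:
  assumes "sphere_fun S p = 0" "sphere_fun S' p = 0"
  shows "lorentz S S' = sphere_grad S p \<bullet> sphere_grad S' p"
  using lorentz_grad[of S S' p] assms by simp

lemma point_sphereI:
  assumes "sphere_fun S p = 0" "sphere_grad S p = 0"
  shows "S = fst S *\<^sub>R point_sphere p"
proof -
  have b: "fst (snd S) = - (2 * fst S) *\<^sub>R p"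
    using assms(2) by (simp add: sphere_grad_def eq_neg_iff_add_eq_0 add.commute)
  then have "snd (snd S) = fst S * (p \<bullet> p)"
    using assms(1) by (simp add: sphere_fun_def case_prod_beta power2_norm_eq_inner algebra_simps)
  then show ?thesis using b by (simp add: point_sphere_def prod_eq_iff)
qed

section \<open>Normalized spheres and their unit normals\<close>

definition unit_sphere ::
    "'a::euclidean_space set \<Rightarrow> real \<times> 'a \<times> real \<Rightarrow> real \<times> 'a \<times> real" where
  "unit_sphere Q S =
     inverse (sqrt (lorentz (reduced_sphere Q S) (reduced_sphere Q S))) *\<^sub>R reduced_sphere Q S"

lemma orthogonal_to_space_scaleR: "orthogonal_to_space Q S \<Longrightarrow> orthogonal_to_space Q (r *\<^sub>R S)"
  by (simp add: orthogonal_to_space_def)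

lemma orthogonal_to_space_add:
  "orthogonal_to_space Q S \<Longrightarrow> orthogonal_to_space Q S' \<Longrightarrow> orthogonal_to_space Q (S + S')"
  by (simp add: orthogonal_to_space_def)

lemma orthogonal_unit_sphere: "orthogonal_to_space Q (unit_sphere Q S)"
  by (simp add: unit_sphere_def orthogonal_to_space_scaleR orthogonal_reduced_sphere)

lemma conormal_scaleR: "conormal Q M p g \<Longrightarrow> conormal Q M p (r *\<^sub>R g)"
  by (simp add: conormal_def)

lemma has_vector_derivative_sphere_grad:
  assumes "(Y has_vector_derivative Y') (at s)" "(c has_vector_derivative v) (at s)"
  shows "((\<lambda>t. sphere_grad (Y t) (c t)) has_vector_derivative
    sphere_grad Y' (c s) + (2 * fst (Y s)) *\<^sub>R v) (at s)"
proof -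
  have f: "((\<lambda>t. fst (Y t)) has_vector_derivative fst Y') (at s)"
    "((\<lambda>t. fst (snd (Y t))) has_vector_derivative fst (snd Y')) (at s)"
    using assms(1) bounded_linear.has_vector_derivative[OF bounded_linear_fst]
      bounded_linear.has_vector_derivative[OF bounded_linear_fst_comp[OF bounded_linear_snd]]
    by blast+
  show ?thesis
    unfolding sphere_grad_def using f assms(2)
    by (auto intro!: derivative_eq_intros simp: has_real_derivative_iff_has_vector_derivative
        algebra_simps)
qed

context surface_in_space
begin

text \<open>At any point of the sphere the self-product is the squared length of the gradient, and
  nondegeneracy makes the gradient nonzero. This is what permits the normalization to a unit
  vector.\<close>

lemma lorentz_reduced_pos:
  assumes "is_sphere Q S"
  shows "0 < lorentz (reduced_sphere Q S) (reduced_sphere Q S)"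
proof -
  have r: "is_sphere Q (reduced_sphere Q S)" using assms is_sphere_reduced by simp
  then obtain p where p: "p \<in> sphere_set Q (reduced_sphere Q S)" by (auto simp: is_sphere_def)
  then have "sphere_grad (reduced_sphere Q S) p \<noteq> 0"
    using is_sphere_grad_nonzero[OF r] by (simp add: sphere_set_def)
  then show ?thesis using p lorentz_grad_zero[of _ p] by (simp add: sphere_set_def)
qed

lemma lorentz_unit_sphere:
  assumes "is_sphere Q S"
  shows "lorentz (unit_sphere Q S) (unit_sphere Q S) = 1"
  using lorentz_reduced_pos[OF assms]
  by (simp add: unit_sphere_def lorentz.scaleR_left lorentz.scaleR_right field_simps
      power2_eq_square[symmetric])

lemma sphere_set_unit_sphere:
  assumes "is_sphere Q S"
  shows "sphere_set Q (unit_sphere Q S) = sphere_set Q S"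
  unfolding sphere_set_reduced[of S, symmetric]
  using lorentz_reduced_pos[OF assms] by (auto simp: sphere_set_def unit_sphere_def)

lemma smooth_unit_sphere:
  assumes "sphere_family Q I \<S>"
  shows "smooth_on I (\<lambda>t. unit_sphere Q (\<S> t))"
  unfolding smooth_on_def
proof
  fix k
  have I: "open I" using assms by (simp add: sphere_family_def)
  have "Ck_on k I \<S>" using assms by (simp add: sphere_family_def smooth_on_def)
  then have red: "Ck_on k I (\<lambda>t. reduced_sphere Q (\<S> t))"
    by (rule Ck_on_linear[OF I bounded_linear_reduced_sphere])
  have pos: "0 < lorentz (reduced_sphere Q (\<S> t)) (reduced_sphere Q (\<S> t))" if "t \<in> I" for t
    using that assms lorentz_reduced_pos by (simp add: sphere_family_def)
  show "Ck_on k I (\<lambda>t. unit_sphere Q (\<S> t))"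
    unfolding unit_sphere_def
    by (rule bounded_bilinear.Ck_on_bilinear[OF bounded_bilinear_scaleR I
          Ck_on_inverse_sqrt[OF I pos lorentz.Ck_on_bilinear[OF I red red]] red])
qed

lemma tangent_unit_sphere:
  assumes "p \<in> M" "is_sphere Q S" "tangent_at Q M S p"
  shows "sphere_fun (unit_sphere Q S) p = 0" "conormal Q M p (sphere_grad (unit_sphere Q S) p)"
    "sphere_grad (unit_sphere Q S) p \<bullet> sphere_grad (unit_sphere Q S) p = 1"
proof -
  have "sphere_fun (reduced_sphere Q S) p = 0" "conormal Q M p (sphere_grad (reduced_sphere Q S) p)"
    using tangent_sphere_iff[OF assms(1) orthogonal_reduced_sphere, of S] assms(2,3)
      is_sphere_reduced tangent_at_reduced by auto
  then show z: "sphere_fun (unit_sphere Q S) p = 0"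
      "conormal Q M p (sphere_grad (unit_sphere Q S) p)"
    by (auto simp: unit_sphere_def conormal_scaleR)
  show "sphere_grad (unit_sphere Q S) p \<bullet> sphere_grad (unit_sphere Q S) p = 1"
    using lorentz_grad_zero[OF z(1) z(1)] lorentz_unit_sphere[OF assms(2)] by simp
qed

lemma unit_conormal_cases:
  assumes "p \<in> M" "conormal Q M p g" "conormal Q M p h" "g \<bullet> g = 1" "h \<bullet> h = 1"
  shows "h = (g \<bullet> h) *\<^sub>R g" "g \<bullet> h = 1 \<or> g \<bullet> h = -1"
proof -
  have "g \<noteq> 0" using assms(4) by auto
  from conormal_unique[OF assms(1-3) this] show h: "h = (g \<bullet> h) *\<^sub>R g"
    using assms(4) by (simp add: inner_commute)
  have "h \<bullet> h = ((g \<bullet> h) *\<^sub>R g) \<bullet> ((g \<bullet> h) *\<^sub>R g)" by (simp only: h[symmetric])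
  then have "(g \<bullet> h) * (g \<bullet> h) = 1" using assms(4,5) by simp
  then show "g \<bullet> h = 1 \<or> g \<bullet> h = -1" using square_eq_1_iff by blast
qed

end

text \<open>
  The last assumption is where the cyclide is used: since \<open>(\<tau>\<^sub>1, \<tau>\<^sub>2)\<close> are local coordinates, any
  two nearby members of the two families touch at a common point of \<open>M\<close>, not only the two
  spheres belonging to the same point.
\<close>

locale cyclide_chart = surface_in_space Q M for Q M :: "'a::euclidean_space set" +
  fixes V :: "'a set" and \<tau>\<^sub>1 \<tau>\<^sub>2 :: "'a \<Rightarrow> real"
    and I\<^sub>1 I\<^sub>2 :: "real set" and T\<^sub>1 T\<^sub>2 :: "real \<Rightarrow> real \<times> 'a \<times> real"
  assumes open_V: "open V" and open_I: "open I\<^sub>1" "open I\<^sub>2"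
    and smooth_\<tau>: "smooth_on V \<tau>\<^sub>1" "smooth_on V \<tau>\<^sub>2"
    and smooth_T: "smooth_on I\<^sub>1 T\<^sub>1" "smooth_on I\<^sub>2 T\<^sub>2"
    and \<tau>_in: "\<And>q. q \<in> M \<inter> V \<Longrightarrow> \<tau>\<^sub>1 q \<in> I\<^sub>1" "\<And>q. q \<in> M \<inter> V \<Longrightarrow> \<tau>\<^sub>2 q \<in> I\<^sub>2"
    and orthogonal_T: "\<And>t. orthogonal_to_space Q (T\<^sub>1 t)" "\<And>t. orthogonal_to_space Q (T\<^sub>2 t)"
    and unit_T: "\<And>t. t \<in> I\<^sub>1 \<Longrightarrow> lorentz (T\<^sub>1 t) (T\<^sub>1 t) = 1" "\<And>t. t \<in> I\<^sub>2 \<Longrightarrow> lorentz (T\<^sub>2 t) (T\<^sub>2 t) = 1"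
    and zero_T: "\<And>q. q \<in> M \<inter> V \<Longrightarrow> sphere_fun (T\<^sub>1 (\<tau>\<^sub>1 q)) q = 0"
      "\<And>q. q \<in> M \<inter> V \<Longrightarrow> sphere_fun (T\<^sub>2 (\<tau>\<^sub>2 q)) q = 0"
    and conormal_T: "\<And>q. q \<in> M \<inter> V \<Longrightarrow> conormal Q M q (sphere_grad (T\<^sub>1 (\<tau>\<^sub>1 q)) q)"
    and grad_eq: "\<And>q. q \<in> M \<inter> V \<Longrightarrow> sphere_grad (T\<^sub>1 (\<tau>\<^sub>1 q)) q = sphere_grad (T\<^sub>2 (\<tau>\<^sub>2 q)) q"
    and curvature_neq: "\<And>q. q \<in> M \<inter> V \<Longrightarrow> fst (T\<^sub>1 (\<tau>\<^sub>1 q)) \<noteq> fst (T\<^sub>2 (\<tau>\<^sub>2 q))"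
    and lorentz_T: "\<And>q q'. q \<in> M \<inter> V \<Longrightarrow> q' \<in> M \<inter> V \<Longrightarrow> lorentz (T\<^sub>1 (\<tau>\<^sub>1 q)) (T\<^sub>2 (\<tau>\<^sub>2 q')) = 1"

section \<open>Derivatives of moving spheres along curves\<close>

lemma smooth_on_has_derivative:
  assumes "smooth_on U f" "open U" "x \<in> U"
  shows "(f has_derivative frechet_derivative f (at x)) (at x)"
proof -
  have "Ck_on (Suc 0) U f" using assms(1) by (simp only: smooth_on_def)
  then show ?thesis
    using assms(2,3) by (simp add: differentiable_on_eq_differentiable_at frechet_derivative_works)
qed

lemma smooth_on_continuous: "smooth_on U f \<Longrightarrow> continuous_on U f"
  using Ck_on.simps(1) smooth_on_def by blast

lemma smooth_on_subset: "smooth_on U f \<Longrightarrow> W \<subseteq> U \<Longrightarrow> smooth_on W f"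
  unfolding smooth_on_def using Ck_on_subset by blast

lemma has_vector_derivative_compose_smooth:
  assumes "smooth_on U f" "open U" "c s \<in> U" "(c has_vector_derivative v) (at s)"
  shows "((\<lambda>t. f (c t)) has_vector_derivative frechet_derivative f (at (c s)) v) (at s)"
  using vector_derivative_diff_chain_within[OF assms(4)
      has_derivative_at_withinI[OF smooth_on_has_derivative[OF assms(1-3)]]] by (simp add: o_def)

text \<open>The velocity of a one-parameter family along any curve through a point is a multiple of
  one vector that depends only on the point. Velocities produced by different curves can therefore
  be compared.\<close>

lemma has_vector_derivative_compose_smooth2:
  fixes \<tau> :: "'a::euclidean_space \<Rightarrow> real" and T :: "real \<Rightarrow> 'b::real_normed_vector"
  assumes "smooth_on U \<tau>" "open U" "c s \<in> U" "smooth_on I T" "open I" "\<tau> (c s) \<in> I"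
    "(c has_vector_derivative v) (at s)"
  shows "((\<lambda>t. T (\<tau> (c t))) has_vector_derivative
    frechet_derivative \<tau> (at (c s)) v *\<^sub>R frechet_derivative T (at (\<tau> (c s))) 1) (at s)"
proof -
  have "linear (frechet_derivative T (at (\<tau> (c s))))"
    using smooth_on_has_derivative[OF assms(4,5,6)] has_derivative_linear by blast
  from linear_cmul[OF this, of "frechet_derivative \<tau> (at (c s)) v" 1]
  show ?thesis
    using has_vector_derivative_compose_smooth[OF assms(4,5,6)
        has_vector_derivative_compose_smooth[OF assms(1-3,7)]] by simp
qed

text \<open>The gradient changes with the sphere and with the point, the latter contributing
  \<open>2 * fst\<close> times the velocity. The relation recovers the velocity of the point of
  contact from the velocities of the two spheres, provided that their leading coefficients
  differ.\<close>

lemma sphere_pencil_derivative: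
  assumes W: "open W" "s \<in> W"
    and eq: "\<And>t. t \<in> W \<Longrightarrow> sphere_grad (A t) (c t) = sphere_grad (B t) (c t)"
    and A: "(A has_vector_derivative A') (at s)" and B: "(B has_vector_derivative B') (at s)"
    and c: "(c has_vector_derivative v) (at s)"
  shows "sphere_grad A' (c s) - sphere_grad B' (c s) = (- 2 * (fst (A s) - fst (B s))) *\<^sub>R v"
proof -
  from has_vector_derivative_transform_within_open[OF has_vector_derivative_sphere_grad[OF A c] W eq]
  have "((\<lambda>t. sphere_grad (B t) (c t)) has_vector_derivative
      sphere_grad A' (c s) + (2 * fst (A s)) *\<^sub>R v) (at s)" .
  from vector_derivative_unique_at[OF this has_vector_derivative_sphere_grad[OF B c]]
  show ?thesis by (simp add: algebra_simps)
qed

lemma tangent_space_localE: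
  fixes p :: "'a::euclidean_space"
  assumes "v \<in> tangent_space X p" "open V" "p \<in> V"
  obtains c W where "open W" "(0::real) \<in> W" "c 0 = p" "(c has_vector_derivative v) (at 0)"
    "\<forall>t\<in>W. c t \<in> X \<inter> V"
proof -
  from assms(1) obtain c \<epsilon> where c: "\<epsilon> > (0::real)" "c ` {-\<epsilon><..<\<epsilon>} \<subseteq> X" "c 0 = p"
    "(c has_vector_derivative v) (at 0)" by (rule tangent_spaceE)
  have "c 0 \<in> V" using assms(3) c(3) by simp
  then have "\<exists>W. open W \<and> 0 \<in> W \<and> (\<forall>t\<in>W. c t \<in> V)"
    using continuous_at_open[THEN iffD1, OF has_vector_derivative_continuous[OF c(4)],
        rule_format, OF conjI[OF assms(2)]] by simp
  then obtain W where W: "open W" "0 \<in> W" "\<forall>t\<in>W. c t \<in> V" by auto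
  show thesis
    by (rule that[of "W \<inter> {-\<epsilon><..<\<epsilon>}" c])
      (use W c in \<open>auto simp: image_subset_iff\<close>)
qed

subsection \<open>Curvature spheres as coordinates\<close>

lemma continuous_preimage_rect:
  assumes "open U" "continuous_on U f" "continuous_on U g" "open A" "open B"
  shows "open {q \<in> U. f q \<in> A \<and> g q \<in> B}"
proof -
  have "{q \<in> U. f q \<in> A \<and> g q \<in> B} = (U \<inter> f -` A) \<inter> (U \<inter> g -` B)" by auto
  then show ?thesis using assms continuous_open_preimage by (metis open_Int)
qed

context surface_in_space
begin

text \<open>The sign compares the orientations of the two spheres. The second part turns positivity,
  an open condition, into equality of the normals, so an orientation matched at one point stays
  matched nearby.\<close>

lemma unit_lorentz_tangent:
  assumes "p \<in> M"
    and "sphere_fun S p = 0" "conormal Q M p (sphere_grad S p)" "lorentz S S = 1"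
    and "sphere_fun S' p = 0" "conormal Q M p (sphere_grad S' p)" "lorentz S' S' = 1"
  shows "lorentz S S' = 1 \<or> lorentz S S' = -1"
    and "0 < lorentz S S' \<Longrightarrow> lorentz S S' = 1 \<and> sphere_grad S p = sphere_grad S' p"
proof -
  have g: "sphere_grad S p \<bullet> sphere_grad S p = 1" "sphere_grad S' p \<bullet> sphere_grad S' p = 1"
    "lorentz S S' = sphere_grad S p \<bullet> sphere_grad S' p"
    using assms lorentz_grad_zero by metis+
  note c = unit_conormal_cases[OF assms(1,3,6) g(1,2)]
  show "lorentz S S' = 1 \<or> lorentz S S' = -1" using c(2) g(3) by simp
  show "0 < lorentz S S' \<Longrightarrow> lorentz S S' = 1 \<and> sphere_grad S p = sphere_grad S' p"
    using c g(3) by auto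
qed

text \<open>By dimension the differential of the pair of parameters, read in a chart, is bijective
  onto the plane. The parameter map is continuous and differentiable at the point in question, so
  its image contains a neighborhood and in it a rectangle.\<close>

lemma ex_surface_point_with_parameters:
  fixes \<tau>\<^sub>1 \<tau>\<^sub>2 :: "'a \<Rightarrow> real"
  assumes "p \<in> M" "open W" "p \<in> W"
    and smooth: "smooth_on W \<tau>\<^sub>1" "smooth_on W \<tau>\<^sub>2"
    and inj: "\<forall>v\<in>tangent_space M p. frechet_derivative \<tau>\<^sub>1 (at p) v = 0 \<and>
      frechet_derivative \<tau>\<^sub>2 (at p) v = 0 \<longrightarrow> v = 0"
  obtains A B where "open A" "open B" "\<tau>\<^sub>1 p \<in> A" "\<tau>\<^sub>2 p \<in> B"
    "\<forall>a\<in>A. \<forall>b\<in>B. \<exists>r\<in>M \<inter> W. \<tau>\<^sub>1 r = a \<and> \<tau>\<^sub>2 r = b"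
proof -
  obtain U and x :: "real^2 \<Rightarrow> 'a" and u L where ch: "open U" "u \<in> U" "x u = p" "x ` U \<subseteq> M"
    "continuous_on U x" "(x has_derivative L) (at u)" "inj L" "tangent_space M p = range L"
    using regular_surface_chart[OF regular assms(1)] by metis
  define U' where "U' = U \<inter> x -` W"
  define f where "f w = (\<tau>\<^sub>1 (x w), \<tau>\<^sub>2 (x w))" for w
  define f' where "f' w = (frechet_derivative \<tau>\<^sub>1 (at p) (L w), frechet_derivative \<tau>\<^sub>2 (at p) (L w))" for w
  have U': "open U'" "u \<in> U'"
    using continuous_open_preimage[OF ch(5,1) assms(2)] ch(2,3) assms(3) by (auto simp: U'_def)
  have d: "((\<lambda>w. \<tau> (x w)) has_derivative (\<lambda>w. frechet_derivative \<tau> (at p) (L w))) (at u)"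
    if "smooth_on W \<tau>" for \<tau> :: "'a \<Rightarrow> real"
    using has_derivative_compose[OF ch(6)] smooth_on_has_derivative[OF that assms(2,3)] ch(3)
    by blast
  have der: "(f has_derivative f') (at u)"
    unfolding f_def[abs_def] f'_def[abs_def] by (intro has_derivative_Pair d smooth)
  have lin: "linear f'" using der has_derivative_linear by blast
  have "inj f'"
  proof (rule linear_injective_0[OF lin, THEN iffD2], intro allI impI)
    fix w assume "f' w = 0"
    then have "L w = 0" using inj[rule_format, of "L w"] ch(8) by (simp add: f'_def zero_prod_def)
    then show "w = 0"
      using ch(7) has_derivative_linear[OF ch(6)] linear_injective_0 by blast
  qed
  then have "dim (range f') = DIM(real \<times> real)"
    using dim_image_eq[OF lin, of UNIV] by simp
  then have "surj f'"
    using dim_eq_full[of "range f'"] linear_subspace_image[OF lin subspace_UNIV] span_eq_iff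
    by metis
  then obtain g where g: "linear g" "f' \<circ> g = id"
    using linear_surjective_right_inverse[OF lin] by blast
  have cont: "continuous_on U' f"
    unfolding f_def
    by (intro continuous_on_Pair continuous_on_compose2[OF smooth_on_continuous[OF smooth(1)]]
        continuous_on_compose2[OF smooth_on_continuous[OF smooth(2)]]
        continuous_on_subset[OF ch(5)]) (auto simp: U'_def)
  have "f u \<in> interior (f ` U')"
    using sussmann_open_mapping[OF U'(1) cont U'(2) der linear_linear[THEN iffD2, OF g(1)] g(2) order_refl]
      U' by (simp add: interior_open)
  then obtain A B where AB: "open A" "open B" "f u \<in> A \<times> B" "A \<times> B \<subseteq> interior (f ` U')"
    by (metis open_interior open_prod_elim)
  have "\<exists>r\<in>M \<inter> W. \<tau>\<^sub>1 r = a \<and> \<tau>\<^sub>2 r = b" if "a \<in> A" "b \<in> B" for a b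
  proof -
    have "(a, b) \<in> f ` U'" using that AB(4) interior_subset by blast
    then obtain w where "w \<in> U'" "(a, b) = f w" by auto
    then show ?thesis using ch(4) by (intro bexI[of _ "x w"]) (auto simp: U'_def f_def)
  qed
  then show thesis using that[OF AB(1,2)] AB(3) ch(3) by (simp add: f_def)
qed

text \<open>Orientations are matched at \<open>p\<close> and remain so nearby; the two spheres at a
  point then share the unit normal but differ in leading coefficient. This makes the differentials
  of the parameters jointly injective on the tangent plane, and the rectangle of realized parameters
  yields the product 1 for all pairs.\<close>

lemma ex_cyclide_chart:
  assumes "dupin_cyclide Q M" "p \<in> M"
  obtains V \<tau>\<^sub>1 \<tau>\<^sub>2 I\<^sub>1 I\<^sub>2 T\<^sub>1 T\<^sub>2 where "p \<in> V" "cyclide_chart Q M V \<tau>\<^sub>1 \<tau>\<^sub>2 I\<^sub>1 I\<^sub>2 T\<^sub>1 T\<^sub>2"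
proof -
  from assms(1)[unfolded dupin_cyclide_def] obtain I\<^sub>1 \<S>\<^sub>1 I\<^sub>2 \<S>\<^sub>2 where
    fam: "sphere_family Q I\<^sub>1 \<S>\<^sub>1" "sphere_family Q I\<^sub>2 \<S>\<^sub>2"
    and env: "envelope Q M I\<^sub>1 \<S>\<^sub>1" "envelope Q M I\<^sub>2 \<S>\<^sub>2"
    and dist: "\<forall>p\<in>M. \<forall>t\<^sub>1\<in>I\<^sub>1. \<forall>t\<^sub>2\<in>I\<^sub>2.
      tangent_at Q M (\<S>\<^sub>1 t\<^sub>1) p \<and> tangent_at Q M (\<S>\<^sub>2 t\<^sub>2) p \<longrightarrow>
      sphere_set Q (\<S>\<^sub>1 t\<^sub>1) \<noteq> sphere_set Q (\<S>\<^sub>2 t\<^sub>2)"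
    by (elim conjE exE) (rule that)
  have sph: "\<And>t. t \<in> I\<^sub>1 \<Longrightarrow> is_sphere Q (\<S>\<^sub>1 t)" "\<And>t. t \<in> I\<^sub>2 \<Longrightarrow> is_sphere Q (\<S>\<^sub>2 t)"
    and I: "open I\<^sub>1" "open I\<^sub>2"
    using fam by (auto simp: sphere_family_def)
  from env(1)[unfolded envelope_def, rule_format, OF assms(2)] obtain V\<^sub>1 \<tau>\<^sub>1 where
    V1: "open V\<^sub>1" "p \<in> V\<^sub>1" "smooth_on V\<^sub>1 \<tau>\<^sub>1"
      "\<And>q. q \<in> M \<inter> V\<^sub>1 \<Longrightarrow> \<tau>\<^sub>1 q \<in> I\<^sub>1 \<and> tangent_at Q M (\<S>\<^sub>1 (\<tau>\<^sub>1 q)) q"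
    by (elim conjE exE) (rule that, auto)
  from env(2)[unfolded envelope_def, rule_format, OF assms(2)] obtain V\<^sub>2 \<tau>\<^sub>2 where
    V2: "open V\<^sub>2" "p \<in> V\<^sub>2" "smooth_on V\<^sub>2 \<tau>\<^sub>2"
      "\<And>q. q \<in> M \<inter> V\<^sub>2 \<Longrightarrow> \<tau>\<^sub>2 q \<in> I\<^sub>2 \<and> tangent_at Q M (\<S>\<^sub>2 (\<tau>\<^sub>2 q)) q"
    by (elim conjE exE) (rule that, auto)
  define T\<^sub>1 where "T\<^sub>1 t = unit_sphere Q (\<S>\<^sub>1 t)" for t
  \<comment> \<open>The sign \<open>1\<close> or \<open>-1\<close> that reverses the second family
    if its normal at \<open>p\<close> is opposite to that of the first.\<close>
  define \<epsilon> where "\<epsilon> = lorentz (T\<^sub>1 (\<tau>\<^sub>1 p)) (unit_sphere Q (\<S>\<^sub>2 (\<tau>\<^sub>2 p)))"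
  define T\<^sub>2 where "T\<^sub>2 t = \<epsilon> *\<^sub>R unit_sphere Q (\<S>\<^sub>2 t)" for t
  have t1: "sphere_fun (T\<^sub>1 (\<tau>\<^sub>1 q)) q = 0" "conormal Q M q (sphere_grad (T\<^sub>1 (\<tau>\<^sub>1 q)) q)"
      "lorentz (T\<^sub>1 (\<tau>\<^sub>1 q)) (T\<^sub>1 (\<tau>\<^sub>1 q)) = 1" if "q \<in> M \<inter> V\<^sub>1" for q
    using tangent_unit_sphere[of q "\<S>\<^sub>1 (\<tau>\<^sub>1 q)"] V1(4)[OF that] that sph(1) lorentz_unit_sphere
    by (auto simp: T\<^sub>1_def)
  have t2': "sphere_fun (unit_sphere Q (\<S>\<^sub>2 (\<tau>\<^sub>2 q))) q = 0"
      "conormal Q M q (sphere_grad (unit_sphere Q (\<S>\<^sub>2 (\<tau>\<^sub>2 q))) q)"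
      "lorentz (unit_sphere Q (\<S>\<^sub>2 (\<tau>\<^sub>2 q))) (unit_sphere Q (\<S>\<^sub>2 (\<tau>\<^sub>2 q))) = 1"
    if "q \<in> M \<inter> V\<^sub>2" for q
    using tangent_unit_sphere[of q "\<S>\<^sub>2 (\<tau>\<^sub>2 q)"] V2(4)[OF that] that sph(2) lorentz_unit_sphere
    by auto
  have p: "p \<in> M \<inter> V\<^sub>1" "p \<in> M \<inter> V\<^sub>2" using assms(2) V1 V2 by auto
  have \<epsilon>: "\<epsilon> * \<epsilon> = 1"
    using unit_lorentz_tangent(1)[OF assms(2) t1[OF p(1)] t2'[OF p(2)]] by (auto simp: \<epsilon>_def)
  have t2: "sphere_fun (T\<^sub>2 (\<tau>\<^sub>2 q)) q = 0" "conormal Q M q (sphere_grad (T\<^sub>2 (\<tau>\<^sub>2 q)) q)"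
      "lorentz (T\<^sub>2 (\<tau>\<^sub>2 q)) (T\<^sub>2 (\<tau>\<^sub>2 q)) = 1" if "q \<in> M \<inter> V\<^sub>2" for q
    using t2'[OF that] \<epsilon> by (auto simp: T\<^sub>2_def conormal_scaleR lorentz.scaleR_left lorentz.scaleR_right)
  have unit: "lorentz (T\<^sub>1 t) (T\<^sub>1 t) = 1" if "t \<in> I\<^sub>1" for t
    using lorentz_unit_sphere sph(1)[OF that] by (simp add: T\<^sub>1_def)
  have unit2: "lorentz (T\<^sub>2 t) (T\<^sub>2 t) = 1" if "t \<in> I\<^sub>2" for t
    using lorentz_unit_sphere sph(2)[OF that] \<epsilon>
    by (simp add: T\<^sub>2_def lorentz.scaleR_left lorentz.scaleR_right)
  have smooth_T: "smooth_on I\<^sub>1 T\<^sub>1" "smooth_on I\<^sub>2 T\<^sub>2"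
    using smooth_unit_sphere[OF fam(1)] smooth_unit_sphere[OF fam(2)]
    by (auto simp: T\<^sub>1_def[abs_def] T\<^sub>2_def[abs_def] smooth_on_def
        intro: Ck_on_linear[OF I(2) bounded_linear_scaleR_right])
  have sets: "sphere_set Q (T\<^sub>1 t) = sphere_set Q (\<S>\<^sub>1 t)" if "t \<in> I\<^sub>1" for t
    using sphere_set_unit_sphere sph(1)[OF that] by (simp add: T\<^sub>1_def)
  have sets2: "sphere_set Q (T\<^sub>2 t) = sphere_set Q (\<S>\<^sub>2 t)" if "t \<in> I\<^sub>2" for t
  proof -
    have "\<epsilon> \<noteq> 0" using \<epsilon> by auto
    then show ?thesis
      using sphere_set_unit_sphere[OF sph(2)[OF that]] by (auto simp: T\<^sub>2_def sphere_set_def)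
  qed

  define h where "h z = lorentz (T\<^sub>1 (fst z)) (T\<^sub>2 (snd z))" for z
  have conth: "continuous_on (I\<^sub>1 \<times> I\<^sub>2) h"
    unfolding h_def
    by (intro lorentz.continuous_on continuous_on_compose2[OF smooth_on_continuous[OF smooth_T(1)]]
        continuous_on_compose2[OF smooth_on_continuous[OF smooth_T(2)]] continuous_intros) auto
  have "open ((I\<^sub>1 \<times> I\<^sub>2) \<inter> h -` {0<..})"
    by (intro continuous_open_preimage conth open_Times I) auto
  moreover have "(\<tau>\<^sub>1 p, \<tau>\<^sub>2 p) \<in> (I\<^sub>1 \<times> I\<^sub>2) \<inter> h -` {0<..}"
    using V1(4)[OF p(1)] V2(4)[OF p(2)] \<epsilon>
    by (simp add: h_def T\<^sub>2_def lorentz.scaleR_right \<epsilon>_def[symmetric])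
  ultimately obtain N1 N2 where N: "open N1" "open N2" "\<tau>\<^sub>1 p \<in> N1" "\<tau>\<^sub>2 p \<in> N2"
    "N1 \<times> N2 \<subseteq> (I\<^sub>1 \<times> I\<^sub>2) \<inter> h -` {0<..}"
    by (metis open_prod_elim mem_Times_iff fst_conv snd_conv)
  define W where "W = {q \<in> V\<^sub>1 \<inter> V\<^sub>2. \<tau>\<^sub>1 q \<in> N1 \<and> \<tau>\<^sub>2 q \<in> N2}"
  have "W \<subseteq> V\<^sub>1" "W \<subseteq> V\<^sub>2" by (auto simp: W_def)
  then have smW: "smooth_on W \<tau>\<^sub>1" "smooth_on W \<tau>\<^sub>2"
    using smooth_on_subset V1(3) V2(3) by blast+
  have W: "open W" "p \<in> W"
    using continuous_preimage_rect[of "V\<^sub>1 \<inter> V\<^sub>2" \<tau>\<^sub>1 \<tau>\<^sub>2 N1 N2] V1(1,2) V2(1,2) N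
      continuous_on_subset[OF smooth_on_continuous[OF V1(3)], of "V\<^sub>1 \<inter> V\<^sub>2"]
      continuous_on_subset[OF smooth_on_continuous[OF V2(3)], of "V\<^sub>1 \<inter> V\<^sub>2"]
    by (auto simp: W_def)
  have touch: "lorentz (T\<^sub>1 (\<tau>\<^sub>1 q)) (T\<^sub>2 (\<tau>\<^sub>2 q)) = 1"
      "sphere_grad (T\<^sub>1 (\<tau>\<^sub>1 q)) q = sphere_grad (T\<^sub>2 (\<tau>\<^sub>2 q)) q" if q: "q \<in> M \<inter> W" for q
  proof -
    have "q \<in> M" "q \<in> M \<inter> V\<^sub>1" "q \<in> M \<inter> V\<^sub>2" "(\<tau>\<^sub>1 q, \<tau>\<^sub>2 q) \<in> N1 \<times> N2" using q by (auto simp: W_def)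
    moreover from this have "0 < lorentz (T\<^sub>1 (\<tau>\<^sub>1 q)) (T\<^sub>2 (\<tau>\<^sub>2 q))" using N(5) by (auto simp: h_def)
    ultimately show "lorentz (T\<^sub>1 (\<tau>\<^sub>1 q)) (T\<^sub>2 (\<tau>\<^sub>2 q)) = 1"
      "sphere_grad (T\<^sub>1 (\<tau>\<^sub>1 q)) q = sphere_grad (T\<^sub>2 (\<tau>\<^sub>2 q)) q"
      using unit_lorentz_tangent(2)[OF _ t1 t2] by blast+
  qed
  have curv: "fst (T\<^sub>1 (\<tau>\<^sub>1 q)) \<noteq> fst (T\<^sub>2 (\<tau>\<^sub>2 q))" if q: "q \<in> M \<inter> W" for q
  proof
    assume eq: "fst (T\<^sub>1 (\<tau>\<^sub>1 q)) = fst (T\<^sub>2 (\<tau>\<^sub>2 q))"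
    have q': "q \<in> M" "q \<in> M \<inter> V\<^sub>1" "q \<in> M \<inter> V\<^sub>2" using q by (auto simp: W_def)
    \<comment> \<open>With equal values, gradients and leading coefficients the two equations
      coincide, against the assumption that the two families never share a tangent sphere at a
      point.\<close>
    have "T\<^sub>1 (\<tau>\<^sub>1 q) - T\<^sub>2 (\<tau>\<^sub>2 q) = 0"
      using point_sphereI[of "T\<^sub>1 (\<tau>\<^sub>1 q) - T\<^sub>2 (\<tau>\<^sub>2 q)" q] t1(1)[OF q'(2)] t2(1)[OF q'(3)] touch(2)[OF q] eq
      by simp
    then show False
      using dist[rule_format, OF q'(1)] V1(4)[OF q'(2)] V2(4)[OF q'(3)] sets sets2 by (metis right_minus_eq)
  qed
  \<comment> \<open>If both parameters are stationary along \<open>v\<close>, both spheres are; the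
    common normal then has two derivatives, which are different multiples of \<open>v\<close> unless
    \<open>v = 0\<close>.\<close>
  have "v = 0" if v: "v \<in> tangent_space M p" and z: "frechet_derivative \<tau>\<^sub>1 (at p) v = 0"
    "frechet_derivative \<tau>\<^sub>2 (at p) v = 0" for v
  proof -
    from v W obtain c D where c: "open D" "(0::real) \<in> D" "c 0 = p"
      "(c has_vector_derivative v) (at 0)" "\<forall>t\<in>D. c t \<in> M \<inter> W" by (rule tangent_space_localE)
    have "((\<lambda>t. T\<^sub>1 (\<tau>\<^sub>1 (c t))) has_vector_derivative 0) (at 0)"
      using has_vector_derivative_compose_smooth2[OF V1(3,1) _ smooth_T(1) I(1) _ c(4)] c(3)
        V1(2) V1(4)[OF p(1)] z by simp
    moreover have "((\<lambda>t. T\<^sub>2 (\<tau>\<^sub>2 (c t))) has_vector_derivative 0) (at 0)"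
      using has_vector_derivative_compose_smooth2[OF V2(3,1) _ smooth_T(2) I(2) _ c(4)] c(3)
        V2(2) V2(4)[OF p(2)] z by simp
    ultimately have "(- 2 * (fst (T\<^sub>1 (\<tau>\<^sub>1 (c 0))) - fst (T\<^sub>2 (\<tau>\<^sub>2 (c 0))))) *\<^sub>R v =
        sphere_grad 0 p - sphere_grad 0 p"
      using sphere_pencil_derivative[OF c(1,2) _ _ _ c(4), of "\<lambda>t. T\<^sub>1 (\<tau>\<^sub>1 (c t))" "\<lambda>t. T\<^sub>2 (\<tau>\<^sub>2 (c t))" 0 0]
        touch(2) c(5) by simp
    then show "v = 0" using curv[of p] assms(2) W(2) c(3) by simp
  qed
  then have "\<forall>v\<in>tangent_space M p. frechet_derivative \<tau>\<^sub>1 (at p) v = 0 \<and>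
      frechet_derivative \<tau>\<^sub>2 (at p) v = 0 \<longrightarrow> v = 0" by blast
  then obtain A B where AB: "open A" "open B" "\<tau>\<^sub>1 p \<in> A" "\<tau>\<^sub>2 p \<in> B"
    "\<forall>a\<in>A. \<forall>b\<in>B. \<exists>r\<in>M \<inter> W. \<tau>\<^sub>1 r = a \<and> \<tau>\<^sub>2 r = b"
    by (rule ex_surface_point_with_parameters[OF assms(2) W smW])
  define V where "V = {q \<in> W. \<tau>\<^sub>1 q \<in> A \<and> \<tau>\<^sub>2 q \<in> B}"
  have V: "open V" "p \<in> V" "V \<subseteq> W"
    using continuous_preimage_rect[OF W(1) smooth_on_continuous[OF smW(1)]
        smooth_on_continuous[OF smW(2)] AB(1,2)] W(2) AB(3,4) by (auto simp: V_def)
  have cross: "lorentz (T\<^sub>1 (\<tau>\<^sub>1 q)) (T\<^sub>2 (\<tau>\<^sub>2 q')) = 1" if "q \<in> M \<inter> V" "q' \<in> M \<inter> V" for q q'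
  proof -
    have "\<tau>\<^sub>1 q \<in> A" "\<tau>\<^sub>2 q' \<in> B" using that by (auto simp: V_def)
    \<comment> \<open>The point \<open>r\<close> where the sphere of \<open>q\<close> touches the
      sphere of \<open>q'\<close> may lie outside \<open>V\<close>; it suffices that it lies in
      \<open>W\<close>, where orientations match.\<close>
    from AB(5)[rule_format, OF this] obtain r
      where "r \<in> M \<inter> W" "\<tau>\<^sub>1 r = \<tau>\<^sub>1 q" "\<tau>\<^sub>2 r = \<tau>\<^sub>2 q'" by blast
    then show ?thesis using touch(1) by metis
  qed
  have sub: "q \<in> M \<inter> W" "q \<in> M \<inter> V\<^sub>1" "q \<in> M \<inter> V\<^sub>2" if "q \<in> M \<inter> V" for q
    using that by (auto simp: V_def W_def)
  have orth: "orthogonal_to_space Q (T\<^sub>1 t)" "orthogonal_to_space Q (T\<^sub>2 t)" for t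
    unfolding T\<^sub>1_def T\<^sub>2_def by (intro orthogonal_unit_sphere orthogonal_to_space_scaleR)+
  have "cyclide_chart Q M V \<tau>\<^sub>1 \<tau>\<^sub>2 I\<^sub>1 I\<^sub>2 T\<^sub>1 T\<^sub>2"
    by unfold_locales
      (use V(1) I smooth_on_subset[OF smW(1) V(3)] smooth_on_subset[OF smW(2) V(3)] smooth_T
        V1(4)[OF sub(2)] V2(4)[OF sub(3)] unit unit2 t1(1,2)[OF sub(2)] t2(1)[OF sub(3)]
        touch(2)[OF sub(1)] curv[OF sub(1)] cross orth in auto)
  then show thesis using that V(2) by blast
qed

end

subsection \<open>Contact of a curve with the tangent spheres\<close>

lemma has_vector_derivative_constant_on_open:
  assumes "open J" "s \<in> J" "\<And>t. t \<in> J \<Longrightarrow> f t = c" "(f has_vector_derivative D) (at s)"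
  shows "D = 0"
  using vector_derivative_unique_at[OF assms(4)
      has_vector_derivative_transform_within_open[OF has_vector_derivative_const assms(1,2)]] assms(3)
  by auto

text \<open>By the Leibniz rule the derivatives of \<open>h\<close> up to order 3 are a triangular
  system in those of \<open>f\<close>, with the nonzero number \<open>g s\<close> on the
  diagonal.\<close>

lemma derivatives_zero_mult_iff:
  fixes f g h :: "real \<Rightarrow> real"
  assumes J: "open J" "s \<in> J" and eq: "\<And>t. t \<in> J \<Longrightarrow> h t = g t * f t" and nz: "g s \<noteq> 0"
    and f: "\<And>t. t \<in> J \<Longrightarrow> (f has_real_derivative f1 t) (at t)"
    "\<And>t. t \<in> J \<Longrightarrow> (f1 has_real_derivative f2 t) (at t)"
    "\<And>t. t \<in> J \<Longrightarrow> (f2 has_real_derivative f3 t) (at t)"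
    and g: "\<And>t. t \<in> J \<Longrightarrow> (g has_real_derivative g1 t) (at t)"
    "\<And>t. t \<in> J \<Longrightarrow> (g1 has_real_derivative g2 t) (at t)"
    "\<And>t. t \<in> J \<Longrightarrow> (g2 has_real_derivative g3 t) (at t)"
    and h: "\<And>t. t \<in> J \<Longrightarrow> (h has_real_derivative h1 t) (at t)"
    "\<And>t. t \<in> J \<Longrightarrow> (h1 has_real_derivative h2 t) (at t)"
    "\<And>t. t \<in> J \<Longrightarrow> (h2 has_real_derivative h3 t) (at t)"
  shows "h s = 0 \<and> h1 s = 0 \<and> h2 s = 0 \<and> h3 s = 0 \<longleftrightarrow> f s = 0 \<and> f1 s = 0 \<and> f2 s = 0 \<and> f3 s = 0"
proof -
  have u: "D = D'" if "t \<in> J" "\<And>t. t \<in> J \<Longrightarrow> k t = k' t" "(k has_real_derivative D) (at t)"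
    "(k' has_real_derivative D') (at t)" for k k' :: "real \<Rightarrow> real" and D D' t
    using has_field_derivative_transform_within_open[OF that(3) J(1) that(1,2)] that(4) DERIV_unique
    by blast
  have e1: "h1 t = g1 t * f t + g t * f1 t" if "t \<in> J" for t
    using u[OF that eq h(1)[OF that] DERIV_mult[OF g(1)[OF that] f(1)[OF that]]]
    by (simp add: algebra_simps)
  have e2: "h2 t = g2 t * f t + (2 * g1 t * f1 t + g t * f2 t)" if "t \<in> J" for t
    using u[OF that e1 h(2)[OF that] DERIV_add[OF DERIV_mult[OF g(2)[OF that] f(1)[OF that]]
          DERIV_mult[OF g(1)[OF that] f(2)[OF that]]]]
    by (simp add: algebra_simps)
  have e3: "h3 t = g3 t * f t + 3 * g2 t * f1 t + 3 * g1 t * f2 t + g t * f3 t" if "t \<in> J" for t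
    using u[OF that e2 h(3)[OF that] DERIV_add[OF DERIV_mult[OF g(3)[OF that] f(1)[OF that]]
          DERIV_add[OF DERIV_mult[OF DERIV_cmult[OF g(2)[OF that]] f(2)[OF that]]
          DERIV_mult[OF g(1)[OF that] f(3)[OF that]]]]]
    by (simp add: algebra_simps)
  show ?thesis
    unfolding eq[OF J(2)] e1[OF J(2)] e2[OF J(2)] e3[OF J(2)] using nz by auto
qed

locale cyclide_curve = cyclide_chart Q M V \<tau>\<^sub>1 \<tau>\<^sub>2 I\<^sub>1 I\<^sub>2 T\<^sub>1 T\<^sub>2
  for Q M V :: "'a::euclidean_space set" and \<tau>\<^sub>1 \<tau>\<^sub>2 I\<^sub>1 I\<^sub>2 T\<^sub>1 T\<^sub>2 +
  fixes J :: "real set" and \<gamma> \<gamma>' :: "real \<Rightarrow> 'a"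
  assumes open_J: "open J" and \<gamma>_in: "\<And>s. s \<in> J \<Longrightarrow> \<gamma> s \<in> M \<inter> V"
    and C3: "Ck_on 3 J \<gamma>"
    and \<gamma>': "\<And>s. s \<in> J \<Longrightarrow> (\<gamma> has_vector_derivative \<gamma>' s) (at s)"
    and unit_speed: "\<And>s. s \<in> J \<Longrightarrow> norm (\<gamma>' s) = 1"
begin

definition "c\<^sub>1 s = T\<^sub>1 (\<tau>\<^sub>1 (\<gamma> s))"
definition "c\<^sub>2 s = T\<^sub>2 (\<tau>\<^sub>2 (\<gamma> s))"

lemma C3_c: "Ck_on 3 J c\<^sub>1" "Ck_on 3 J c\<^sub>2"
proof -
  have im: "\<gamma> ` J \<subseteq> V" "(\<lambda>s. \<tau>\<^sub>1 (\<gamma> s)) ` J \<subseteq> I\<^sub>1" "(\<lambda>s. \<tau>\<^sub>2 (\<gamma> s)) ` J \<subseteq> I\<^sub>2"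
    using \<gamma>_in \<tau>_in by auto
  note sm = smooth_\<tau>[unfolded smooth_on_def, rule_format] smooth_T[unfolded smooth_on_def, rule_format]
  show "Ck_on 3 J c\<^sub>1" unfolding c\<^sub>1_def[abs_def]
    by (rule Ck_on_compose_curve[OF open_J open_I(1) im(2) sm(3)
          Ck_on_compose_curve[OF open_J open_V im(1) sm(1) C3]])
  show "Ck_on 3 J c\<^sub>2" unfolding c\<^sub>2_def[abs_def]
    by (rule Ck_on_compose_curve[OF open_J open_I(2) im(3) sm(4)
          Ck_on_compose_curve[OF open_J open_V im(1) sm(2) C3]])
qed

text \<open>The factor between \<open>c\<^sub>1 - c\<^sub>2\<close> and the point sphere of
  \<open>\<gamma>\<close>, whose leading coefficient is 1. It is nonzero because the two curvature
  spheres differ.\<close>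

definition "\<phi> s = fst (c\<^sub>1 s) - fst (c\<^sub>2 s)"

lemma \<phi>_nonzero: "s \<in> J \<Longrightarrow> \<phi> s \<noteq> 0"
  using curvature_neq[OF \<gamma>_in] by (simp add: \<phi>_def c\<^sub>1_def c\<^sub>2_def)

lemma sphere_fun_c: "s \<in> J \<Longrightarrow> sphere_fun (c\<^sub>1 s) (\<gamma> s) = 0" "s \<in> J \<Longrightarrow> sphere_fun (c\<^sub>2 s) (\<gamma> s) = 0"
  using zero_T[OF \<gamma>_in] by (auto simp: c\<^sub>1_def c\<^sub>2_def)

lemma sphere_grad_c: "s \<in> J \<Longrightarrow> sphere_grad (c\<^sub>1 s) (\<gamma> s) = sphere_grad (c\<^sub>2 s) (\<gamma> s)"
  using grad_eq[OF \<gamma>_in] by (auto simp: c\<^sub>1_def c\<^sub>2_def)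

lemma lorentz_c:
  "s \<in> J \<Longrightarrow> lorentz (c\<^sub>1 s) (c\<^sub>1 s) = 1" "s \<in> J \<Longrightarrow> lorentz (c\<^sub>2 s) (c\<^sub>2 s) = 1"
  "s \<in> J \<Longrightarrow> t \<in> J \<Longrightarrow> lorentz (c\<^sub>1 s) (c\<^sub>2 t) = 1"
  using unit_T \<tau>_in[OF \<gamma>_in] lorentz_T[OF \<gamma>_in \<gamma>_in] by (auto simp: c\<^sub>1_def c\<^sub>2_def)

lemma c_diff: "s \<in> J \<Longrightarrow> c\<^sub>1 s - c\<^sub>2 s = \<phi> s *\<^sub>R point_sphere (\<gamma> s)"
  using point_sphereI[of "c\<^sub>1 s - c\<^sub>2 s" "\<gamma> s"] sphere_fun_c sphere_grad_c by (simp add: \<phi>_def)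

lemma lorentz_c_diff: "s \<in> J \<Longrightarrow> lorentz S (c\<^sub>1 s - c\<^sub>2 s) = (- 2 * \<phi> s) * sphere_fun S (\<gamma> s)"
  by (simp add: c_diff lorentz.scaleR_right lorentz_point_sphere)

text \<open>The point sphere is a multiple of \<open>c\<^sub>1 s - c\<^sub>2 s\<close>, so passing
  through \<open>\<gamma> s\<close> can be tested on the two curvature spheres.\<close>

lemma sphere_fun_zeroI:
  assumes "s \<in> J" "lorentz S (c\<^sub>1 s) = lorentz S (c\<^sub>2 s)"
  shows "sphere_fun S (\<gamma> s) = 0"
  using lorentz_c_diff[OF assms(1), of S] assms(2) \<phi>_nonzero[OF assms(1)]
  by (simp add: lorentz.diff_right)

end

locale cyclide_curve_derivs = cyclide_curve +
  fixes p1 p2 p3 q1 q2 q3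
  assumes p: "\<And>s. s \<in> J \<Longrightarrow> (c\<^sub>1 has_vector_derivative p1 s) (at s)"
    "\<And>s. s \<in> J \<Longrightarrow> (p1 has_vector_derivative p2 s) (at s)"
    "\<And>s. s \<in> J \<Longrightarrow> (p2 has_vector_derivative p3 s) (at s)"
  and q: "\<And>s. s \<in> J \<Longrightarrow> (c\<^sub>2 has_vector_derivative q1 s) (at s)"
    "\<And>s. s \<in> J \<Longrightarrow> (q1 has_vector_derivative q2 s) (at s)"
    "\<And>s. s \<in> J \<Longrightarrow> (q2 has_vector_derivative q3 s) (at s)"
begin

section \<open>Products of the derivatives of the two sphere curves\<close>

lemma lorentz_const_deriv:
  assumes "s \<in> J" "(Y has_vector_derivative Y') (at s)" "\<And>t. t \<in> J \<Longrightarrow> lorentz S (Y t) = k"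
  shows "lorentz S Y' = 0"
  using has_vector_derivative_constant_on_open[OF open_J assms(1,3)
      bounded_linear.has_vector_derivative[OF lorentz.bounded_linear_right assms(2)]] by simp

lemma lorentz_c2_const_derivs:
  assumes "s \<in> J" "\<And>t. t \<in> J \<Longrightarrow> lorentz S (c\<^sub>2 t) = k"
  shows "lorentz S (q1 s) = 0" "lorentz S (q2 s) = 0" "lorentz S (q3 s) = 0"
proof -
  have a: "lorentz S (q1 t) = 0" if "t \<in> J" for t
    by (rule lorentz_const_deriv[OF that q(1)[OF that] assms(2)])
  have b: "lorentz S (q2 t) = 0" if "t \<in> J" for t
    by (rule lorentz_const_deriv[OF that q(2)[OF that] a])
  have "lorentz S (q3 t) = 0" if "t \<in> J" for t
    by (rule lorentz_const_deriv[OF that q(3)[OF that] b])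
  then show "lorentz S (q1 s) = 0" "lorentz S (q2 s) = 0" "lorentz S (q3 s) = 0"
    using a b assms(1) by auto
qed

lemma lorentz_c1_const_derivs:
  assumes "s \<in> J" "\<And>t. t \<in> J \<Longrightarrow> lorentz S (c\<^sub>1 t) = k"
  shows "lorentz S (p1 s) = 0" "lorentz S (p2 s) = 0" "lorentz S (p3 s) = 0"
proof -
  have a: "lorentz S (p1 t) = 0" if "t \<in> J" for t
    by (rule lorentz_const_deriv[OF that p(1)[OF that] assms(2)])
  have b: "lorentz S (p2 t) = 0" if "t \<in> J" for t
    by (rule lorentz_const_deriv[OF that p(2)[OF that] a])
  have "lorentz S (p3 t) = 0" if "t \<in> J" for t
    by (rule lorentz_const_deriv[OF that p(3)[OF that] b])
  then show "lorentz S (p1 s) = 0" "lorentz S (p2 s) = 0" "lorentz S (p3 s) = 0"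
    using a b assms(1) by auto
qed

text \<open>The product of \<open>c\<^sub>1 s\<close> and \<open>c\<^sub>2 t\<close> is 1 for
  independent \<open>s\<close> and \<open>t\<close>, so one factor can be frozen while the other is
  differentiated. Differentiating once in each variable gives the orthogonality of the velocities;
  constancy on the diagonal \<open>s = t\<close> alone would not.\<close>

lemma lorentz_cross_derivs:
  assumes "s \<in> J"
  shows "lorentz (c\<^sub>1 s) (q1 s) = 0" "lorentz (c\<^sub>1 s) (q2 s) = 0" "lorentz (c\<^sub>1 s) (q3 s) = 0"
    "lorentz (c\<^sub>2 s) (p1 s) = 0" "lorentz (c\<^sub>2 s) (p2 s) = 0" "lorentz (c\<^sub>2 s) (p3 s) = 0"
    "lorentz (p1 s) (q1 s) = 0"
proof -
  show "lorentz (c\<^sub>1 s) (q1 s) = 0" "lorentz (c\<^sub>1 s) (q2 s) = 0" "lorentz (c\<^sub>1 s) (q3 s) = 0"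
    using lorentz_c2_const_derivs[OF assms, of "c\<^sub>1 s" 1] lorentz_c(3)[OF assms] by auto
  have c: "lorentz (c\<^sub>2 t) (p1 s) = 0" "lorentz (c\<^sub>2 t) (p2 s) = 0" "lorentz (c\<^sub>2 t) (p3 s) = 0"
    if "t \<in> J" for t
    using lorentz_c1_const_derivs[OF assms, of "c\<^sub>2 t" 1] lorentz_c(3)[OF _ that] by (auto simp: lorentz_commute)
  then show "lorentz (c\<^sub>2 s) (p1 s) = 0" "lorentz (c\<^sub>2 s) (p2 s) = 0" "lorentz (c\<^sub>2 s) (p3 s) = 0"
    using assms by auto
  show "lorentz (p1 s) (q1 s) = 0"
    using lorentz_c2_const_derivs(1)[OF assms, of "p1 s" 0] c(1) by (simp add: lorentz_commute)
qed

text \<open>Repeated differentiation of the constant self-product. The results are the expansion to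
  order 3 of the product of \<open>c s\<close> with \<open>c t\<close>, which is 1 minus half the
  squared chord.\<close>

lemma lorentz_unit_curve:
  assumes "open J" "\<And>t. t \<in> J \<Longrightarrow> lorentz (c t) (c t) = 1"
    and d: "\<And>s. s \<in> J \<Longrightarrow> (c has_vector_derivative d1 s) (at s)"
    "\<And>s. s \<in> J \<Longrightarrow> (d1 has_vector_derivative d2 s) (at s)"
    "\<And>s. s \<in> J \<Longrightarrow> (d2 has_vector_derivative d3 s) (at s)"
    and "s \<in> J"
  shows "lorentz (c s) (d1 s) = 0" "lorentz (c s) (d2 s) = - lorentz (d1 s) (d1 s)"
    "lorentz (c s) (d3 s) = - 3 * lorentz (d1 s) (d2 s)"
proof -
  have a: "lorentz (c t) (d1 t) = 0" if "t \<in> J" for t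
    using has_vector_derivative_constant_on_open[OF assms(1) that assms(2)
        lorentz.has_vector_derivative[OF d(1)[OF that] d(1)[OF that]]]
    by (simp add: lorentz_commute)
  have b: "lorentz (c t) (d2 t) + lorentz (d1 t) (d1 t) = 0" if "t \<in> J" for t
    using has_vector_derivative_constant_on_open[OF assms(1) that a
        lorentz.has_vector_derivative[OF d(1)[OF that] d(2)[OF that]]] by simp
  have "lorentz (c t) (d3 t) + 3 * lorentz (d1 t) (d2 t) = 0" if "t \<in> J" for t
    using has_vector_derivative_constant_on_open[OF assms(1) that b has_vector_derivative_add[OF
          lorentz.has_vector_derivative[OF d(1)[OF that] d(3)[OF that]]
          lorentz.has_vector_derivative[OF d(2)[OF that] d(2)[OF that]]]]
    by (simp add: lorentz_commute[of "d2 t"])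
  then show "lorentz (c s) (d1 s) = 0" "lorentz (c s) (d2 s) = - lorentz (d1 s) (d1 s)"
    "lorentz (c s) (d3 s) = - 3 * lorentz (d1 s) (d2 s)"
    using a b assms(6) by (auto simp: eq_neg_iff_add_eq_0)
qed

lemmas lorentz_c1_derivs = lorentz_unit_curve[OF open_J lorentz_c(1) p, simplified]
lemmas lorentz_c2_derivs = lorentz_unit_curve[OF open_J lorentz_c(2) q, simplified]

text \<open>
  \<open>c\<^sub>1 - c\<^sub>2\<close> is a nonvanishing multiple of the point sphere of \<open>\<gamma>\<close>, and a nonvanishing factor does
  not change the order of contact.
\<close>

lemma contact_iff:
  assumes "s \<in> J"
  shows "contact_order_ge 3 S \<gamma> s \<longleftrightarrow>
    (let S' = reduced_sphere Q S in
      lorentz S' (c\<^sub>1 s - c\<^sub>2 s) = 0 \<and> lorentz S' (p1 s - q1 s) = 0 \<and>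
      lorentz S' (p2 s - q2 s) = 0 \<and> lorentz S' (p3 s - q3 s) = 0)"
proof -
  define S' where "S' = reduced_sphere Q S"
  have "Ck_on 3 J (\<lambda>t. fst S * (\<gamma> t \<bullet> \<gamma> t) + (fst (snd S) \<bullet> \<gamma> t + snd (snd S)))"
    by (intro Ck_on_add[OF open_J] Ck_on_const[OF open_J] C3
        Ck_on_linear[OF open_J bounded_linear_mult_right]
        Ck_on_linear[OF open_J bounded_linear_inner_right]
        bounded_bilinear.Ck_on_bilinear[OF bounded_bilinear_inner open_J])
  moreover have "(\<lambda>t. fst S * (\<gamma> t \<bullet> \<gamma> t) + (fst (snd S) \<bullet> \<gamma> t + snd (snd S))) =
      (\<lambda>t. sphere_fun S (\<gamma> t))"
    by (simp add: sphere_fun_def case_prod_beta power2_norm_eq_inner add.assoc)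
  ultimately have "Ck_on 3 J (\<lambda>t. sphere_fun S (\<gamma> t))" by simp
  then obtain f1 f2 f3 where
    "\<And>s. s \<in> J \<Longrightarrow> ((\<lambda>t. sphere_fun S (\<gamma> t)) has_vector_derivative f1 s) (at s)"
    "\<And>s. s \<in> J \<Longrightarrow> (f1 has_vector_derivative f2 s) (at s)"
    "\<And>s. s \<in> J \<Longrightarrow> (f2 has_vector_derivative f3 s) (at s)"
    by (rule Ck_on_3D[OF open_J]) (rule that)
  note f = this[folded has_real_derivative_iff_has_vector_derivative]
  have lin: "((\<lambda>t. lorentz S' (Y t - Z t)) has_real_derivative lorentz S' (Y' - Z')) (at t)"
    "((\<lambda>t. - 2 * (fst (Y t) - fst (Z t))) has_real_derivative - 2 * (fst Y' - fst Z')) (at t)"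
    if "(Y has_vector_derivative Y') (at t)" "(Z has_vector_derivative Z') (at t)" for Y Y' Z Z' t
    unfolding has_real_derivative_iff_has_vector_derivative
    by (intro bounded_linear.has_vector_derivative[OF lorentz.bounded_linear_right]
        bounded_linear.has_vector_derivative[OF bounded_linear_mult_right]
        bounded_linear.has_vector_derivative[OF bounded_linear_fst] has_vector_derivative_diff that)+
  have eq: "lorentz S' (c\<^sub>1 t - c\<^sub>2 t) = (- 2 * (fst (c\<^sub>1 t) - fst (c\<^sub>2 t))) * sphere_fun S (\<gamma> t)"
    if "t \<in> J" for t
    using lorentz_c_diff[OF that, of S'] sphere_fun_reduced[of "\<gamma> t" S] \<gamma>_in[OF that] subset
    by (auto simp: S'_def \<phi>_def)
  have nz: "- 2 * (fst (c\<^sub>1 s) - fst (c\<^sub>2 s)) \<noteq> 0"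
    using \<phi>_nonzero[OF assms] by (simp add: \<phi>_def)
  have "contact_order_ge 3 S \<gamma> s \<longleftrightarrow>
      sphere_fun S (\<gamma> s) = 0 \<and> f1 s = 0 \<and> f2 s = 0 \<and> f3 s = 0"
    unfolding contact_order_ge_def by (rule deriv_iterate_upto_3[OF open_J assms f])
  also have "\<dots> \<longleftrightarrow> lorentz S' (c\<^sub>1 s - c\<^sub>2 s) = 0 \<and> lorentz S' (p1 s - q1 s) = 0 \<and>
      lorentz S' (p2 s - q2 s) = 0 \<and> lorentz S' (p3 s - q3 s) = 0"
    by (rule derivatives_zero_mult_iff[OF open_J assms eq nz f lin(2)[OF p(1) q(1)]
          lin(2)[OF p(2) q(2)] lin(2)[OF p(3) q(3)] lin(1)[OF p(1) q(1)]
          lin(1)[OF p(2) q(2)] lin(1)[OF p(3) q(3)], symmetric])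
  finally show ?thesis by (simp only: Let_def S'_def)
qed

text \<open>
  By Pythagoras, \<open>A / (A + B)\<close> is the squared cosine of the angle of \<open>\<gamma>\<close> with a principal direction.
\<close>

definition "A s = lorentz (p1 s) (p1 s)"
definition "B s = lorentz (q1 s) (q1 s)"
definition "A' s = 2 * lorentz (p1 s) (p2 s)"
definition "B' s = 2 * lorentz (q1 s) (q2 s)"

lemma sphere_fun_derivs:
  assumes "s \<in> J"
  shows "sphere_fun (p1 s) (\<gamma> s) = 0" "sphere_fun (q1 s) (\<gamma> s) = 0"
  using sphere_fun_zeroI[OF assms, of "p1 s"] sphere_fun_zeroI[OF assms, of "q1 s"]
    lorentz_cross_derivs[OF assms] lorentz_c1_derivs(1)[OF assms] lorentz_c2_derivs(1)[OF assms]
  by (auto simp: lorentz_commute)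

text \<open>The derivatives \<open>p1 s\<close> and \<open>q1 s\<close>, read as equations, vanish
  at \<open>\<gamma> s\<close>, so their Lorentz products are Euclidean products of gradients. The
  two gradients are the legs of a right triangle whose hypotenuse is a multiple of the
  velocity.\<close>

lemma grad_derivs:
  assumes "s \<in> J"
  shows "sphere_grad (p1 s) (\<gamma> s) - sphere_grad (q1 s) (\<gamma> s) = (- 2 * \<phi> s) *\<^sub>R \<gamma>' s"
    and "sphere_grad (p1 s) (\<gamma> s) \<bullet> sphere_grad (q1 s) (\<gamma> s) = 0"
    and "A s = sphere_grad (p1 s) (\<gamma> s) \<bullet> sphere_grad (p1 s) (\<gamma> s)"
    and "B s = sphere_grad (q1 s) (\<gamma> s) \<bullet> sphere_grad (q1 s) (\<gamma> s)"
  using sphere_pencil_derivative[OF open_J assms sphere_grad_c p(1)[OF assms] q(1)[OF assms]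
      \<gamma>'[OF assms]] lorentz_grad_zero[of _ "\<gamma> s"] sphere_fun_derivs[OF assms] lorentz_cross_derivs(7)[OF assms]
  by (auto simp: \<phi>_def A_def B_def)

lemma A_plus_B: "s \<in> J \<Longrightarrow> A s + B s = 4 * (\<phi> s)\<^sup>2"
proof -
  assume s: "s \<in> J"
  note g = grad_derivs[OF s]
  have "A s + B s = (sphere_grad (p1 s) (\<gamma> s) - sphere_grad (q1 s) (\<gamma> s)) \<bullet>
      (sphere_grad (p1 s) (\<gamma> s) - sphere_grad (q1 s) (\<gamma> s))"
    using g(2-4) by (simp add: inner_simps inner_commute)
  also have "\<dots> = 4 * (\<phi> s)\<^sup>2 * (\<gamma>' s \<bullet> \<gamma>' s)"
    unfolding g(1) by (simp add: power2_eq_square)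
  finally show ?thesis
    using unit_speed[OF s] by (simp add: power2_norm_eq_inner[symmetric])
qed

lemma A_plus_B_pos: "s \<in> J \<Longrightarrow> 0 < A s + B s"
  using A_plus_B \<phi>_nonzero by simp

text \<open>A sphere tangent at \<open>\<gamma> s\<close> is a combination of
  \<open>c\<^sub>1 s\<close> and \<open>c\<^sub>2 s\<close>, for which the conditions of order 0 and
  1 hold. Orders 2 and 3 are linear in the two coefficients; a nontrivial solution forces the
  determinant to vanish, and conversely the coefficients \<open>B s\<close>, \<open>A s\<close>
  solve the system.\<close>

lemma darboux_iff:
  assumes "s \<in> J"
  shows "(\<exists>S. is_sphere Q S \<and> contact_order_ge 3 S \<gamma> s \<and> tangent_at Q M S (\<gamma> s)) \<longleftrightarrow>
    A' s * B s = A s * B' s"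
proof
  have pM: "\<gamma> s \<in> M" using \<gamma>_in[OF assms] by auto
  note [simp] = lorentz.add_left lorentz.diff_left lorentz.scaleR_left lorentz.diff_right lorentz_cross_derivs[OF assms]
    lorentz_c1_derivs[OF assms] lorentz_c2_derivs[OF assms] lorentz_c(1,2)[OF assms] lorentz_c(3)[OF assms assms]
  have [simp]: "lorentz (c\<^sub>2 s) (c\<^sub>1 s) = 1" using lorentz_c(3)[OF assms assms] by (simp add: lorentz_commute)
  {
    assume "\<exists>S. is_sphere Q S \<and> contact_order_ge 3 S \<gamma> s \<and> tangent_at Q M S (\<gamma> s)"
    then obtain S where S: "is_sphere Q S" "contact_order_ge 3 S \<gamma> s" "tangent_at Q M S (\<gamma> s)"
      by blast
    define S' where "S' = reduced_sphere Q S"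
    have S': "sphere_fun S' (\<gamma> s) = 0" "sphere_grad S' (\<gamma> s) \<noteq> 0"
        "conormal Q M (\<gamma> s) (sphere_grad S' (\<gamma> s))"
      using tangent_sphere_iff[OF pM orthogonal_reduced_sphere, of S] S is_sphere_reduced
        tangent_at_reduced by (auto simp: S'_def)
    define \<nu> where "\<nu> = sphere_grad (c\<^sub>1 s) (\<gamma> s)"
    have \<nu>: "\<nu> \<bullet> \<nu> = 1" "conormal Q M (\<gamma> s) \<nu>"
      using lorentz_grad_zero[OF sphere_fun_c(1) sphere_fun_c(1)] conormal_T[OF \<gamma>_in] assms
      by (auto simp: \<nu>_def lorentz_c simp flip: c\<^sub>1_def)
    then have "\<nu> \<noteq> 0" by auto
    define \<mu> where "\<mu> = sphere_grad S' (\<gamma> s) \<bullet> \<nu>"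
    have \<mu>: "sphere_grad S' (\<gamma> s) = \<mu> *\<^sub>R \<nu>"
      using conormal_unique[OF pM \<nu>(2) S'(3) \<open>\<nu> \<noteq> 0\<close>] \<nu>(1) by (simp add: \<mu>_def)
    then have "\<mu> \<noteq> 0" using S'(2) by auto
    \<comment> \<open>After subtraction of \<open>\<mu> *\<^sub>R c\<^sub>1 s\<close> value and
      gradient vanish at \<open>\<gamma> s\<close>. What remains is a multiple of the point sphere,
      and \<open>\<rho>\<close> is its coefficient when it is written in terms of
      \<open>c\<^sub>1 s - c\<^sub>2 s\<close>.\<close>
    define \<rho> where "\<rho> = fst (S' - \<mu> *\<^sub>R c\<^sub>1 s) / \<phi> s"
    have "S' - \<mu> *\<^sub>R c\<^sub>1 s = fst (S' - \<mu> *\<^sub>R c\<^sub>1 s) *\<^sub>R point_sphere (\<gamma> s)"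
      by (rule point_sphereI) (simp_all add: S'(1) sphere_fun_c(1)[OF assms] \<mu> \<nu>_def)
    also have "\<dots> = \<rho> *\<^sub>R (c\<^sub>1 s - c\<^sub>2 s)"
      using \<phi>_nonzero[OF assms] by (simp add: c_diff[OF assms] \<rho>_def)
    finally have S'': "S' = (\<mu> + \<rho>) *\<^sub>R c\<^sub>1 s + (- \<rho>) *\<^sub>R c\<^sub>2 s"
      by (simp add: algebra_simps)
    have "lorentz S' (p2 s - q2 s) = 0" "lorentz S' (p3 s - q3 s) = 0"
      using S(2) contact_iff[OF assms, of S] by (auto simp: S'_def Let_def)
    moreover have "lorentz S' (p2 s - q2 s) = - ((\<mu> + \<rho>) * A s) - \<rho> * B s"
      unfolding S'' by (simp add: A_def B_def)
    moreover have "lorentz S' (p3 s - q3 s) = - (3 / 2) * ((\<mu> + \<rho>) * A' s + \<rho> * B' s)"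
      unfolding S'' by (simp add: A'_def B'_def) (simp add: field_simps)
    ultimately have "(\<mu> + \<rho>) * A s = - \<rho> * B s" "(\<mu> + \<rho>) * A' s = - \<rho> * B' s"
      by simp_all
    \<comment> \<open>Cramer's rule: each coefficient is annihilated by the determinant. The
      coefficients \<open>\<mu> + \<rho>\<close> and \<open>\<rho>\<close> are not both zero since
      \<open>\<mu>\<close> is not.\<close>
    then have "(\<mu> + \<rho>) * (A' s * B s - A s * B' s) = 0" "\<rho> * (A' s * B s - A s * B' s) = 0"
      by algebra+
    then show "A' s * B s = A s * B' s" using \<open>\<mu> \<noteq> 0\<close> by auto
  }
  assume w: "A' s * B s = A s * B' s"
  \<comment> \<open>These coefficients cancel the second-order term identically; \<open>w\<close> is
    the third-order condition, and \<open>A s + B s > 0\<close> keeps the gradient nonzero.\<close>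
  define S where "S = B s *\<^sub>R c\<^sub>1 s + A s *\<^sub>R c\<^sub>2 s"
  have orth: "orthogonal_to_space Q S"
    unfolding S_def c\<^sub>1_def c\<^sub>2_def
    by (intro orthogonal_to_space_add orthogonal_to_space_scaleR orthogonal_T)
  then have red: "reduced_sphere Q S = S"
    by (auto simp: orthogonal_to_space_def reduced_sphere_def prod_eq_iff)
  have "contact_order_ge 3 S \<gamma> s"
    unfolding contact_iff[OF assms] Let_def red
    using w by (simp add: S_def) (simp add: A_def B_def A'_def B'_def algebra_simps)
  moreover have g: "sphere_grad S (\<gamma> s) = (A s + B s) *\<^sub>R sphere_grad (c\<^sub>1 s) (\<gamma> s)"
    using sphere_grad_c[OF assms] by (simp add: S_def algebra_simps)
  have "sphere_grad (c\<^sub>1 s) (\<gamma> s) \<noteq> 0"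
    using lorentz_grad_zero[OF sphere_fun_c(1)[OF assms] sphere_fun_c(1)[OF assms]]
      lorentz_c(1)[OF assms] by auto
  then have "is_sphere Q S \<and> tangent_at Q M S (\<gamma> s)"
    unfolding tangent_sphere_iff[OF pM orth] g
    using A_plus_B_pos[OF assms] conormal_T[OF \<gamma>_in[OF assms]] sphere_fun_c[OF assms]
    by (simp add: S_def conormal_scaleR c\<^sub>1_def)
  ultimately show "\<exists>S. is_sphere Q S \<and> contact_order_ge 3 S \<gamma> s \<and> tangent_at Q M S (\<gamma> s)"
    by blast
qed

end

subsection \<open>The angle with the principal directions\<close>

context cyclide_curve_derivs
begin

text \<open>Taking the product of the relation between the gradients and the velocity with
  \<open>e\<close> leaves only the gradient of \<open>p1 s\<close>, whose squared length is
  \<open>A s\<close>.\<close>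

lemma squared_angle_grad_p1:
  assumes s: "s \<in> J"
    and par: "sphere_grad (p1 s) (\<gamma> s) = y *\<^sub>R e" "sphere_grad (q1 s) (\<gamma> s) \<bullet> e = 0"
  shows "(\<gamma>' s \<bullet> e)\<^sup>2 * (A s + B s) = A s * (e \<bullet> e)"
proof -
  have "(- 2 * \<phi> s) * (\<gamma>' s \<bullet> e) = y * (e \<bullet> e)"
    using arg_cong[OF grad_derivs(1)[OF s], of "\<lambda>v. v \<bullet> e"] par by (simp add: inner_simps)
  then have "((- 2 * \<phi> s) * (\<gamma>' s \<bullet> e))\<^sup>2 = y\<^sup>2 * (e \<bullet> e) * (e \<bullet> e)"
    by (simp add: power2_eq_square)
  moreover have "A s = y\<^sup>2 * (e \<bullet> e)"
    using grad_derivs(3)[OF s] par by (simp add: power2_eq_square)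
  ultimately show ?thesis using A_plus_B[OF s] by (simp add: power_mult_distrib mult.commute)
qed

lemma squared_angle_grad_q1:
  assumes s: "s \<in> J"
    and par: "sphere_grad (q1 s) (\<gamma> s) = y *\<^sub>R e" "sphere_grad (p1 s) (\<gamma> s) \<bullet> e = 0"
  shows "(\<gamma>' s \<bullet> e)\<^sup>2 * (A s + B s) = B s * (e \<bullet> e)"
proof -
  have "(2 * \<phi> s) * (\<gamma>' s \<bullet> e) = y * (e \<bullet> e)"
    using arg_cong[OF grad_derivs(1)[OF s], of "\<lambda>v. v \<bullet> e"] par by (simp add: inner_simps)
  then have "((2 * \<phi> s) * (\<gamma>' s \<bullet> e))\<^sup>2 = y\<^sup>2 * (e \<bullet> e) * (e \<bullet> e)"
    by (simp add: power2_eq_square)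
  moreover have "B s = y\<^sup>2 * (e \<bullet> e)"
    using grad_derivs(4)[OF s] par by (simp add: power2_eq_square)
  ultimately show ?thesis using A_plus_B[OF s] by (simp add: power_mult_distrib mult.commute)
qed

text \<open>Move from \<open>\<gamma> s\<close> along a curve in \<open>M\<close> with velocity
  \<open>e\<close>. Since the derivative of the unit normal is a multiple of \<open>e\<close>, so
  are the gradients of the velocities \<open>X1\<close>, \<open>X2\<close> of the two spheres. These
  gradients are also orthogonal, so one of them vanishes, and \<open>e\<close> is tangent to a
  coordinate line. Which one it is depends on \<open>e\<close>, whence the disjunction.\<close>

lemma principal_direction_squared_angle:
  assumes s: "s \<in> J" and e: "principal_direction Q M (\<gamma> s) e"
  shows "(\<gamma>' s \<bullet> e)\<^sup>2 * (A s + B s) = A s * (e \<bullet> e) \<or>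
    (\<gamma>' s \<bullet> e)\<^sup>2 * (A s + B s) = B s * (e \<bullet> e)"
proof -
  have pM: "\<gamma> s \<in> M" and pV: "\<gamma> s \<in> V" using \<gamma>_in[OF s] by auto
  from e[unfolded principal_direction_def] obtain N V' k where
    e0: "e \<in> tangent_space M (\<gamma> s)" "e \<noteq> 0" and V': "open V'" "\<gamma> s \<in> V'"
    and N: "smooth_on V' N" "\<forall>q\<in>M \<inter> V'. unit_normal Q M q (N q)"
      "frechet_derivative N (at (\<gamma> s)) e = - (k *\<^sub>R e)"
    by (elim conjE exE) (rule that)
  obtain c W where W: "open W" "(0::real) \<in> W" and c: "c 0 = \<gamma> s" "(c has_vector_derivative e) (at 0)"
    and cW: "\<forall>t\<in>W. c t \<in> M \<inter> (V \<inter> V')"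
    by (rule tangent_space_localE[OF e0(1) open_Int[OF open_V V'(1)] IntI[OF pV V'(2)]]) (rule that)
  \<comment> \<open>The vector of which both \<open>p1 s\<close>, produced by
    \<open>\<gamma>\<close>, and \<open>X1\<close>, produced by the curve in direction
    \<open>e\<close>, are multiples; \<open>w2\<close> plays this role for the second
    family.\<close>
  define w1 where "w1 = frechet_derivative T\<^sub>1 (at (\<tau>\<^sub>1 (\<gamma> s))) 1"
  define w2 where "w2 = frechet_derivative T\<^sub>2 (at (\<tau>\<^sub>2 (\<gamma> s))) 1"
  define X1 where "X1 = frechet_derivative \<tau>\<^sub>1 (at (\<gamma> s)) e *\<^sub>R w1"
  define X2 where "X2 = frechet_derivative \<tau>\<^sub>2 (at (\<gamma> s)) e *\<^sub>R w2"
  define t1 where "t1 r = T\<^sub>1 (\<tau>\<^sub>1 (c r))" for r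
  define t2 where "t2 r = T\<^sub>2 (\<tau>\<^sub>2 (c r))" for r
  have \<tau>I: "\<tau>\<^sub>1 (\<gamma> s) \<in> I\<^sub>1" "\<tau>\<^sub>2 (\<gamma> s) \<in> I\<^sub>2" using \<tau>_in[OF \<gamma>_in[OF s]] by auto
  have dt: "(t1 has_vector_derivative X1) (at 0)" "(t2 has_vector_derivative X2) (at 0)"
    unfolding t1_def[abs_def] t2_def[abs_def]
    using has_vector_derivative_compose_smooth2[OF smooth_\<tau>(1) open_V _ smooth_T(1) open_I(1) _ c(2)]
      has_vector_derivative_compose_smooth2[OF smooth_\<tau>(2) open_V _ smooth_T(2) open_I(2) _ c(2)]
      c(1) pV \<tau>I by (simp_all add: X1_def X2_def w1_def w2_def)
  have dc: "p1 s = frechet_derivative \<tau>\<^sub>1 (at (\<gamma> s)) (\<gamma>' s) *\<^sub>R w1"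
    "q1 s = frechet_derivative \<tau>\<^sub>2 (at (\<gamma> s)) (\<gamma>' s) *\<^sub>R w2"
    using vector_derivative_unique_at[OF p(1)[OF s, unfolded c\<^sub>1_def[abs_def]]
        has_vector_derivative_compose_smooth2[OF smooth_\<tau>(1) open_V pV smooth_T(1) open_I(1) \<tau>I(1) \<gamma>'[OF s]]]
      vector_derivative_unique_at[OF q(1)[OF s, unfolded c\<^sub>2_def[abs_def]]
        has_vector_derivative_compose_smooth2[OF smooth_\<tau>(2) open_V pV smooth_T(2) open_I(2) \<tau>I(2) \<gamma>'[OF s]]]
    by (simp_all add: w1_def w2_def)
  have t0: "t1 0 = c\<^sub>1 s" "t2 0 = c\<^sub>2 s" by (simp_all add: t1_def t2_def c(1) c\<^sub>1_def c\<^sub>2_def)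
  have cMV: "c r \<in> M \<inter> V" if "r \<in> W" for r using cW that by auto

  have left: "lorentz X1 S = 0" if "\<And>r. r \<in> W \<Longrightarrow> lorentz (t1 r) S = 1" for S
    by (rule has_vector_derivative_constant_on_open[OF W that
          bounded_linear.has_vector_derivative[OF lorentz.bounded_linear_left dt(1)]])
  have left2: "lorentz X2 S = 0" if "\<And>r. r \<in> W \<Longrightarrow> lorentz (t2 r) S = 1" for S
    by (rule has_vector_derivative_constant_on_open[OF W that
          bounded_linear.has_vector_derivative[OF lorentz.bounded_linear_left dt(2)]])
  have X1c2: "lorentz X1 (c\<^sub>2 t) = 0" if "t \<in> J" for t
    by (rule left) (simp add: t1_def c\<^sub>2_def lorentz_T[OF cMV \<gamma>_in[OF that]])
  have X2c1: "lorentz X2 (c\<^sub>1 t) = 0" if "t \<in> J" for t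
    by (rule left2) (simp add: t2_def c\<^sub>1_def lorentz_T[OF \<gamma>_in[OF that] cMV] lorentz_commute[of "T\<^sub>2 _"])
  have X1t2: "lorentz X1 (t2 r) = 0" if "r \<in> W" for r
    by (rule left) (simp add: t1_def t2_def lorentz_T[OF cMV cMV[OF that]])
  have X1X2: "lorentz X1 X2 = 0"
    using has_vector_derivative_constant_on_open[OF W X1t2
        bounded_linear.has_vector_derivative[OF lorentz.bounded_linear_right dt(2)]] by simp
  have X1c1: "lorentz X1 (c\<^sub>1 s) = 0"
    using has_vector_derivative_constant_on_open[OF W _ lorentz.has_vector_derivative[OF dt(1) dt(1)], of 1]
      unit_T(1)[OF \<tau>_in(1)[OF cMV]] t0 by (simp add: lorentz_commute t1_def)
  have X2c2: "lorentz X2 (c\<^sub>2 s) = 0"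
    using has_vector_derivative_constant_on_open[OF W _ lorentz.has_vector_derivative[OF dt(2) dt(2)], of 1]
      unit_T(2)[OF \<tau>_in(2)[OF cMV]] t0 by (simp add: lorentz_commute t2_def)
  have z: "sphere_fun X1 (\<gamma> s) = 0" "sphere_fun X2 (\<gamma> s) = 0"
    using sphere_fun_zeroI[OF s] X1c2[OF s] X2c1[OF s] X1c1 X2c2 by auto
  have perp: "sphere_grad X1 (\<gamma> s) \<bullet> sphere_grad X2 (\<gamma> s) = 0"
    "sphere_grad X1 (\<gamma> s) \<bullet> sphere_grad (q1 s) (\<gamma> s) = 0"
    "sphere_grad X2 (\<gamma> s) \<bullet> sphere_grad (p1 s) (\<gamma> s) = 0"
    using lorentz_grad_zero[OF z] lorentz_grad_zero[OF z(1) sphere_fun_derivs(2)[OF s]]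
      lorentz_grad_zero[OF z(2) sphere_fun_derivs(1)[OF s]] X1X2
      lorentz_c2_const_derivs(1)[OF s X1c2] lorentz_c1_const_derivs(1)[OF s X2c1] by simp_all

  define \<nu> where "\<nu> r = sphere_grad (t1 r) (c r)" for r
  define n where "n r = N (c r)" for r
  define \<nu>' where "\<nu>' = sphere_grad X1 (\<gamma> s) + (2 * fst (c\<^sub>1 s)) *\<^sub>R e"
  have d\<nu>: "(\<nu> has_vector_derivative \<nu>') (at 0)"
    using has_vector_derivative_sphere_grad[OF dt(1) c(2)]
    by (simp add: \<nu>_def[abs_def] \<nu>'_def c(1) t0)
  have dn: "(n has_vector_derivative - (k *\<^sub>R e)) (at 0)"
    using has_vector_derivative_compose_smooth[OF N(1) V'(1) _ c(2)] V'(2) N(3)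
    by (simp add: c(1) n_def[abs_def])
  have \<nu>: "\<nu> r \<bullet> \<nu> r = 1" "conormal Q M (c r) (\<nu> r)" if "r \<in> W" for r
    using lorentz_grad_zero[OF zero_T(1)[OF cMV[OF that]] zero_T(1)[OF cMV[OF that]]]
      unit_T(1)[OF \<tau>_in(1)[OF cMV[OF that]]] conormal_T[OF cMV[OF that]]
    by (simp_all add: \<nu>_def t1_def)
  have n: "n r \<bullet> n r = 1" "conormal Q M (c r) (n r)" if "r \<in> W" for r
  proof -
    have "unit_normal Q M (c r) (n r)" using N(2) cW that by (auto simp: n_def)
    then show "n r \<bullet> n r = 1" "conormal Q M (c r) (n r)"
      using tangent_space_Q by (auto simp: unit_normal_def conormal_def norm_eq_1)
  qed
  \<comment> \<open>The normal field of the principal direction and the normal of the spheres agree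
    up to a sign, which is written as their inner product so that it can be differentiated.\<close>
  have eq: "n r = (\<nu> r \<bullet> n r) *\<^sub>R \<nu> r" and pm: "\<nu> r \<bullet> n r = 1 \<or> \<nu> r \<bullet> n r = -1" if "r \<in> W" for r
    using unit_conormal_cases[OF _ \<nu>(2)[OF that] n(2)[OF that] \<nu>(1)[OF that] n(1)[OF that]]
      cMV[OF that] by auto
  \<comment> \<open>The derivative of that sign. It is shown to vanish by projection to
    \<open>\<nu> 0\<close>, to which both \<open>e\<close> and \<open>\<nu>'\<close> are
    orthogonal.\<close>
  define l' where "l' = \<nu> 0 \<bullet> (- (k *\<^sub>R e)) + \<nu>' \<bullet> n 0"
  have "((\<lambda>r. (\<nu> r \<bullet> n r) *\<^sub>R \<nu> r) has_vector_derivative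
      (\<nu> 0 \<bullet> n 0) *\<^sub>R \<nu>' + l' *\<^sub>R \<nu> 0) (at 0)"
    unfolding l'_def
    by (rule bounded_bilinear.has_vector_derivative[OF bounded_bilinear_scaleR
          bounded_bilinear.has_vector_derivative[OF bounded_bilinear_inner d\<nu> dn] d\<nu>])
  moreover have "((\<lambda>r. (\<nu> r \<bullet> n r) *\<^sub>R \<nu> r) has_vector_derivative - (k *\<^sub>R e)) (at 0)"
    by (rule has_vector_derivative_transform_within_open[OF dn W eq])
  ultimately have ke: "- (k *\<^sub>R e) = (\<nu> 0 \<bullet> n 0) *\<^sub>R \<nu>' + l' *\<^sub>R \<nu> 0"
    by (rule vector_derivative_unique_at[rotated])
  have "\<nu> 0 \<bullet> \<nu>' + \<nu>' \<bullet> \<nu> 0 = 0"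
    by (rule has_vector_derivative_constant_on_open[OF W \<nu>(1)
          bounded_bilinear.has_vector_derivative[OF bounded_bilinear_inner d\<nu> d\<nu>]])
  then have "\<nu>' \<bullet> \<nu> 0 = 0" by (simp add: inner_commute)
  moreover have "e \<bullet> \<nu> 0 = 0"
    using \<nu>(2)[OF W(2)] e0(1) c(1) by (simp add: conormal_def inner_commute)
  ultimately have "l' = 0"
    using arg_cong[OF ke, of "\<lambda>v. v \<bullet> \<nu> 0"] \<nu>(1)[OF W(2)] by (simp add: inner_simps)
  then have "(\<nu> 0 \<bullet> n 0) *\<^sub>R \<nu>' = - (k *\<^sub>R e)" using ke by simp
  moreover have "\<nu>' = (\<nu> 0 \<bullet> n 0) *\<^sub>R ((\<nu> 0 \<bullet> n 0) *\<^sub>R \<nu>')" using pm[OF W(2)] by auto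
  ultimately have "\<nu>' = (- (\<nu> 0 \<bullet> n 0) * k) *\<^sub>R e" by simp
  then obtain m where m: "\<nu>' = m *\<^sub>R e" by blast

  have u1: "sphere_grad X1 (\<gamma> s) = (m - 2 * fst (c\<^sub>1 s)) *\<^sub>R e"
    using m by (simp add: \<nu>'_def algebra_simps)
  have "sphere_grad X1 (\<gamma> s) - sphere_grad X2 (\<gamma> s) = (- 2 * \<phi> s) *\<^sub>R e"
    using sphere_pencil_derivative[OF W _ dt c(2)] grad_eq[OF cMV]
    by (simp add: t1_def t2_def c(1) \<phi>_def c\<^sub>1_def c\<^sub>2_def)
  then have u2: "sphere_grad X2 (\<gamma> s) = (m - 2 * fst (c\<^sub>2 s)) *\<^sub>R e"
    using u1 by (simp add: \<phi>_def algebra_simps)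
  \<comment> \<open>Both gradients are multiples of the nonzero vector \<open>e\<close>, so their
    orthogonality says that one coefficient is zero.\<close>
  from perp(1) e0(2) have "m = 2 * fst (c\<^sub>1 s) \<or> m = 2 * fst (c\<^sub>2 s)"
    by (auto simp: u1 u2)
  then show ?thesis
  proof
    assume "m = 2 * fst (c\<^sub>2 s)"
    then have u: "sphere_grad X1 (\<gamma> s) = (- 2 * \<phi> s) *\<^sub>R e" using u1 by (simp add: \<phi>_def algebra_simps)
    then have "frechet_derivative \<tau>\<^sub>1 (at (\<gamma> s)) e \<noteq> 0"
      using e0(2) \<phi>_nonzero[OF s] by (auto simp: X1_def)
    \<comment> \<open>As \<open>\<tau>\<^sub>1\<close> is not stationary along \<open>e\<close>, the
      vector \<open>w1\<close> is a multiple of \<open>X1\<close>, which carries the direction of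
      \<open>X1\<close> over to \<open>p1 s\<close>.\<close>
    then have "p1 s = (frechet_derivative \<tau>\<^sub>1 (at (\<gamma> s)) (\<gamma>' s) / frechet_derivative \<tau>\<^sub>1 (at (\<gamma> s)) e) *\<^sub>R X1"
      by (simp add: dc X1_def)
    then have "\<exists>y. sphere_grad (p1 s) (\<gamma> s) = y *\<^sub>R e"
      using u by (metis scaleR_scaleR sphere_grad_linear(3))
    moreover have "sphere_grad (q1 s) (\<gamma> s) \<bullet> e = 0"
      using perp(2) \<phi>_nonzero[OF s] unfolding u by (simp add: inner_commute)
    ultimately show ?thesis using squared_angle_grad_p1[OF s] by blast
  next
    assume "m = 2 * fst (c\<^sub>1 s)"
    then have u: "sphere_grad X2 (\<gamma> s) = (2 * \<phi> s) *\<^sub>R e" using u2 by (simp add: \<phi>_def algebra_simps)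
    then have "frechet_derivative \<tau>\<^sub>2 (at (\<gamma> s)) e \<noteq> 0"
      using e0(2) \<phi>_nonzero[OF s] by (auto simp: X2_def)
    then have "q1 s = (frechet_derivative \<tau>\<^sub>2 (at (\<gamma> s)) (\<gamma>' s) / frechet_derivative \<tau>\<^sub>2 (at (\<gamma> s)) e) *\<^sub>R X2"
      by (simp add: dc X2_def)
    then have "\<exists>y. sphere_grad (q1 s) (\<gamma> s) = y *\<^sub>R e"
      using u by (metis scaleR_scaleR sphere_grad_linear(3))
    moreover have "sphere_grad (p1 s) (\<gamma> s) \<bullet> e = 0"
      using perp(3) \<phi>_nonzero[OF s] unfolding u by (simp add: inner_commute)
    ultimately show ?thesis using squared_angle_grad_q1[OF s] by blast
  qed
qed

section \<open>The squared cosine as a function along the curve\<close>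

definition "\<kappa> s = A s / (A s + B s)"
text \<open>The quotient rule for \<open>\<kappa>\<close> after cancellation of
  \<open>A s * A' s\<close>; the numerator is the determinant of the contact equations.\<close>

definition "\<kappa>' s = (A' s * B s - A s * B' s) / (A s + B s)\<^sup>2"

lemma DERIV_\<kappa>:
  assumes "s \<in> J"
  shows "(\<kappa> has_real_derivative \<kappa>' s) (at s)"
proof -
  have d: "(A has_real_derivative A' s) (at s)" "(B has_real_derivative B' s) (at s)"
    using lorentz.has_vector_derivative[OF p(2)[OF assms] p(2)[OF assms]]
      lorentz.has_vector_derivative[OF q(2)[OF assms] q(2)[OF assms]]
    by (auto simp: has_real_derivative_iff_has_vector_derivative A_def[abs_def] A'_def
        B_def[abs_def] B'_def lorentz_commute[of "p2 s"] lorentz_commute[of "q2 s"])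
  have "(\<kappa> has_real_derivative (A' s * (A s + B s) - A s * (A' s + B' s)) / ((A s + B s) * (A s + B s))) (at s)"
    unfolding \<kappa>_def[abs_def]
    by (rule DERIV_divide[OF d(1) DERIV_add[OF d]]) (use A_plus_B_pos[OF assms] in auto)
  then show ?thesis by (simp add: \<kappa>'_def power2_eq_square algebra_simps)
qed

lemma darboux_iff_\<kappa>':
  assumes "s \<in> J"
  shows "(\<exists>S. is_sphere Q S \<and> contact_order_ge 3 S \<gamma> s \<and> tangent_at Q M S (\<gamma> s)) \<longleftrightarrow> \<kappa>' s = 0"
  unfolding darboux_iff[OF assms] using A_plus_B_pos[OF assms] by (simp add: \<kappa>'_def)

lemma principal_direction_\<kappa>:
  assumes "s \<in> J" "principal_direction Q M (\<gamma> s) e"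
  shows "(\<gamma>' s \<bullet> e)\<^sup>2 = \<kappa> s * (e \<bullet> e) \<or> (\<gamma>' s \<bullet> e)\<^sup>2 = (1 - \<kappa> s) * (e \<bullet> e)"
proof -
  have AB: "A s + B s \<noteq> 0" using A_plus_B_pos[OF assms(1)] by simp
  then have "1 - \<kappa> s = B s / (A s + B s)" by (simp add: \<kappa>_def field_simps)
  then show ?thesis
    using principal_direction_squared_angle[OF assms] AB by (auto simp: \<kappa>_def field_simps)
qed

end

context surface_in_space
begin

text \<open>The interface between the Lorentz model and the study of foliations: charts and
  derivatives of spheres are hidden, and a local function remains that detects both the contact
  spheres and the angle with principal directions.\<close>

lemma ex_local_angle_function:
  assumes "dupin_cyclide Q M" "unit_speed_curve M J \<gamma>" "s\<^sub>0 \<in> J"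
  obtains W \<kappa> \<kappa>' where "open W" "s\<^sub>0 \<in> W" "W \<subseteq> J"
    "\<forall>s\<in>W. (\<kappa> has_real_derivative \<kappa>' s) (at s)"
    "\<forall>s\<in>W. (\<exists>S. is_sphere Q S \<and> contact_order_ge 3 S \<gamma> s \<and> tangent_at Q M S (\<gamma> s)) \<longleftrightarrow> \<kappa>' s = 0"
    "\<forall>s\<in>W. \<forall>e. principal_direction Q M (\<gamma> s) e \<longrightarrow>
      (vector_derivative \<gamma> (at s) \<bullet> e)\<^sup>2 = \<kappa> s * (e \<bullet> e) \<or>
      (vector_derivative \<gamma> (at s) \<bullet> e)\<^sup>2 = (1 - \<kappa> s) * (e \<bullet> e)"
proof -
  have J: "open J" "\<gamma> ` J \<subseteq> M" "Ck_on 3 J \<gamma>" "\<forall>s\<in>J. norm (vector_derivative \<gamma> (at s)) = 1"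
    using assms(2) by (auto simp: unit_speed_curve_def)
  have dJ: "(\<gamma> has_vector_derivative vector_derivative \<gamma> (at s)) (at s)" if "s \<in> J" for s
    by (rule Ck_on_3D[OF J(1,3)]) (use that vector_derivative_at in metis)
  have "\<gamma> s\<^sub>0 \<in> M" using J(2) assms(3) by auto
  from ex_cyclide_chart[OF assms(1) this] obtain V \<tau>\<^sub>1 \<tau>\<^sub>2 I\<^sub>1 I\<^sub>2 T\<^sub>1 T\<^sub>2
    where V: "\<gamma> s\<^sub>0 \<in> V" and chart: "cyclide_chart Q M V \<tau>\<^sub>1 \<tau>\<^sub>2 I\<^sub>1 I\<^sub>2 T\<^sub>1 T\<^sub>2" .
  interpret ch: cyclide_chart Q M V \<tau>\<^sub>1 \<tau>\<^sub>2 I\<^sub>1 I\<^sub>2 T\<^sub>1 T\<^sub>2 by (rule chart)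
  define W where "W = J \<inter> \<gamma> -` V"
  have "continuous_on J \<gamma>"
    using dJ has_vector_derivative_continuous continuous_at_imp_continuous_on by blast
  then have W: "open W" "s\<^sub>0 \<in> W" "W \<subseteq> J"
    using continuous_open_preimage[OF _ J(1) ch.open_V] assms(3) V by (auto simp: W_def)
  interpret cv: cyclide_curve Q M V \<tau>\<^sub>1 \<tau>\<^sub>2 I\<^sub>1 I\<^sub>2 T\<^sub>1 T\<^sub>2 W \<gamma> "\<lambda>s. vector_derivative \<gamma> (at s)"
    by unfold_locales (use W J dJ Ck_on_subset[OF J(3)] in \<open>auto simp: W_def\<close>)
  obtain p1 p2 p3 where p: "\<And>s. s \<in> W \<Longrightarrow> (cv.c\<^sub>1 has_vector_derivative p1 s) (at s)"
    "\<And>s. s \<in> W \<Longrightarrow> (p1 has_vector_derivative p2 s) (at s)"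
    "\<And>s. s \<in> W \<Longrightarrow> (p2 has_vector_derivative p3 s) (at s)"
    by (rule Ck_on_3D[OF W(1) cv.C3_c(1)]) (rule that)
  obtain q1 q2 q3 where q: "\<And>s. s \<in> W \<Longrightarrow> (cv.c\<^sub>2 has_vector_derivative q1 s) (at s)"
    "\<And>s. s \<in> W \<Longrightarrow> (q1 has_vector_derivative q2 s) (at s)"
    "\<And>s. s \<in> W \<Longrightarrow> (q2 has_vector_derivative q3 s) (at s)"
    by (rule Ck_on_3D[OF W(1) cv.C3_c(2)]) (rule that)
  interpret d: cyclide_curve_derivs Q M V \<tau>\<^sub>1 \<tau>\<^sub>2 I\<^sub>1 I\<^sub>2 T\<^sub>1 T\<^sub>2 W \<gamma> "\<lambda>s. vector_derivative \<gamma> (at s)"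
    p1 p2 p3 q1 q2 q3
    by unfold_locales (use p q in auto)
  show thesis
    using that[OF W, of d.\<kappa> d.\<kappa>'] d.DERIV_\<kappa> d.darboux_iff_\<kappa>' d.principal_direction_\<kappa> by blast
qed

end

subsection \<open>Leaves\<close>

lemma integral_curve_subset_cong:
  assumes "integral_curve M F J' \<gamma>'" "open J" "is_interval J" "J \<noteq> {}" "J \<subseteq> J'"
    and eq: "\<forall>s\<in>J. \<gamma> s = \<gamma>' s"
  shows "integral_curve M F J \<gamma>"
proof -
  have vd: "vector_derivative \<gamma> (at s) = vector_derivative \<gamma>' (at s)" if "s \<in> J" for s
  proof (rule vector_derivative_cong_eq)
    show "\<forall>\<^sub>F x in nhds s. x \<in> UNIV \<longrightarrow> \<gamma> x = \<gamma>' x"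
      using eventually_nhds_in_open[OF assms(2) that] by eventually_elim (use eq in auto)
  qed auto
  have "Ck_on 3 J' \<gamma>'" using assms(1) by (simp add: integral_curve_def unit_speed_curve_def)
  then have "Ck_on 3 J \<gamma>'" using assms(5) Ck_on_subset by blast
  then have "Ck_on 3 J \<gamma>" using Ck_on_cong[OF assms(2), of \<gamma>' \<gamma>] eq by simp
  then show ?thesis
    using assms vd unfolding integral_curve_def unit_speed_curve_def
    by (auto simp: image_subset_iff subset_iff)
qed

text \<open>The common parameter \<open>s\<^sub>0\<close> makes the union of the intervals
  connected, hence an interval; the remaining conditions are local.\<close>

lemma integral_curve_UN:
  assumes int: "\<And>i. i \<in> I \<Longrightarrow> integral_curve M F (J i) (g i)"
    and agree: "\<And>i. i \<in> I \<Longrightarrow> \<forall>s\<in>J i. \<gamma> s = g i s"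
    and s\<^sub>0: "\<And>i. i \<in> I \<Longrightarrow> s\<^sub>0 \<in> J i" and "I \<noteq> {}"
  shows "integral_curve M F (\<Union>i\<in>I. J i) \<gamma>"
proof -
  have J: "open (J i)" "is_interval (J i)" "J i \<noteq> {}" if "i \<in> I" for i
    using int[OF that] by (auto simp: integral_curve_def unit_speed_curve_def)
  have cur: "integral_curve M F (J i) \<gamma>" if "i \<in> I" for i
    by (rule integral_curve_subset_cong[OF int[OF that] J[OF that] order_refl agree[OF that]])
  have "connected (\<Union>i\<in>I. J i)"
  proof (rule connected_Union)
    have "s\<^sub>0 \<in> (\<Inter>i\<in>I. J i)" using s\<^sub>0 by auto
    then show "(\<Inter>i\<in>I. J i) \<noteq> {}" by blast
  qed (use J(2) in \<open>auto simp: is_interval_connected_1\<close>)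
  then have "is_interval (\<Union>i\<in>I. J i)" by (simp add: is_interval_connected_1)
  moreover have "Ck_on 3 (\<Union>i\<in>I. J i) \<gamma>"
    using cur J(1) by (intro Ck_on_UN) (auto simp: integral_curve_def unit_speed_curve_def)
  moreover have "open (\<Union>i\<in>I. J i)" "(\<Union>i\<in>I. J i) \<noteq> {}" using J(1) s\<^sub>0 assms(4) by auto
  moreover have "\<gamma> s \<in> M \<and> norm (vector_derivative \<gamma> (at s)) = 1 \<and> vector_derivative \<gamma> (at s) \<in> F (\<gamma> s)"
    if "s \<in> (\<Union>i\<in>I. J i)" for s
  proof -
    obtain i where "i \<in> I" "s \<in> J i" using \<open>s \<in> (\<Union>i\<in>I. J i)\<close> by blast
    then show ?thesis
      using cur[of i] by (simp add: integral_curve_def unit_speed_curve_def image_subset_iff)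
  qed
  ultimately show ?thesis
    by (simp add: integral_curve_def unit_speed_curve_def image_subset_iff)
qed

text \<open>Zorn's lemma for graphs ordered by inclusion: inclusion of graphs encodes at once the
  inclusion of the intervals and the agreement of the curves on the smaller one.\<close>

lemma integral_curve_extends_to_leaf:
  assumes "integral_curve M F J \<gamma>"
  obtains J' \<gamma>' where "leaf M F J' \<gamma>'" "J \<subseteq> J'" "\<forall>s\<in>J. \<gamma> s = \<gamma>' s"
proof -
  define graph where "graph J \<gamma> = (\<lambda>s. (s, \<gamma> s)) ` J" for J :: "real set" and \<gamma> :: "real \<Rightarrow> 'a"
  define \<A> where "\<A> = {graph J' \<gamma>' | J' \<gamma>'. integral_curve M F J' \<gamma>' \<and> J \<subseteq> J' \<and> (\<forall>s\<in>J. \<gamma> s = \<gamma>' s)}"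
  have graph_subset: "J1 \<subseteq> J2 \<and> (\<forall>s\<in>J1. g1 s = g2 s)" if "graph J1 g1 \<subseteq> graph J2 g2" for J1 J2 g1 g2
    using that by (auto simp: graph_def)
  obtain s\<^sub>0 where s\<^sub>0: "s\<^sub>0 \<in> J" using assms by (auto simp: integral_curve_def unit_speed_curve_def)
  have "\<exists>X\<in>\<A>. \<forall>Y\<in>\<A>. X \<subseteq> Y \<longrightarrow> Y = X"
  proof (rule subset_Zorn_nonempty)
    show "\<A> \<noteq> {}" using assms unfolding \<A>_def by blast
    fix \<C> assume \<C>: "\<C> \<noteq> {}" "subset.chain \<A> \<C>"
    have "\<forall>X\<in>\<C>. \<exists>J' \<gamma>'. X = graph J' \<gamma>' \<and> integral_curve M F J' \<gamma>' \<and> J \<subseteq> J' \<and> (\<forall>s\<in>J. \<gamma> s = \<gamma>' s)"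
      using \<C>(2) unfolding subset.chain_def \<A>_def by blast
    then obtain Jf gf where X: "\<And>X. X \<in> \<C> \<Longrightarrow> X = graph (Jf X) (gf X)"
      "\<And>X. X \<in> \<C> \<Longrightarrow> integral_curve M F (Jf X) (gf X)"
      "\<And>X. X \<in> \<C> \<Longrightarrow> J \<subseteq> Jf X" "\<And>X. X \<in> \<C> \<Longrightarrow> \<forall>s\<in>J. \<gamma> s = gf X s"
      by metis
    have agree: "gf X s = gf Y s" if "X \<in> \<C>" "Y \<in> \<C>" "s \<in> Jf X" "s \<in> Jf Y" for X Y s
    proof -
      have "X \<subseteq> Y \<or> Y \<subseteq> X" using \<C>(2) that(1,2) unfolding subset.chain_def by blast
      then show ?thesis
        using X(1)[OF that(1)] X(1)[OF that(2)] graph_subset that(3,4) by metis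
    qed
    \<comment> \<open>Members of a chain agree wherever both are defined, so the choice of a member
      does not affect the value.\<close>
    define g where "g s = gf (SOME X. X \<in> \<C> \<and> s \<in> Jf X) s" for s
    have g: "\<forall>s\<in>Jf X. g s = gf X s" if "X \<in> \<C>" for X
    proof
      fix s assume "s \<in> Jf X"
      with that have "\<exists>X. X \<in> \<C> \<and> s \<in> Jf X" by blast
      from someI_ex[OF this] show "g s = gf X s"
        unfolding g_def using agree[OF _ that _ \<open>s \<in> Jf X\<close>] by blast
    qed
    have int: "integral_curve M F (\<Union>X\<in>\<C>. Jf X) g"
      by (rule integral_curve_UN[OF X(2) g]) (use X(3) s\<^sub>0 \<C>(1) in auto)
    have un: "\<Union>\<C> = graph (\<Union>X\<in>\<C>. Jf X) g"
    proof -
      have "X = graph (Jf X) g" if "X \<in> \<C>" for X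
        using X(1)[OF that] g[OF that] by (auto simp: graph_def image_iff)
      then have "\<Union>\<C> = (\<Union>X\<in>\<C>. graph (Jf X) g)" by auto
      then show ?thesis by (simp add: graph_def image_UN)
    qed
    moreover obtain X\<^sub>0 where "X\<^sub>0 \<in> \<C>" using \<C>(1) by blast
    then have "J \<subseteq> (\<Union>X\<in>\<C>. Jf X)" "\<forall>s\<in>J. \<gamma> s = g s"
      using X(3,4) g[of X\<^sub>0] by (blast, metis subsetD)
    ultimately show "\<Union>\<C> \<in> \<A>" unfolding \<A>_def using int by blast
  qed
  then obtain X where "X \<in> \<A>" and X: "\<And>Y. Y \<in> \<A> \<Longrightarrow> X \<subseteq> Y \<Longrightarrow> Y = X" by auto
  from this(1) obtain J' \<gamma>' where J': "integral_curve M F J' \<gamma>'" "J \<subseteq> J'" "\<forall>s\<in>J. \<gamma> s = \<gamma>' s"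
    and "X = graph J' \<gamma>'" unfolding \<A>_def by auto
  note max = X[unfolded this(4)]
  have "J'' = J'" if "integral_curve M F J'' \<gamma>''" "J' \<subseteq> J''" "\<forall>s\<in>J'. \<gamma>'' s = \<gamma>' s" for J'' \<gamma>''
  proof -
    have "graph J'' \<gamma>'' \<in> \<A>"
      unfolding \<A>_def using that J'(2,3) by (intro CollectI exI[of _ J''] exI[of _ \<gamma>'']) auto
    moreover have "graph J' \<gamma>' \<subseteq> graph J'' \<gamma>''" using that(2,3) by (auto simp: graph_def image_iff)
    ultimately have "graph J'' \<gamma>'' = graph J' \<gamma>'" by (rule max)
    then show ?thesis using graph_subset by blast
  qed
  then have "leaf M F J' \<gamma>'" using J'(1) unfolding leaf_def inextendible_def by blast
  then show thesis using that J' by blast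
qed

lemma leaf_cong:
  assumes "\<And>p. p \<in> M \<Longrightarrow> F p = G p"
  shows "leaf M F = leaf M G"
proof -
  have "integral_curve M F = integral_curve M G"
    using assms by (auto simp: fun_eq_iff integral_curve_def unit_speed_curve_def image_subset_iff)
  then show ?thesis by (simp add: leaf_def)
qed

lemma unit_speed_curve_velocity:
  assumes "unit_speed_curve M J \<gamma>" "s \<in> J"
  shows "(\<gamma> has_vector_derivative vector_derivative \<gamma> (at s)) (at s)"
    and "vector_derivative \<gamma> (at s) \<in> tangent_space M (\<gamma> s)"
    and "continuous_on J (\<lambda>s. vector_derivative \<gamma> (at s))"
proof -
  have J: "open J" "\<gamma> ` J \<subseteq> M" "Ck_on 3 J \<gamma>" using assms(1) by (auto simp: unit_speed_curve_def)
  obtain f1 f2 f3 where f: "\<And>s. s \<in> J \<Longrightarrow> (\<gamma> has_vector_derivative f1 s) (at s)"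
    "\<And>s. s \<in> J \<Longrightarrow> (f1 has_vector_derivative f2 s) (at s)"
    "\<And>s. s \<in> J \<Longrightarrow> (f2 has_vector_derivative f3 s) (at s)"
    by (rule Ck_on_3D[OF J(1,3)]) (rule that)
  have v: "vector_derivative \<gamma> (at s) = f1 s" if "s \<in> J" for s
    using f(1)[OF that] by (rule vector_derivative_at)
  show d: "(\<gamma> has_vector_derivative vector_derivative \<gamma> (at s)) (at s)" using f(1) v assms(2) by simp
  have "continuous_on J f1"
    using f(2) has_vector_derivative_continuous continuous_at_imp_continuous_on by blast
  then show "continuous_on J (\<lambda>s. vector_derivative \<gamma> (at s))"
    using v by (simp cong: continuous_on_cong)
  obtain e where e: "e > 0" "ball s e \<subseteq> J" using J(1) assms(2) open_contains_ball by blast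
  have "((\<lambda>t. \<gamma> (s + t)) has_vector_derivative vector_derivative \<gamma> (at s)) (at 0)"
  proof -
    have "((\<lambda>t::real. s + t) has_vector_derivative 1) (at 0)"
      by (auto intro!: derivative_eq_intros)
    from vector_derivative_diff_chain_within[OF this, of \<gamma> "\<lambda>x. x *\<^sub>R vector_derivative \<gamma> (at s)"] d
    show ?thesis by (simp add: o_def has_vector_derivative_def has_derivative_at_withinI)
  qed
  moreover have "s + t \<in> J" if "t \<in> {-e<..<e}" for t
    using e(2) that by (auto simp: dist_real_def subset_iff)
  ultimately show "vector_derivative \<gamma> (at s) \<in> tangent_space M (\<gamma> s)"
    unfolding tangent_space_def using e(1) J(2)
    by (intro CollectI exI[of _ "\<lambda>t. \<gamma> (s + t)"] exI[of _ e]) auto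
qed

subsection \<open>Darboux curves\<close>

locale foliated_cyclide = surface_in_space Q M for Q M :: "'a::euclidean_space set" +
  fixes P :: "'a \<Rightarrow> 'a set" and R :: "'a \<Rightarrow> 'a \<Rightarrow> 'a"
  assumes dupin: "dupin_cyclide Q M" and principal: "principal_foliation Q M P"
    and orientation: "surface_orientation M R"
begin

section \<open>Line fields at constant angle with a principal foliation\<close>

lemma ex_principal_direction:
  assumes "p \<in> M"
  obtains e where "principal_direction Q M p e" "P p = span {e}" "e \<in> tangent_space M p" "e \<noteq> 0"
  using principal[unfolded principal_foliation_def, rule_format, OF assms] assms that
  unfolding principal_direction_def by blast

lemma rotation:
  assumes "p \<in> M" "v \<in> tangent_space M p"
  shows "linear (R p)" "R p v \<in> tangent_space M p" "R p v \<bullet> R p v = v \<bullet> v" "R p v \<bullet> v = 0" "v \<bullet> R p v = 0"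
  using orientation assms unfolding surface_orientation_def
  by (auto simp: norm_eq inner_commute)

text \<open>Three nonzero mutually orthogonal vectors do not fit into a plane, so no remainder
  \<open>w\<close> is left. Both coefficients have denominator \<open>e \<bullet> e\<close> because
  the rotation preserves length.\<close>

lemma tangent_frame:
  assumes p: "p \<in> M" and e: "e \<in> tangent_space M p" "e \<noteq> 0" and v: "v \<in> tangent_space M p"
  shows "v = ((v \<bullet> e) / (e \<bullet> e)) *\<^sub>R e + ((v \<bullet> R p e) / (e \<bullet> e)) *\<^sub>R R p e"
proof (rule ccontr)
  note rot = rotation[OF p e(1)]
  note sub = subspace_tangent_space[OF p]
  define w where "w = v - (((v \<bullet> e) / (e \<bullet> e)) *\<^sub>R e + ((v \<bullet> R p e) / (e \<bullet> e)) *\<^sub>R R p e)"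
  assume "\<not> ?thesis"
  then have w: "w \<noteq> 0" by (simp add: w_def)
  have wT: "w \<in> tangent_space M p"
    unfolding w_def using v e rot sub by (intro subspace_diff subspace_add subspace_scale)
  have we: "w \<bullet> e = 0" "w \<bullet> R p e = 0"
    using rot e(2) by (simp_all add: w_def inner_simps)
  have Re: "R p e \<noteq> 0" using rot(3) e(2) by auto
  have ne: "e \<noteq> R p e" "w \<noteq> e" "w \<noteq> R p e" using rot(4) we e(2) Re by auto
  have "independent {e, R p e, w}"
    using rot we w e(2) Re
    by (intro pairwise_orthogonal_independent)
      (auto simp: pairwise_insert orthogonal_def inner_commute)
  then have "card {e, R p e, w} \<le> dim (tangent_space M p)"
    using e rot(2) wT by (intro independent_card_le_dim) auto
  then show False using dim_tangent_space[OF p] ne by (simp add: insert_absorb) 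
qed

lemma angle_foliation_iff:
  assumes "p \<in> M" "P p = span {e}"
  shows "v \<in> angle_foliation R P \<alpha> p \<longleftrightarrow> (\<exists>r. v = r *\<^sub>R (cos \<alpha> *\<^sub>R e + sin \<alpha> *\<^sub>R R p e))"
proof -
  have "linear (R p)" using orientation assms(1) by (simp add: surface_orientation_def)
  then show ?thesis
    unfolding angle_foliation_def assms(2) span_singleton
    by (auto simp: linear_cmul algebra_simps image_iff)
qed

text \<open>Lines carry no direction, so the angle only matters modulo \<pi>.\<close>

lemma angle_foliation_sign:
  assumes "p \<in> M" "(cos \<alpha> = cos \<beta> \<and> sin \<alpha> = sin \<beta>) \<or> (cos \<alpha> = - cos \<beta> \<and> sin \<alpha> = - sin \<beta>)"
  shows "angle_foliation R P \<alpha> p = angle_foliation R P \<beta> p"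
proof -
  obtain e where e: "P p = span {e}" using ex_principal_direction[OF assms(1)] by blast
  have "(\<exists>r. v = r *\<^sub>R (cos \<alpha> *\<^sub>R e + sin \<alpha> *\<^sub>R R p e)) \<longleftrightarrow> (\<exists>r. v = r *\<^sub>R (cos \<beta> *\<^sub>R e + sin \<beta> *\<^sub>R R p e))" for v
    using assms(2)
  proof
    assume "cos \<alpha> = - cos \<beta> \<and> sin \<alpha> = - sin \<beta>"
    then have "r *\<^sub>R (cos \<alpha> *\<^sub>R e + sin \<alpha> *\<^sub>R R p e) = (- r) *\<^sub>R (cos \<beta> *\<^sub>R e + sin \<beta> *\<^sub>R R p e)" for r
      by (simp add: algebra_simps)
    then show ?thesis by (metis add.inverse_inverse)
  qed simp
  then show ?thesis using angle_foliation_iff[OF assms(1) e] by auto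
qed

text \<open>A common nonzero vector at one point determines cosine and sine up to a common sign.
  This is a relation between the angles alone and therefore holds at every other point.\<close>

lemma angle_foliation_unique:
  assumes "p \<in> M" "v \<in> angle_foliation R P \<alpha> p" "v \<in> angle_foliation R P \<beta> p" "v \<noteq> 0" "q \<in> M"
  shows "angle_foliation R P \<alpha> q = angle_foliation R P \<beta> q"
proof (rule angle_foliation_sign[OF assms(5)])
  obtain e where e: "P p = span {e}" "e \<in> tangent_space M p" "e \<noteq> 0"
    using ex_principal_direction[OF assms(1)] by blast
  note rot = rotation[OF assms(1) e(2)]
  from assms(2,3)[unfolded angle_foliation_iff[OF assms(1) e(1)]] obtain r r'
    where r: "v = r *\<^sub>R (cos \<alpha> *\<^sub>R e + sin \<alpha> *\<^sub>R R p e)"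
      "v = r' *\<^sub>R (cos \<beta> *\<^sub>R e + sin \<beta> *\<^sub>R R p e)"
    by (elim exE) (rule that)
  have "v \<bullet> e = r * cos \<alpha> * (e \<bullet> e)" "v \<bullet> R p e = r * sin \<alpha> * (e \<bullet> e)"
    unfolding r(1) using rot by (simp_all add: inner_simps)
  moreover have "v \<bullet> e = r' * cos \<beta> * (e \<bullet> e)" "v \<bullet> R p e = r' * sin \<beta> * (e \<bullet> e)"
    unfolding r(2) using rot by (simp_all add: inner_simps)
  ultimately have cs: "r * cos \<alpha> = r' * cos \<beta>" "r * sin \<alpha> = r' * sin \<beta>" using e(3) by auto
  have "r \<noteq> 0" using r assms(4) by auto
  have "r\<^sup>2 = (r * cos \<alpha>)\<^sup>2 + (r * sin \<alpha>)\<^sup>2"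
    by (simp add: power_mult_distrib distrib_left[symmetric])
  also have "\<dots> = r'\<^sup>2"
    unfolding cs by (simp add: power_mult_distrib distrib_left[symmetric])
  finally have "r' = r \<or> r' = - r" by (auto simp: power2_eq_iff)
  then show "(cos \<alpha> = cos \<beta> \<and> sin \<alpha> = sin \<beta>) \<or> (cos \<alpha> = - cos \<beta> \<and> sin \<alpha> = - sin \<beta>)"
  proof
    assume "r' = - r"
    then have "r * cos \<alpha> = r * (- cos \<beta>)" "r * sin \<alpha> = r * (- sin \<beta>)" using cs by simp_all
    then show ?thesis using \<open>r \<noteq> 0\<close> unfolding mult_cancel_left by blast
  qed (use cs \<open>r \<noteq> 0\<close> in simp)
qed

lemma angle_foliation_range:
  obtains \<alpha> where "\<alpha> \<in> {-pi/2<..pi/2}"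
    "\<And>p. p \<in> M \<Longrightarrow> angle_foliation R P \<alpha> p = angle_foliation R P \<beta> p"
proof -
  note result = that
  \<comment> \<open>The sign \<open>\<sigma>\<close> moves \<open>(cos \<beta>, sin \<beta>)\<close>
    to the right half of the unit circle, where \<open>arcsin\<close> returns the angle. On the
    vertical axis only the point \<open>(0, 1)\<close> is allowed, matching the half-open
    interval.\<close>
  have *: thesis if "x = \<sigma> * cos \<beta>" "y = \<sigma> * sin \<beta>" "\<sigma> = 1 \<or> \<sigma> = -1" "x > 0 \<or> (x = 0 \<and> y = 1)" for x y \<sigma>
  proof -
    have xy: "x\<^sup>2 + y\<^sup>2 = 1" using that(1-3) by (auto simp: power_mult_distrib)
    then have y1: "\<bar>y\<bar> \<le> 1" using abs_square_le_1[of y] by (metis le_add_same_cancel2 zero_le_power2)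
    have "sqrt (1 - y\<^sup>2) = x" using xy that(4) by (intro real_sqrt_unique) auto
    then have cs: "cos (arcsin y) = x" "sin (arcsin y) = y"
      using y1 by (auto simp: cos_arcsin)
    have "y \<noteq> -1" using xy that(4) by auto
    then have "arcsin y \<noteq> - (pi / 2)" using cs(2) by (metis sin_minus sin_pi_half)
    moreover have "- (pi / 2) \<le> arcsin y" "arcsin y \<le> pi / 2"
      using arcsin_bounded[of y] y1 by (auto simp: abs_le_iff)
    ultimately have "arcsin y \<in> {-pi/2<..pi/2}" by (auto simp: less_le)
    moreover have "angle_foliation R P (arcsin y) p = angle_foliation R P \<beta> p" if "p \<in> M" for p
      by (rule angle_foliation_sign[OF that])
        (use cs \<open>x = \<sigma> * cos \<beta>\<close> \<open>y = \<sigma> * sin \<beta>\<close> \<open>\<sigma> = 1 \<or> \<sigma> = -1\<close> in auto)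
    ultimately show thesis by (rule result)
  qed
  consider "cos \<beta> > 0" | "cos \<beta> < 0" | "cos \<beta> = 0" "sin \<beta> = 1" | "cos \<beta> = 0" "sin \<beta> = -1"
    using sin_cos_squared_add[of \<beta>] by (cases "cos \<beta> = 0") (auto simp: power2_eq_1_iff, linarith)
  then show thesis
    by cases (use *[of _ 1] *[of _ "-1"] in auto)
qed

section \<open>Constant angle and contact spheres\<close>

lemma constant_if_finite_range:
  fixes f :: "real \<Rightarrow> real"
  assumes "continuous_on (ball s\<^sub>0 \<delta>) f" "finite (f ` ball s\<^sub>0 \<delta>)"
  obtains c where "\<And>s. s \<in> ball s\<^sub>0 \<delta> \<Longrightarrow> f s = c"
  using continuous_finite_range_constant[OF connected_ball assms] unfolding constant_on_def by blast

text \<open>A constant angle leaves two candidates for the value of \<open>\<kappa>\<close> at each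
  point, since the foliation is not matched with a family of spheres. By continuity
  \<open>\<kappa>\<close> stays at one of them, so its derivative is zero.\<close>

lemma integral_curve_imp_darboux:
  assumes int: "integral_curve M (angle_foliation R P \<alpha>) J \<gamma>"
  shows "darboux_curve Q M J \<gamma>"
proof -
  have us: "unit_speed_curve M J \<gamma>" using int by (simp add: integral_curve_def)
  have "\<exists>S. is_sphere Q S \<and> contact_order_ge 3 S \<gamma> s\<^sub>0 \<and> tangent_at Q M S (\<gamma> s\<^sub>0)" if s\<^sub>0: "s\<^sub>0 \<in> J" for s\<^sub>0
  proof -
    obtain W \<kappa> \<kappa>' where W: "open W" "s\<^sub>0 \<in> W" "W \<subseteq> J"
      and d: "\<forall>s\<in>W. (\<kappa> has_real_derivative \<kappa>' s) (at s)"
      and iff: "\<forall>s\<in>W. (\<exists>S. is_sphere Q S \<and> contact_order_ge 3 S \<gamma> s \<and> tangent_at Q M S (\<gamma> s)) \<longleftrightarrow> \<kappa>' s = 0"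
      and pr: "\<forall>s\<in>W. \<forall>e. principal_direction Q M (\<gamma> s) e \<longrightarrow>
        (vector_derivative \<gamma> (at s) \<bullet> e)\<^sup>2 = \<kappa> s * (e \<bullet> e) \<or>
        (vector_derivative \<gamma> (at s) \<bullet> e)\<^sup>2 = (1 - \<kappa> s) * (e \<bullet> e)"
      by (rule ex_local_angle_function[OF dupin us s\<^sub>0]) (rule that)
    have two: "\<kappa> s \<in> {(cos \<alpha>)\<^sup>2, 1 - (cos \<alpha>)\<^sup>2}" if s: "s \<in> W" for s
    proof -
      let ?v = "vector_derivative \<gamma> (at s)"
      have sJ: "s \<in> J" and sM: "\<gamma> s \<in> M" using s W(3) us by (auto simp: unit_speed_curve_def)
      obtain e where e: "principal_direction Q M (\<gamma> s) e" "P (\<gamma> s) = span {e}"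
        "e \<in> tangent_space M (\<gamma> s)" "e \<noteq> 0" using ex_principal_direction[OF sM] by blast
      note rot = rotation[OF sM e(3)]
      have "?v \<in> angle_foliation R P \<alpha> (\<gamma> s)" using int sJ by (simp add: integral_curve_def)
      then obtain r where r: "?v = r *\<^sub>R (cos \<alpha> *\<^sub>R e + sin \<alpha> *\<^sub>R R (\<gamma> s) e)"
        unfolding angle_foliation_iff[OF sM e(2)] by (elim exE)
      have "?v \<bullet> ?v = 1" using us sJ by (simp add: unit_speed_curve_def norm_eq_1)
      moreover have "?v \<bullet> ?v = (r * cos \<alpha>)\<^sup>2 * (e \<bullet> e) + (r * sin \<alpha>)\<^sup>2 * (e \<bullet> e)"
        unfolding r using rot by (simp add: inner_simps power2_eq_square algebra_simps)
      moreover have "\<dots> = r\<^sup>2 * (e \<bullet> e) * ((cos \<alpha>)\<^sup>2 + (sin \<alpha>)\<^sup>2)" by algebra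
      ultimately have r1: "r\<^sup>2 * (e \<bullet> e) = 1" by simp
      have "(?v \<bullet> e)\<^sup>2 = (r\<^sup>2 * (e \<bullet> e)) * ((cos \<alpha>)\<^sup>2 * (e \<bullet> e))"
        unfolding r using rot by (simp add: inner_simps power2_eq_square)
      then have "(?v \<bullet> e)\<^sup>2 = (cos \<alpha>)\<^sup>2 * (e \<bullet> e)" unfolding r1 by simp
      then show ?thesis using pr[rule_format, OF s e(1)] e(4) by auto
    qed
    obtain \<delta> where \<delta>: "\<delta> > 0" "ball s\<^sub>0 \<delta> \<subseteq> W" using W open_contains_ball by blast
    have "continuous_on (ball s\<^sub>0 \<delta>) \<kappa>"
    proof (rule continuous_at_imp_continuous_on, rule ballI)
      fix s assume "s \<in> ball s\<^sub>0 \<delta>"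
      then have "s \<in> W" using \<delta>(2) by auto
      then show "isCont \<kappa> s" by (rule DERIV_isCont[OF bspec[OF d]])
    qed
    moreover have "finite (\<kappa> ` ball s\<^sub>0 \<delta>)"
      by (rule finite_subset[OF image_subsetI[OF two[OF subsetD[OF \<delta>(2)]]]]) simp_all
    ultimately obtain c where c: "\<And>s. s \<in> ball s\<^sub>0 \<delta> \<Longrightarrow> \<kappa> s = c" by (rule constant_if_finite_range) (rule that)
    have "(\<kappa> has_vector_derivative \<kappa>' s\<^sub>0) (at s\<^sub>0)"
      using d W(2) by (simp add: has_real_derivative_iff_has_vector_derivative)
    from has_vector_derivative_constant_on_open[OF open_ball centre_in_ball[THEN iffD2, OF \<delta>(1)] c this]
    have "\<kappa>' s\<^sub>0 = 0" .
    then show ?thesis using iff W(2) by blast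
  qed
  then show ?thesis using us by (simp add: darboux_curve_def)
qed

text \<open>The function \<open>\<kappa>\<close> is now constant, which determines the squared
  components of the velocity up to exchange. In a continuous principal frame the components
  themselves are continuous with finitely many possible values, hence constant, and they are the
  cosine and sine of one angle. The orientation enters here, through the continuity of the second
  frame vector.\<close>

lemma darboux_local_angle:
  assumes dar: "darboux_curve Q M J \<gamma>" and s\<^sub>0: "s\<^sub>0 \<in> J"
  obtains \<delta> \<alpha> where "\<delta> > 0" "ball s\<^sub>0 \<delta> \<subseteq> J"
    "\<forall>s\<in>ball s\<^sub>0 \<delta>. vector_derivative \<gamma> (at s) \<in> angle_foliation R P \<alpha> (\<gamma> s)"
proof -
  have us: "unit_speed_curve M J \<gamma>" using dar by (simp add: darboux_curve_def)
  then have J: "open J" "\<gamma> ` J \<subseteq> M" by (auto simp: unit_speed_curve_def)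
  obtain W \<kappa> \<kappa>' where W: "open W" "s\<^sub>0 \<in> W" "W \<subseteq> J"
    and d: "\<forall>s\<in>W. (\<kappa> has_real_derivative \<kappa>' s) (at s)"
    and iff: "\<forall>s\<in>W. (\<exists>S. is_sphere Q S \<and> contact_order_ge 3 S \<gamma> s \<and> tangent_at Q M S (\<gamma> s)) \<longleftrightarrow> \<kappa>' s = 0"
    and pr: "\<forall>s\<in>W. \<forall>e. principal_direction Q M (\<gamma> s) e \<longrightarrow>
      (vector_derivative \<gamma> (at s) \<bullet> e)\<^sup>2 = \<kappa> s * (e \<bullet> e) \<or>
      (vector_derivative \<gamma> (at s) \<bullet> e)\<^sup>2 = (1 - \<kappa> s) * (e \<bullet> e)"
    by (rule ex_local_angle_function[OF dupin us s\<^sub>0]) (rule that)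
  have \<gamma>M: "\<gamma> s \<in> M" if "s \<in> W" for s using that W(3) J(2) by auto
  from principal[unfolded principal_foliation_def, rule_format, OF \<gamma>M[OF W(2)]]
  obtain V e where V: "open V" "\<gamma> s\<^sub>0 \<in> V" "continuous_on (M \<inter> V) e"
    and e: "\<forall>q\<in>M \<inter> V. principal_direction Q M q (e q) \<and> P q = span {e q}"
    by (elim exE conjE) (rule that)
  note vel = unit_speed_curve_velocity[OF us]
  have cont\<gamma>: "continuous_on W \<gamma>"
    using has_vector_derivative_continuous[OF vel(1)] W(3)
    by (intro continuous_at_imp_continuous_on) blast
  have "open (W \<inter> \<gamma> -` V)" using continuous_open_preimage[OF cont\<gamma> W(1) V(1)] .
  then obtain \<delta> where \<delta>: "\<delta> > 0" "ball s\<^sub>0 \<delta> \<subseteq> W \<inter> \<gamma> -` V"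
    using W(2) V(2) open_contains_ball by blast
  let ?B = "ball s\<^sub>0 \<delta>"
  define v where "v s = vector_derivative \<gamma> (at s)" for s
  define \<epsilon> where "\<epsilon> s = e (\<gamma> s)" for s
  have B: "s \<in> W" "\<gamma> s \<in> M \<inter> V" "s \<in> J" if "s \<in> ?B" for s using \<delta>(2) that \<gamma>M W(3) by auto
  have \<epsilon>: "principal_direction Q M (\<gamma> s) (\<epsilon> s)" "P (\<gamma> s) = span {\<epsilon> s}" if "s \<in> ?B" for s
    using e B(2)[OF that] by (auto simp: \<epsilon>_def)
  then have \<epsilon>T: "\<epsilon> s \<in> tangent_space M (\<gamma> s)" "\<epsilon> s \<noteq> 0" if "s \<in> ?B" for s
    using that by (auto simp: principal_direction_def)
  have rot: "R (\<gamma> s) (\<epsilon> s) \<bullet> R (\<gamma> s) (\<epsilon> s) = \<epsilon> s \<bullet> \<epsilon> s" "R (\<gamma> s) (\<epsilon> s) \<bullet> \<epsilon> s = 0" "\<epsilon> s \<bullet> R (\<gamma> s) (\<epsilon> s) = 0" if "s \<in> ?B" for s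
    using rotation[of "\<gamma> s" "\<epsilon> s"] B(2)[OF that] \<epsilon>T(1)[OF that] by auto
  \<comment> \<open>The frame vectors have the common length \<open>norm (\<epsilon> s)\<close>, not
    1; the division makes \<open>x\<close> and \<open>y\<close> a point of the unit circle.\<close>
  define x where "x s = (v s \<bullet> \<epsilon> s) / norm (\<epsilon> s)" for s
  define y where "y s = (v s \<bullet> R (\<gamma> s) (\<epsilon> s)) / norm (\<epsilon> s)" for s
  have frame: "v s = (1 / norm (\<epsilon> s)) *\<^sub>R (x s *\<^sub>R \<epsilon> s + y s *\<^sub>R R (\<gamma> s) (\<epsilon> s))" if "s \<in> ?B" for s
    using tangent_frame[of "\<gamma> s" "\<epsilon> s" "v s"] B(2)[OF that] \<epsilon>T[OF that] vel(2)[OF B(3)[OF that]]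
    by (simp add: v_def x_def y_def power2_norm_eq_inner[symmetric] power2_eq_square scaleR_add_right)
  have unit: "(x s)\<^sup>2 + (y s)\<^sup>2 = 1" if "s \<in> ?B" for s
  proof -
    have "v s \<bullet> v s = 1" using us B(3)[OF that] by (simp add: v_def unit_speed_curve_def norm_eq_1)
    moreover have "v s \<bullet> v s = (1 / norm (\<epsilon> s))\<^sup>2 * ((x s)\<^sup>2 + (y s)\<^sup>2) * (\<epsilon> s \<bullet> \<epsilon> s)"
      by (subst (1 2) frame[OF that]) (simp add: rot[OF that] inner_simps power2_eq_square algebra_simps)
    ultimately show ?thesis
      using \<epsilon>T(2)[OF that] by (simp add: power2_norm_eq_inner[symmetric] power_divide)
  qed
  have "continuous_on ?B \<gamma>" by (rule continuous_on_subset[OF cont\<gamma>]) (use B in auto)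
  then have cont\<epsilon>: "continuous_on ?B \<epsilon>"
    unfolding \<epsilon>_def by (rule continuous_on_compose2[OF V(3)]) (use B in auto)
  have "continuous_on (SIGMA p:M. tangent_space M p) (\<lambda>(p, v). R p v)"
    using orientation by (simp add: surface_orientation_def)
  then have contR: "continuous_on ?B (\<lambda>s. (\<lambda>(p, v). R p v) (\<gamma> s, \<epsilon> s))"
    by (rule continuous_on_compose2)
      (use \<open>continuous_on ?B \<gamma>\<close> cont\<epsilon> B \<epsilon>T in \<open>auto intro!: continuous_on_Pair\<close>)
  have contv: "continuous_on ?B v"
    unfolding v_def by (rule continuous_on_subset[OF vel(3)[OF s\<^sub>0]]) (use B in auto)
  have contxy: "continuous_on ?B x" "continuous_on ?B y"
    unfolding x_def[abs_def] y_def[abs_def] using contv cont\<epsilon> contR \<epsilon>T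
    by (auto intro!: continuous_on_divide continuous_on_inner continuous_on_norm)
  have osc: "\<forall>s\<in>J. \<exists>S. is_sphere Q S \<and> contact_order_ge 3 S \<gamma> s \<and> tangent_at Q M S (\<gamma> s)"
    using dar unfolding darboux_curve_def by (rule conjunct2)
  have "\<kappa>' s = 0" if "s \<in> W" for s
    by (rule iffD1[OF bspec[OF iff that] bspec[OF osc subsetD[OF W(3) that]]])
  then have "(\<kappa> has_real_derivative 0) (at s)" if "s \<in> ?B" for s
    using d B(1)[OF that] by metis
  then obtain k where k: "\<And>s. s \<in> ?B \<Longrightarrow> \<kappa> s = k"
    using DERIV_zero_connected_constant[OF connected_ball open_ball finite.emptyI, of s\<^sub>0 \<delta> \<kappa>]
      continuous_at_imp_continuous_on[of ?B \<kappa>] DERIV_isCont by (metis Diff_empty)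
  have x2: "(x s)\<^sup>2 = k \<or> (x s)\<^sup>2 = 1 - k" if "s \<in> ?B" for s
    using pr[rule_format, OF B(1)[OF that] \<epsilon>(1)[OF that]] \<epsilon>T(2)[OF that] k[OF that]
    by (auto simp: x_def v_def power_divide power2_norm_eq_inner)
  then have y2: "(y s)\<^sup>2 = k \<or> (y s)\<^sup>2 = 1 - k" if "s \<in> ?B" for s
    using unit[OF that] that by fastforce
  let ?F = "{sqrt k, - sqrt k, sqrt (1 - k), - sqrt (1 - k)}"
  have "z = sqrt a \<or> z = - sqrt a" if "a = z\<^sup>2" for z a :: real
    unfolding that by (auto simp: abs_if)
  then have root: "z \<in> ?F" if "z\<^sup>2 = k \<or> z\<^sup>2 = 1 - k" for z
    using that by (elim disjE) (metis insertCI)+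
  have "x ` ?B \<subseteq> ?F" "y ` ?B \<subseteq> ?F"
    by (rule image_subsetI[OF root[OF x2]], assumption) (rule image_subsetI[OF root[OF y2]])
  then have "finite (x ` ?B)" "finite (y ` ?B)" by (auto intro: finite_subset)
  then obtain x0 y0 where xy: "\<And>s. s \<in> ?B \<Longrightarrow> x s = x0" "\<And>s. s \<in> ?B \<Longrightarrow> y s = y0"
    using constant_if_finite_range[OF contxy(1)] constant_if_finite_range[OF contxy(2)] by metis
  then obtain \<alpha> where \<alpha>: "x0 = cos \<alpha>" "y0 = sin \<alpha>"
    using unit[of s\<^sub>0] \<delta>(1) sincos_total_2pi by (metis centre_in_ball)
  have "v s \<in> angle_foliation R P \<alpha> (\<gamma> s)" if "s \<in> ?B" for s
    using frame[OF that] xy[OF that] B(2)[OF that] \<alpha> angle_foliation_iff[OF _ \<epsilon>(2)[OF that]] by auto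
  moreover have "?B \<subseteq> J" using B(3) by (rule subsetI)
  ultimately show thesis using that[OF \<delta>(1)] unfolding v_def by blast
qed

text \<open>The set \<open>K \<alpha>\<close> of parameters with angle \<open>\<alpha>\<close> is
  open in \<open>J\<close> and so is its complement, because the angle is constant near each
  parameter. Connectedness gives one angle for all of \<open>J\<close>.\<close>

lemma darboux_imp_integral_curve:
  assumes dar: "darboux_curve Q M J \<gamma>"
  obtains \<alpha> where "integral_curve M (angle_foliation R P \<alpha>) J \<gamma>"
proof -
  have us: "unit_speed_curve M J \<gamma>" using dar by (simp add: darboux_curve_def)
  then have J: "open J" "connected J" "J \<noteq> {}" "\<gamma> ` J \<subseteq> M"
    and v0: "\<And>s. s \<in> J \<Longrightarrow> vector_derivative \<gamma> (at s) \<noteq> 0"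
    by (force simp: unit_speed_curve_def is_interval_connected_1)+
  define K where "K \<alpha> = {s \<in> J. vector_derivative \<gamma> (at s) \<in> angle_foliation R P \<alpha> (\<gamma> s)}" for \<alpha>
  have loc: "\<exists>\<delta>>0. ball s \<delta> \<subseteq> K \<alpha> \<or> ball s \<delta> \<subseteq> J - K \<alpha>" if s: "s \<in> J" for s \<alpha>
  proof -
    obtain \<delta> \<beta> where \<delta>: "\<delta> > 0" "ball s \<delta> \<subseteq> J"
      "\<forall>s\<in>ball s \<delta>. vector_derivative \<gamma> (at s) \<in> angle_foliation R P \<beta> (\<gamma> s)"
      by (rule darboux_local_angle[OF dar s]) (rule that)
    \<comment> \<open>One parameter of the ball at which both \<open>\<alpha>\<close> and the local
      angle \<open>\<beta>\<close> describe the velocity identifies the two line fields on all of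
      \<open>M\<close>.\<close>
    have "ball s \<delta> \<subseteq> K \<alpha>" if t: "t \<in> ball s \<delta>" "t \<in> K \<alpha>" for t
    proof
      fix r assume r: "r \<in> ball s \<delta>"
      have "angle_foliation R P \<alpha> (\<gamma> r) = angle_foliation R P \<beta> (\<gamma> r)"
        using angle_foliation_unique[of "\<gamma> t" "vector_derivative \<gamma> (at t)" \<alpha> \<beta> "\<gamma> r"] t r \<delta> J(4) v0[of t]
        by (auto simp: K_def subset_iff)
      then show "r \<in> K \<alpha>" using \<delta>(2,3) r by (auto simp: K_def)
    qed
    then show ?thesis using \<delta>(1,2) by blast
  qed
  have openK: "open (K \<alpha>)" "open (J - K \<alpha>)" for \<alpha>
  proof -
    show "open (K \<alpha>)" unfolding open_contains_ball
    proof
      fix s assume s: "s \<in> K \<alpha>"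
      then have "s \<in> J" by (simp add: K_def)
      from loc[OF this] obtain \<delta> where "\<delta> > 0" "ball s \<delta> \<subseteq> K \<alpha> \<or> ball s \<delta> \<subseteq> J - K \<alpha>" by blast
      moreover from this have "s \<in> ball s \<delta>" by simp
      ultimately show "\<exists>\<delta>>0. ball s \<delta> \<subseteq> K \<alpha>" using s by blast
    qed
    show "open (J - K \<alpha>)" unfolding open_contains_ball
    proof
      fix s assume s: "s \<in> J - K \<alpha>"
      then have "s \<in> J" by simp
      from loc[OF this] obtain \<delta> where "\<delta> > 0" "ball s \<delta> \<subseteq> K \<alpha> \<or> ball s \<delta> \<subseteq> J - K \<alpha>" by blast
      moreover from this have "s \<in> ball s \<delta>" by simp
      ultimately show "\<exists>\<delta>>0. ball s \<delta> \<subseteq> J - K \<alpha>" using s by blast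
    qed
  qed
  obtain s\<^sub>0 where s\<^sub>0: "s\<^sub>0 \<in> J" using J(3) by blast
  obtain \<delta> \<alpha> where \<delta>: "\<delta> > 0"
    "\<forall>s\<in>ball s\<^sub>0 \<delta>. vector_derivative \<gamma> (at s) \<in> angle_foliation R P \<alpha> (\<gamma> s)"
    by (rule darboux_local_angle[OF dar s\<^sub>0]) (rule that)
  then have "s\<^sub>0 \<in> K \<alpha>" using s\<^sub>0 by (simp add: K_def)
  then have "J - K \<alpha> = {}"
    using connectedD[OF J(2) openK[of \<alpha>]] s\<^sub>0 by blast
  then have "integral_curve M (angle_foliation R P \<alpha>) J \<gamma>"
    using us by (auto simp: integral_curve_def K_def)
  then show thesis by (rule that)
qed

lemma darboux_iff_integral_curve:
  "darboux_curve Q M J \<gamma> \<longleftrightarrow> (\<exists>\<alpha>. integral_curve M (angle_foliation R P \<alpha>) J \<gamma>)"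
proof
  assume "darboux_curve Q M J \<gamma>"
  then show "\<exists>\<alpha>. integral_curve M (angle_foliation R P \<alpha>) J \<gamma>"
    by (rule darboux_imp_integral_curve) (rule exI)
next
  assume "\<exists>\<alpha>. integral_curve M (angle_foliation R P \<alpha>) J \<gamma>"
  then show "darboux_curve Q M J \<gamma>" by (elim exE) (rule integral_curve_imp_darboux)
qed

text \<open>Maximality refers to different classes: an extension of a leaf as a Darboux curve could
  a priori follow another angle \<open>\<beta>\<close>. On the old interval both angles describe the
  same velocity, so the two line fields coincide and the extension stays in the class.\<close>

lemma inextendible_darboux_iff_leaf:
  "inextendible (darboux_curve Q M) J \<gamma> \<longleftrightarrow> (\<exists>\<alpha>. leaf M (angle_foliation R P \<alpha>) J \<gamma>)"
proof
  assume dar: "inextendible (darboux_curve Q M) J \<gamma>"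
  then have "darboux_curve Q M J \<gamma>" by (simp add: inextendible_def)
  then obtain \<alpha> where "integral_curve M (angle_foliation R P \<alpha>) J \<gamma>"
    by (rule darboux_imp_integral_curve)
  moreover have "J' = J" if "integral_curve M (angle_foliation R P \<alpha>) J' \<gamma>'" "J \<subseteq> J'"
    "\<forall>s\<in>J. \<gamma>' s = \<gamma> s" for J' \<gamma>'
  proof -
    have "\<forall>J' \<gamma>'. darboux_curve Q M J' \<gamma>' \<and> J \<subseteq> J' \<and> (\<forall>s\<in>J. \<gamma>' s = \<gamma> s) \<longrightarrow> J' = J"
      using dar unfolding inextendible_def by (rule conjunct2)
    from this[rule_format, of J' \<gamma>'] show ?thesis
      using that(2,3) integral_curve_imp_darboux[OF that(1)] by simp
  qed
  ultimately have "leaf M (angle_foliation R P \<alpha>) J \<gamma>"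
    unfolding leaf_def inextendible_def by auto
  then show "\<exists>\<alpha>. leaf M (angle_foliation R P \<alpha>) J \<gamma>" by blast
next
  assume "\<exists>\<alpha>. leaf M (angle_foliation R P \<alpha>) J \<gamma>"
  then obtain \<alpha> where leaf: "leaf M (angle_foliation R P \<alpha>) J \<gamma>" by blast
  then have int: "integral_curve M (angle_foliation R P \<alpha>) J \<gamma>"
    by (simp add: leaf_def inextendible_def)
  then have J: "open J" "is_interval J" "J \<noteq> {}" "\<gamma> ` J \<subseteq> M"
    by (auto simp: integral_curve_def unit_speed_curve_def)
  then obtain s where s: "s \<in> J" by blast
  have "J' = J" if J': "darboux_curve Q M J' \<gamma>'" "J \<subseteq> J'" "\<forall>s\<in>J. \<gamma>' s = \<gamma> s" for J' \<gamma>'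
  proof -
    obtain \<beta> where int': "integral_curve M (angle_foliation R P \<beta>) J' \<gamma>'"
      using J'(1) darboux_iff_integral_curve by blast
    have "integral_curve M (angle_foliation R P \<beta>) J \<gamma>"
      using integral_curve_subset_cong[OF int' J(1-3) J'(2)] J'(3) by simp
    then have v: "vector_derivative \<gamma> (at s) \<in> angle_foliation R P \<alpha> (\<gamma> s)"
      "vector_derivative \<gamma> (at s) \<in> angle_foliation R P \<beta> (\<gamma> s)"
      "norm (vector_derivative \<gamma> (at s)) = 1" "\<gamma> s \<in> M"
      using int s J(4) by (auto simp: integral_curve_def unit_speed_curve_def)
    then have "vector_derivative \<gamma> (at s) \<noteq> 0" by auto
    from leaf_cong[OF angle_foliation_unique[OF v(4,1,2) this]]
    have "leaf M (angle_foliation R P \<beta>) J \<gamma>" using leaf by simp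
    then show ?thesis using int' J'(2,3) unfolding leaf_def inextendible_def by auto
  qed
  then show "inextendible (darboux_curve Q M) J \<gamma>"
    using integral_curve_imp_darboux[OF int] unfolding inextendible_def by auto
qed

text \<open>Angles modulo \<pi> describe the line fields, so the signed angles of the half-open
  interval and all real angles give the same collection of leaves.\<close>

lemma ex_leaf_angle_range_iff:
  "(\<exists>\<alpha>\<in>{-pi/2<..pi/2}. leaf M (angle_foliation R P \<alpha>) J \<gamma> \<or> leaf M (angle_foliation R P (-\<alpha>)) J \<gamma>) \<longleftrightarrow>
    (\<exists>\<alpha>. leaf M (angle_foliation R P \<alpha>) J \<gamma>)"
proof
  assume "\<exists>\<alpha>. leaf M (angle_foliation R P \<alpha>) J \<gamma>"
  then obtain \<beta> where \<beta>: "leaf M (angle_foliation R P \<beta>) J \<gamma>" by blast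
  obtain \<alpha> where \<alpha>: "\<alpha> \<in> {-pi/2<..pi/2}"
    "\<And>p. p \<in> M \<Longrightarrow> angle_foliation R P \<alpha> p = angle_foliation R P \<beta> p"
    by (rule angle_foliation_range) (rule that)
  have "leaf M (angle_foliation R P \<alpha>) J \<gamma>"
    using leaf_cong[of M "angle_foliation R P \<alpha>" "angle_foliation R P \<beta>"] \<alpha>(2) \<beta> by simp
  then show "\<exists>\<alpha>\<in>{-pi/2<..pi/2}. leaf M (angle_foliation R P \<alpha>) J \<gamma> \<or> leaf M (angle_foliation R P (-\<alpha>)) J \<gamma>"
    using \<alpha>(1) by blast
qed blast

text \<open>A Darboux curve follows one angle and extends to a maximal integral curve of that line
  field; conversely, being an integral curve passes to open subintervals.\<close>

lemma darboux_iff_part_of_leaf: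
  "darboux_curve Q M J \<gamma> \<longleftrightarrow> (\<exists>J' \<gamma>'. (\<exists>\<alpha>. leaf M (angle_foliation R P \<alpha>) J' \<gamma>') \<and>
     open J \<and> is_interval J \<and> J \<noteq> {} \<and> J \<subseteq> J' \<and> (\<forall>s\<in>J. \<gamma> s = \<gamma>' s))"
proof
  assume dar: "darboux_curve Q M J \<gamma>"
  then obtain \<alpha> where "integral_curve M (angle_foliation R P \<alpha>) J \<gamma>"
    by (rule darboux_imp_integral_curve)
  then obtain J' \<gamma>' where "leaf M (angle_foliation R P \<alpha>) J' \<gamma>'" "J \<subseteq> J'" "\<forall>s\<in>J. \<gamma> s = \<gamma>' s"
    by (rule integral_curve_extends_to_leaf)
  moreover have "open J" "is_interval J" "J \<noteq> {}"
    using dar by (auto simp: darboux_curve_def unit_speed_curve_def)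
  ultimately show "\<exists>J' \<gamma>'. (\<exists>\<alpha>. leaf M (angle_foliation R P \<alpha>) J' \<gamma>') \<and>
     open J \<and> is_interval J \<and> J \<noteq> {} \<and> J \<subseteq> J' \<and> (\<forall>s\<in>J. \<gamma> s = \<gamma>' s)"
    by blast
next
  assume "\<exists>J' \<gamma>'. (\<exists>\<alpha>. leaf M (angle_foliation R P \<alpha>) J' \<gamma>') \<and>
     open J \<and> is_interval J \<and> J \<noteq> {} \<and> J \<subseteq> J' \<and> (\<forall>s\<in>J. \<gamma> s = \<gamma>' s)"
  then show "darboux_curve Q M J \<gamma>"
    using integral_curve_subset_cong integral_curve_imp_darboux
    unfolding leaf_def inextendible_def by metis
qed

end

theorem proposition15:
  fixes Q M :: "'a::euclidean_space set"
    and P\<^sub>1 :: "'a \<Rightarrow> 'a set"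
    and R :: "'a \<Rightarrow> 'a \<Rightarrow> 'a"
  assumes "ambient_space Q"
    and "dupin_cyclide Q M"
    and "principal_foliation Q M P\<^sub>1"
    and "surface_orientation M R"
  shows "(\<forall>J \<gamma>. inextendible (darboux_curve Q M) J \<gamma> \<longleftrightarrow>
            (\<exists>\<alpha>\<in>{-pi/2<..pi/2}. leaf M (angle_foliation R P\<^sub>1 \<alpha>) J \<gamma> \<or>
                                 leaf M (angle_foliation R P\<^sub>1 (-\<alpha>)) J \<gamma>)) \<and>
         (\<forall>J \<gamma>. darboux_curve Q M J \<gamma> \<longleftrightarrow>
            (\<exists>\<alpha>\<in>{-pi/2<..pi/2}. \<exists>J' \<gamma>'.
               (leaf M (angle_foliation R P\<^sub>1 \<alpha>) J' \<gamma>' \<or>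
                leaf M (angle_foliation R P\<^sub>1 (-\<alpha>)) J' \<gamma>') \<and>
               open J \<and> is_interval J \<and> J \<noteq> {} \<and> J \<subseteq> J' \<and> (\<forall>s\<in>J. \<gamma> s = \<gamma>' s)))"
proof -
  interpret foliated_cyclide Q M P\<^sub>1 R
    by unfold_locales (use assms in \<open>simp_all add: dupin_cyclide_def\<close>)
  show ?thesis
    unfolding inextendible_darboux_iff_leaf darboux_iff_part_of_leaf ex_leaf_angle_range_iff[symmetric]
    by blast
qed

end
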